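(* Let $\lambda$ be a partition of $n+1$ and let $F$ be a field of characteristic $p>2$. Suppose that $\alpha\neq\beta$ are partitions of $n$ obtained by removing from $\lambda$ a node of residue $r_\alpha$, respectively $r_\beta$, with $\alpha\unrhd\beta$ (dominance order). Let $\theta:S_F^\alpha\to S_F^\beta$ be an $F\Sigma_n$-homomorphism, and let $i\ge 0$ be an integer. If $p^i$ divides $r_\alpha-r_\beta$, then $\theta(S_F^\alpha)$ is contained in the $i$-th Jantzen submodule of $S_F^\beta$.
   Context: For a ring $R$, $M_R^\beta$ is the free $R$-module on the $\beta$-tabloids, with its permutation action of $\Sigma_n$, and $S_R^\beta\subseteq M_R^\beta$ is the Specht module, the $R$-span of the polytabloids. The residue of the node in row $i$, column $j$ of a Young diagram is the integer $j-i$. Let $\langle\,,\,\rangle$ be the symmetric bilinear form on $M^\beta_{\mathbb Z}$ for which the $\beta$-tabloids are orthonormal. For $i\geq0$ put $J^i(S_{\mathbb Z}^\beta)=\{x\in S_{\mathbb Z}^\beta\mid \langle x,S_{\mathbb Z}^\beta\rangle\subseteq p^i\mathbb Z\}$. The $i$-th Jantzen submodule of $S_F^\beta$ is the ($F$-span of the) image of $J^i(S_{\mathbb Z}^\beta)$ under reduction modulo $p$, $S_{\mathbb Z}^\beta\to S_{\mathbb Z}^\beta/pS_{\mathbb Z}^\beta$ (with scalars extended to $F$). *)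

theory Defs
  imports
    Complex_Main
    "HOL-Combinatorics.Permutations"
    "HOL-Library.Function_Algebras"
    "HOL-Library.FuncSet"
begin

text \<open>A partition is the sequence of its parts, padded with zeros. Rows and columns
  are numbered from 0; residues, being differences of the two, are not affected.\<close>

type_synonym node = "nat \<times> nat"

definition is_partition :: "nat \<Rightarrow> (nat \<Rightarrow> nat) \<Rightarrow> bool" where
  "is_partition n \<beta> \<longleftrightarrow>
     antimono \<beta> \<and> finite {i. \<beta> i \<noteq> 0} \<and> (\<Sum>i | \<beta> i \<noteq> 0. \<beta> i) = n"

definition diagram :: "(nat \<Rightarrow> nat) \<Rightarrow> node set" where
  "diagram \<beta> = {(i, j). j < \<beta> i}"

definition diagram_row :: "(nat \<Rightarrow> nat) \<Rightarrow> nat \<Rightarrow> node set" where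
  "diagram_row \<beta> i = {x \<in> diagram \<beta>. fst x = i}"

definition diagram_col :: "(nat \<Rightarrow> nat) \<Rightarrow> nat \<Rightarrow> node set" where
  "diagram_col \<beta> j = {x \<in> diagram \<beta>. snd x = j}"

definition residue :: "node \<Rightarrow> int" where
  "residue x = int (snd x) - int (fst x)"

definition dominates :: "(nat \<Rightarrow> nat) \<Rightarrow> (nat \<Rightarrow> nat) \<Rightarrow> bool" (infix "\<unrhd>" 50) where
  "\<alpha> \<unrhd> \<beta> \<longleftrightarrow> (\<forall>k. (\<Sum>i<k. \<beta> i) \<le> (\<Sum>i<k. \<alpha> i))"

text \<open>A tableau of a partition of \<open>n\<close> takes the dummy value 0 off the diagram. The entries are
  \<open>1, \<dots>, n\<close>, so permutations of the entries fix 0, and composing with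
  one of them maps tableaux to tableaux.\<close>

type_synonym tableau = "node \<Rightarrow> nat"

type_synonym tabloid = "tableau set"

definition tableaux :: "(nat \<Rightarrow> nat) \<Rightarrow> tableau set" where
  "tableaux \<beta> = {t. bij_betw t (diagram \<beta>) {1..card (diagram \<beta>)} \<and> (\<forall>x. x \<notin> diagram \<beta> \<longrightarrow> t x = 0)}"

definition tabloid_of :: "(nat \<Rightarrow> nat) \<Rightarrow> tableau \<Rightarrow> tabloid" where
  "tabloid_of \<beta> t = {s \<in> tableaux \<beta>. \<forall>i. s ` diagram_row \<beta> i = t ` diagram_row \<beta> i}"

definition tabloids :: "(nat \<Rightarrow> nat) \<Rightarrow> tabloid set" where
  "tabloids \<beta> = tabloid_of \<beta> ` tableaux \<beta>"

definition column_stabilizer :: "(nat \<Rightarrow> nat) \<Rightarrow> tableau \<Rightarrow> (nat \<Rightarrow> nat) set" where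
  "column_stabilizer \<beta> t =
     {\<pi>. \<pi> permutes {1..card (diagram \<beta>)} \<and>
         (\<forall>j. \<pi> ` (t ` diagram_col \<beta> j) = t ` diagram_col \<beta> j)}"

text \<open>The free \<open>R\<close>-module on the \<open>\<beta>\<close>-tabloids consists of the coefficient functions that vanish
  off the (finite) set of \<open>\<beta>\<close>-tabloids, with pointwise operations.\<close>

definition scale :: "'r::comm_ring_1 \<Rightarrow> (tabloid \<Rightarrow> 'r) \<Rightarrow> tabloid \<Rightarrow> 'r" where
  "scale c x = (\<lambda>T. c * x T)"

interpretation tabloid_module: module "scale :: 'r::comm_ring_1 \<Rightarrow> (tabloid \<Rightarrow> 'r) \<Rightarrow> tabloid \<Rightarrow> 'r"
  by standard (simp_all add: scale_def fun_eq_iff algebra_simps)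

definition tabloid_basis :: "tabloid \<Rightarrow> tabloid \<Rightarrow> 'r::comm_ring_1" where
  "tabloid_basis T = (\<lambda>U. if U = T then 1 else 0)"

definition perm_module :: "(nat \<Rightarrow> nat) \<Rightarrow> (tabloid \<Rightarrow> 'r::comm_ring_1) set" where
  "perm_module \<beta> = {x. \<forall>T. T \<notin> tabloids \<beta> \<longrightarrow> x T = 0}"

text \<open>The linear extension of \<open>{t} \<mapsto> {\<pi> \<circ> t}\<close>; see \<open>perm_action_basis\<close> below.\<close>

definition perm_action :: "(nat \<Rightarrow> nat) \<Rightarrow> (tabloid \<Rightarrow> 'r::comm_ring_1) \<Rightarrow> tabloid \<Rightarrow> 'r" where
  "perm_action \<pi> x = (\<lambda>T. x ((\<circ>) (inv \<pi>) ` T))"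

lemma comp_in_tableaux:
  assumes "\<pi> permutes {1..card (diagram \<beta>)}" and "t \<in> tableaux \<beta>"
  shows "\<pi> \<circ> t \<in> tableaux \<beta>"
  using assms permutes_imp_bij[OF assms(1)] permutes_not_in[OF assms(1), of 0]
  unfolding tableaux_def by (auto intro: bij_betw_trans)

lemma comp_image_tabloid:
  assumes \<pi>: "\<pi> permutes {1..card (diagram \<beta>)}"
  shows "(\<circ>) \<pi> ` tabloid_of \<beta> t = tabloid_of \<beta> (\<pi> \<circ> t)"
proof
  show "(\<circ>) \<pi> ` tabloid_of \<beta> t \<subseteq> tabloid_of \<beta> (\<pi> \<circ> t)"
  proof
    fix u assume "u \<in> (\<circ>) \<pi> ` tabloid_of \<beta> t"
    then obtain s where "s \<in> tabloid_of \<beta> t" and u: "u = \<pi> \<circ> s" by blast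
    then have s: "s \<in> tableaux \<beta>" "\<And>i. s ` diagram_row \<beta> i = t ` diagram_row \<beta> i"
      by (simp_all add: tabloid_of_def)
    have "u ` diagram_row \<beta> i = (\<pi> \<circ> t) ` diagram_row \<beta> i" for i
      unfolding u by (metis s(2) image_comp)
    then show "u \<in> tabloid_of \<beta> (\<pi> \<circ> t)"
      using comp_in_tableaux[OF \<pi> s(1)] by (simp add: tabloid_of_def u)
  qed
  show "tabloid_of \<beta> (\<pi> \<circ> t) \<subseteq> (\<circ>) \<pi> ` tabloid_of \<beta> t"
  proof
    fix s assume s: "s \<in> tabloid_of \<beta> (\<pi> \<circ> t)"
    have "inv \<pi> \<circ> s \<in> tableaux \<beta>"
      using s comp_in_tableaux[OF permutes_inv[OF \<pi>]] by (simp add: tabloid_of_def)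
    moreover have "(inv \<pi> \<circ> s) ` diagram_row \<beta> i = t ` diagram_row \<beta> i" for i
    proof -
      have "(inv \<pi> \<circ> s) ` diagram_row \<beta> i = inv \<pi> ` ((\<pi> \<circ> t) ` diagram_row \<beta> i)"
        using s unfolding tabloid_of_def mem_Collect_eq by (metis image_comp)
      then show ?thesis
        by (simp add: permutes_inverses(2)[OF \<pi>] image_image)
    qed
    ultimately have "inv \<pi> \<circ> s \<in> tabloid_of \<beta> t"
      by (simp add: tabloid_of_def)
    moreover have "s = \<pi> \<circ> (inv \<pi> \<circ> s)"
      using permutes_inv_o(1)[OF \<pi>] by (simp add: o_assoc)
    ultimately show "s \<in> (\<circ>) \<pi> ` tabloid_of \<beta> t" by blast
  qed
qed

lemma perm_action_basis:
  assumes \<pi>: "\<pi> permutes {1..card (diagram \<beta>)}"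
  shows "perm_action \<pi> (tabloid_basis (tabloid_of \<beta> t)) = tabloid_basis (tabloid_of \<beta> (\<pi> \<circ> t))"
proof -
  have "(\<circ>) \<pi> \<circ> (\<circ>) (inv \<pi>) = id" "(\<circ>) (inv \<pi>) \<circ> (\<circ>) \<pi> = id"
    using permutes_inv_o[OF \<pi>] by (simp_all add: fun_eq_iff)
  then have "(\<circ>) (inv \<pi>) ` T = tabloid_of \<beta> t \<longleftrightarrow> T = (\<circ>) \<pi> ` tabloid_of \<beta> t" for T
    by (metis image_comp image_id id_apply)
  then show ?thesis
    by (simp add: perm_action_def tabloid_basis_def comp_image_tabloid[OF \<pi>] fun_eq_iff)
qed

definition polytabloid :: "(nat \<Rightarrow> nat) \<Rightarrow> tableau \<Rightarrow> tabloid \<Rightarrow> 'r::comm_ring_1" where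
  "polytabloid \<beta> t =
     (\<Sum>\<pi>\<in>column_stabilizer \<beta> t. scale (of_int (sign \<pi>)) (tabloid_basis (tabloid_of \<beta> (\<pi> \<circ> t))))"

definition specht :: "(nat \<Rightarrow> nat) \<Rightarrow> (tabloid \<Rightarrow> 'r::comm_ring_1) set" where
  "specht \<beta> = tabloid_module.span (polytabloid \<beta> ` tableaux \<beta>)"

lemma specht_subset_perm_module: "specht \<beta> \<subseteq> perm_module \<beta>"
proof -
  have sub: "tabloid_module.subspace (perm_module \<beta>)"
    by (simp add: tabloid_module.subspace_def perm_module_def scale_def)
  have "polytabloid \<beta> t \<in> perm_module \<beta>" if "t \<in> tableaux \<beta>" for t
    unfolding polytabloid_def
    using that comp_in_tableaux[of _ \<beta> t]
    by (intro tabloid_module.subspace_sum[OF sub] tabloid_module.subspace_scale[OF sub])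
       (auto simp: perm_module_def tabloid_basis_def tabloids_def column_stabilizer_def)
  then show ?thesis
    unfolding specht_def by (intro tabloid_module.span_minimal sub) auto
qed

text \<open>Homomorphisms of \<open>R\<Sigma>\<^sub>n\<close>-modules; only the values on \<open>U\<close> are constrained.\<close>

definition sym_hom :: "nat \<Rightarrow> (tabloid \<Rightarrow> 'r::comm_ring_1) set \<Rightarrow> (tabloid \<Rightarrow> 'r) set \<Rightarrow>
    ((tabloid \<Rightarrow> 'r) \<Rightarrow> tabloid \<Rightarrow> 'r) set" where
  "sym_hom n U V =
     {\<theta> \<in> U \<rightarrow> V.
        (\<forall>x\<in>U. \<forall>y\<in>U. \<theta> (x + y) = \<theta> x + \<theta> y) \<and>
        (\<forall>c. \<forall>x\<in>U. \<theta> (scale c x) = scale c (\<theta> x)) \<and>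
        (\<forall>\<pi>. \<pi> permutes {1..n} \<longrightarrow> (\<forall>x\<in>U. \<theta> (perm_action \<pi> x) = perm_action \<pi> (\<theta> x)))}"

definition tabloid_form :: "(nat \<Rightarrow> nat) \<Rightarrow> (tabloid \<Rightarrow> int) \<Rightarrow> (tabloid \<Rightarrow> int) \<Rightarrow> int" where
  "tabloid_form \<beta> x y = (\<Sum>T\<in>tabloids \<beta>. x T * y T)"

definition jantzen_lattice :: "nat \<Rightarrow> nat \<Rightarrow> (nat \<Rightarrow> nat) \<Rightarrow> (tabloid \<Rightarrow> int) set" where
  "jantzen_lattice p i \<beta> =
     {x \<in> specht \<beta>. \<forall>y\<in>specht \<beta>. int p ^ i dvd tabloid_form \<beta> x y}"

text \<open>Reduction of coefficients in characteristic \<open>p\<close>. The integral Specht module is a pure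
  sublattice of the integral permutation module, so its elements of zero reduction are its
  multiples of \<open>p\<close>: this realises the quotient modulo \<open>p\<close>, extended to the field \<open>'f\<close>, inside
  the permutation module over \<open>'f\<close>.\<close>

definition reduction :: "(tabloid \<Rightarrow> int) \<Rightarrow> tabloid \<Rightarrow> 'f::field" where
  "reduction x = (\<lambda>T. of_int (x T))"

definition jantzen_submodule :: "nat \<Rightarrow> (nat \<Rightarrow> nat) \<Rightarrow> (tabloid \<Rightarrow> 'f::field) set" where
  "jantzen_submodule i \<beta> = tabloid_module.span (reduction ` jantzen_lattice CHAR('f) i \<beta>)"

end

theory Submission
  imports Defs
begin

text \<open>Write \<open>\<alpha> = \<lambda> - a\<close>, \<open>\<beta> = \<lambda> - b\<close>; dominance puts \<open>a\<close> below \<open>b\<close>. Restrict the integral Specht module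
  of \<open>\<lambda>\<close> to \<open>\<Sigma>\<^sub>n\<close> and filter it by the column of \<open>n + 1\<close>; the Jucys--Murphy element
  \<open>L = (1, n+1) + \<dots> + (n, n+1)\<close> acts on the sections by the residues of the removable nodes. The
  product of the \<open>L - r\<close> over the residues \<open>r\<close> of the removable nodes from \<open>a\<close> up to, but
  excluding, \<open>b\<close> therefore maps a polytabloid \<open>e\<^sub>t\<close> with \<open>t(a) = n + 1\<close> to a vector \<open>y\<close> of the
  integral Specht module of \<open>\<beta>\<close>. Since \<open>L\<close> is a difference of central elements, its adjoint acts on
  the Specht module of \<open>\<beta>\<close> by \<open>r\<^sub>b\<close> when paired with that of \<open>\<lambda>\<close>, so all inner products of \<open>y\<close>
  with the Specht module of \<open>\<beta>\<close> are multiples of \<open>r\<^sub>b - r\<^sub>a\<close>, and \<open>y\<close> lies in the Jantzen lattice.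

  If \<open>p\<close> divides \<open>r\<^sub>a - r\<^sub>b\<close>, the reduction of \<open>y\<close> satisfies the Garnir relations of \<open>\<alpha>\<close>, as does the
  image of a polytabloid under any homomorphism \<open>\<theta>\<close>. Every vector of the Specht module of \<open>\<beta>\<close> that
  satisfies these relations is determined, for \<open>p > 2\<close>, by its coefficient at one particular tabloid,
  and that coefficient of \<open>y\<close> is \<open>1\<close>. Hence \<open>\<theta>\<close> maps the polytabloid to a multiple of the reduction
  of \<open>y\<close>.\<close>

section \<open>Coefficients of polytabloids\<close>

text \<open>Uniqueness is proved by reading the coefficients of a vector as a function on fillings
  of the diagram of \<alpha> with content \<beta>. A nonzero filling of maximal weight turns out to
  be a chain: the column of \<open>a\<close> is one entry short for \<beta>, the hole in its row is
  filled by the bottom entry of a later column, which leaves a hole of its own, and so on until the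
  column of \<open>b\<close> closes the last one. Maximality does not decide which columns in
  between take part, so many chains remain, and the Garnir and kernel relations are used once more
  to tie each of them to the chain in which every column takes part. This is the particular tabloid.
  It is also where the product of the \<open>L - r\<close> can be evaluated. In it the bottom entry
  of every column between \<open>a\<close> and \<open>b\<close> that is shorter than its left
  neighbour (the column of \<open>b\<close> included) has changed its row. There are exactly as many
  such columns as factors, and a factor can put at most one of them right. Hence a single
  contribution remains, and its value does not involve the residues, so it survives
  reduction.\<close>

definition ht :: "(nat \<Rightarrow> nat) \<Rightarrow> nat \<Rightarrow> nat" where
  "ht \<mu> j = card {i. j < \<mu> i}"

lemma finite_rows: "is_partition n \<mu> \<Longrightarrow> finite {i. j < \<mu> i}"
  unfolding is_partition_def by (auto elim: rev_finite_subset)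

lemma less_ht_iff:
  assumes "is_partition n \<mu>"
  shows "i < ht \<mu> j \<longleftrightarrow> j < \<mu> i"
proof -
  let ?S = "{i. j < \<mu> i}"
  have fin: "finite ?S" by (rule finite_rows[OF assms])
  have down: "i' \<in> ?S" if "i \<in> ?S" "i' \<le> i" for i i'
    using that assms by (auto simp: is_partition_def antimono_def dest: order.strict_trans2)
  show ?thesis
  proof
    assume i: "i < ht \<mu> j"
    show "j < \<mu> i"
    proof (rule ccontr)
      assume "\<not> j < \<mu> i"
      then have "?S \<subseteq> {..<i}" using down by (metis lessThan_iff mem_Collect_eq not_le_imp_less subsetI)
      then have "card ?S \<le> i" using card_mono[of "{..<i}"] by simp
      then show False using i by (simp add: ht_def)
    qed
  next
    assume "j < \<mu> i"
    then have "{..i} \<subseteq> ?S" using down by blast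
    then have "Suc i \<le> card ?S" using card_mono[OF fin, of "{..i}"] by simp
    then show "i < ht \<mu> j" by (simp add: ht_def)
  qed
qed

lemma ht_antimono: "is_partition n \<mu> \<Longrightarrow> j \<le> k \<Longrightarrow> ht \<mu> k \<le> ht \<mu> j"
  by (metis less_ht_iff linorder_not_less order.strict_trans2 order_refl)

lemma diagram_iff_ht: "is_partition n \<mu> \<Longrightarrow> (i, j) \<in> diagram \<mu> \<longleftrightarrow> i < ht \<mu> j"
  by (simp add: diagram_def less_ht_iff)

lemma diagram_col_eq: "is_partition n \<mu> \<Longrightarrow> diagram_col \<mu> j = (\<lambda>i. (i, j)) ` {..<ht \<mu> j}"
  by (auto simp: diagram_col_def diagram_iff_ht)

lemma diagram_Sigma: "diagram \<mu> = (SIGMA i:{i. \<mu> i \<noteq> 0}. {..<\<mu> i})"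
  by (auto simp: diagram_def)

lemma finite_diagram: "is_partition n \<mu> \<Longrightarrow> finite (diagram \<mu>)"
  unfolding diagram_Sigma is_partition_def by auto

lemma card_diagram: "is_partition n \<mu> \<Longrightarrow> card (diagram \<mu>) = n"
  unfolding diagram_Sigma is_partition_def by (subst card_SigmaI) auto

lemma tableaux_bij:
  "is_partition n \<mu> \<Longrightarrow> t \<in> tableaux \<mu> \<Longrightarrow> bij_betw t (diagram \<mu>) {1..n}"
  by (simp add: tableaux_def card_diagram)

lemma tableaux_eq_iff:
  "is_partition n \<mu> \<Longrightarrow> t \<in> tableaux \<mu> \<Longrightarrow> u \<in> diagram \<mu> \<Longrightarrow> v \<in> diagram \<mu> \<Longrightarrow> t u = t v \<longleftrightarrow> u = v"
  using tableaux_bij by (auto simp: bij_betw_def inj_on_def)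

lemma tableaux_range: "is_partition n \<mu> \<Longrightarrow> t \<in> tableaux \<mu> \<Longrightarrow> v \<in> diagram \<mu> \<Longrightarrow> t v \<in> {1..n}"
  using tableaux_bij bij_betwE by blast

lemma tableaux_surj:
  assumes "is_partition n \<mu>" "t \<in> tableaux \<mu>" "z \<in> {1..n}"
  obtains v where "v \<in> diagram \<mu>" "z = t v"
proof -
  have "z \<in> t ` diagram \<mu>" using tableaux_bij[OF assms(1,2)] assms(3) by (simp only: bij_betw_def)
  then show ?thesis using that by blast
qed

lemma comp_tableaux:
  "is_partition n \<mu> \<Longrightarrow> \<pi> permutes {1..n} \<Longrightarrow> t \<in> tableaux \<mu> \<Longrightarrow> \<pi> \<circ> t \<in> tableaux \<mu>"
  by (intro comp_in_tableaux) (simp_all add: card_diagram)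

lemma transpose_permutes:
  "is_partition n \<mu> \<Longrightarrow> t \<in> tableaux \<mu> \<Longrightarrow> u \<in> diagram \<mu> \<Longrightarrow> v \<in> diagram \<mu> \<Longrightarrow>
    transpose (t u) (t v) permutes {1..n}"
  by (intro permutes_swap_id tableaux_range)

text \<open>A tabloid is determined by the function sending each entry to its row.\<close>

definition gtab :: "(nat \<Rightarrow> nat) \<Rightarrow> (nat \<Rightarrow> nat) \<Rightarrow> tabloid" where
  "gtab \<mu> g = {s \<in> tableaux \<mu>. \<forall>v\<in>diagram \<mu>. g (s v) = fst v}"

lemma gtab_cong:
  assumes "is_partition n \<mu>" "\<And>z. z \<in> {1..n} \<Longrightarrow> g z = g' z"
  shows "gtab \<mu> g = gtab \<mu> g'"
  using assms tableaux_range[OF assms(1)] unfolding gtab_def by auto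

lemma tabloid_of_eq_gtab:
  assumes P: "is_partition n \<mu>" and t: "t \<in> tableaux \<mu>" and g: "\<forall>v\<in>diagram \<mu>. g (t v) = fst v"
  shows "tabloid_of \<mu> t = gtab \<mu> g"
proof -
  have row: "s ` diagram_row \<mu> i = {z \<in> {1..n}. g z = i}"
    if s: "s \<in> tableaux \<mu>" "\<forall>v\<in>diagram \<mu>. g (s v) = fst v" for s i
    using s(2) tableaux_range[OF P s(1)] tableaux_surj[OF P s(1)]
    by (fastforce simp: diagram_row_def)
  show ?thesis
  proof (intro equalityI subsetI)
    fix s assume s: "s \<in> tabloid_of \<mu> t"
    have "g (s v) = fst v" if v: "v \<in> diagram \<mu>" for v
    proof -
      have "s v \<in> s ` diagram_row \<mu> (fst v)" using v by (simp add: diagram_row_def)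
      then have "s v \<in> t ` diagram_row \<mu> (fst v)" using s by (simp add: tabloid_of_def)
      then show ?thesis using row[OF t g] by simp
    qed
    then show "s \<in> gtab \<mu> g" using s by (simp add: gtab_def tabloid_of_def)
  next
    fix s assume "s \<in> gtab \<mu> g"
    then have "s \<in> tableaux \<mu>" "\<forall>v\<in>diagram \<mu>. g (s v) = fst v" by (auto simp: gtab_def)
    then show "s \<in> tabloid_of \<mu> t" using row[OF t g] row by (simp add: tabloid_of_def)
  qed
qed

lemma gtab_eq_tabloid_of_iff:
  assumes P: "is_partition n \<mu>" and t: "t \<in> tableaux \<mu>"
  shows "gtab \<mu> g = tabloid_of \<mu> t \<longleftrightarrow> (\<forall>v\<in>diagram \<mu>. g (t v) = fst v)"
proof
  assume "gtab \<mu> g = tabloid_of \<mu> t"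
  then have "t \<in> gtab \<mu> g" using t by (simp add: tabloid_of_def)
  then show "\<forall>v\<in>diagram \<mu>. g (t v) = fst v" by (simp add: gtab_def)
qed (use tabloid_of_eq_gtab[OF P t] in auto)

lemma tabloids_gtab:
  assumes P: "is_partition n \<mu>" and T: "T \<in> tabloids \<mu>"
  obtains g where "T = gtab \<mu> g"
proof -
  obtain t where t: "t \<in> tableaux \<mu>" and T: "T = tabloid_of \<mu> t" using T by (auto simp: tabloids_def)
  have "T = gtab \<mu> (\<lambda>z. fst (inv_into (diagram \<mu>) t z))"
    unfolding T using tableaux_bij[OF P t]
    by (intro tabloid_of_eq_gtab[OF P t]) (auto simp: bij_betw_def)
  then show ?thesis by (rule that)
qed

lemma perm_action_gtab:
  assumes P: "is_partition n \<mu>" and \<sigma>: "\<sigma> permutes {1..n}"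
  shows "perm_action \<sigma> x (gtab \<mu> g) = x (gtab \<mu> (g \<circ> \<sigma>))"
proof -
  have "(\<circ>) (inv \<sigma>) ` gtab \<mu> g = gtab \<mu> (g \<circ> \<sigma>)"
  proof (intro equalityI subsetI)
    fix s assume "s \<in> (\<circ>) (inv \<sigma>) ` gtab \<mu> g"
    then show "s \<in> gtab \<mu> (g \<circ> \<sigma>)"
      using comp_tableaux[OF P permutes_inv[OF \<sigma>]] permutes_inverses(1)[OF \<sigma>]
      by (auto simp: gtab_def)
  next
    fix s assume s: "s \<in> gtab \<mu> (g \<circ> \<sigma>)"
    then have "\<sigma> \<circ> s \<in> gtab \<mu> g" using comp_tableaux[OF P \<sigma>] by (auto simp: gtab_def)
    moreover have "s = inv \<sigma> \<circ> (\<sigma> \<circ> s)" using permutes_inverses(2)[OF \<sigma>] by (auto simp: fun_eq_iff)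
    ultimately show "s \<in> (\<circ>) (inv \<sigma>) ` gtab \<mu> g" by blast
  qed
  then show ?thesis by (simp add: perm_action_def)
qed

text \<open>A row function that fits no tableau gives the empty set, which is no tabloid, and
  vectors of \<open>perm_module\<close> vanish there. So coefficients may be compared at all
  \<open>g\<close> without a side condition.\<close>

lemma perm_module_eqI:
  assumes P: "is_partition n \<mu>" and "x \<in> perm_module \<mu>" "y \<in> perm_module \<mu>"
    and "\<And>g. x (gtab \<mu> g) = y (gtab \<mu> g)"
  shows "x = y"
proof
  fix T show "x T = y T"
    using assms by (cases "T \<in> tabloids \<mu>") (auto simp: perm_module_def elim!: tabloids_gtab[OF P])
qed

lemma sum_fun_apply: "(\<Sum>i\<in>A. f i) x = (\<Sum>i\<in>A. f i x)"
  by (induction A rule: infinite_finite_induct) auto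

lemma polytabloid_gtab:
  assumes P: "is_partition n \<mu>" and t: "t \<in> tableaux \<mu>"
  shows "polytabloid \<mu> t (gtab \<mu> g) =
    (\<Sum>\<pi>\<in>column_stabilizer \<mu> t. if \<forall>v\<in>diagram \<mu>. g (\<pi> (t v)) = fst v then of_int (sign \<pi>) else 0)"
  unfolding polytabloid_def sum_fun_apply scale_def tabloid_basis_def
proof (intro sum.cong refl)
  fix \<pi> assume "\<pi> \<in> column_stabilizer \<mu> t"
  then have "\<pi> \<circ> t \<in> tableaux \<mu>" using comp_in_tableaux t by (auto simp: column_stabilizer_def)
  from gtab_eq_tabloid_of_iff[OF P this, of g]
  show "of_int (sign \<pi>) * (if gtab \<mu> g = tabloid_of \<mu> (\<pi> \<circ> t) then 1 else 0) =
        (if \<forall>v\<in>diagram \<mu>. g (\<pi> (t v)) = fst v then of_int (sign \<pi>) else 0)" by auto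
qed

lemma column_stabilizer_iff:
  "is_partition n \<mu> \<Longrightarrow> \<pi> \<in> column_stabilizer \<mu> t \<longleftrightarrow>
    \<pi> permutes {1..n} \<and> (\<forall>j. \<pi> ` (t ` diagram_col \<mu> j) = t ` diagram_col \<mu> j)"
  by (simp add: column_stabilizer_def card_diagram)

lemma column_stabilizer_comp:
  assumes P: "is_partition n \<mu>"
    and "\<pi> \<in> column_stabilizer \<mu> t" "\<sigma> \<in> column_stabilizer \<mu> t"
  shows "\<pi> \<circ> \<sigma> \<in> column_stabilizer \<mu> t"
proof -
  have "\<pi> permutes {1..n}" "\<sigma> permutes {1..n}"
    and im: "\<pi> ` t ` diagram_col \<mu> j = t ` diagram_col \<mu> j" "\<sigma> ` t ` diagram_col \<mu> j = t ` diagram_col \<mu> j" for j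
    using assms(2,3) by (simp_all only: column_stabilizer_iff[OF P])
  then have "\<pi> \<circ> \<sigma> permutes {1..n}" by (blast intro: permutes_compose)
  moreover have "(\<pi> \<circ> \<sigma>) ` t ` diagram_col \<mu> j = t ` diagram_col \<mu> j" for j
    unfolding image_comp[symmetric, of \<pi> \<sigma>] im ..
  ultimately show ?thesis by (simp only: column_stabilizer_iff[OF P]) blast
qed

lemma column_stabilizer_inv:
  assumes P: "is_partition n \<mu>" and \<pi>: "\<pi> \<in> column_stabilizer \<mu> t"
  shows "inv \<pi> \<in> column_stabilizer \<mu> t"
proof -
  have p: "\<pi> permutes {1..n}" and im: "\<And>j. \<pi> ` (t ` diagram_col \<mu> j) = t ` diagram_col \<mu> j"
    using \<pi> by (auto simp: column_stabilizer_iff[OF P])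
  have "inv \<pi> ` (t ` diagram_col \<mu> j) = t ` diagram_col \<mu> j" for j
    by (subst im[symmetric]) (simp add: image_image permutes_inverses(2)[OF p])
  then show ?thesis using permutes_inv[OF p] by (simp only: column_stabilizer_iff[OF P]) blast
qed

lemma perm_action_perm_module:
  assumes P: "is_partition n \<mu>" and \<sigma>: "\<sigma> permutes {1..n}" and x: "x \<in> perm_module \<mu>"
  shows "perm_action \<sigma> x \<in> perm_module \<mu>"
proof -
  have "T \<in> tabloids \<mu>" if T: "(\<circ>) (inv \<sigma>) ` T \<in> tabloids \<mu>" for T
  proof -
    obtain t where t: "t \<in> tableaux \<mu>" "(\<circ>) (inv \<sigma>) ` T = tabloid_of \<mu> t"
      using T by (auto simp: tabloids_def)
    have "T = (\<circ>) \<sigma> ` (\<circ>) (inv \<sigma>) ` T"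
      using permutes_inverses(1)[OF \<sigma>] by (auto simp: image_image o_def)
    also have "\<dots> = tabloid_of \<mu> (\<sigma> \<circ> t)"
      unfolding t(2) by (rule comp_image_tabloid) (use \<sigma> in \<open>simp only: card_diagram[OF P]\<close>)
    finally show ?thesis using comp_tableaux[OF P \<sigma> t(1)] by (simp add: tabloids_def)
  qed
  then have "T \<notin> tabloids \<mu> \<Longrightarrow> (\<circ>) (inv \<sigma>) ` T \<notin> tabloids \<mu>" for T by blast
  moreover have "x U = 0" if "U \<notin> tabloids \<mu>" for U using x that by (simp add: perm_module_def)
  ultimately show ?thesis unfolding perm_module_def perm_action_def by blast
qed

lemma polytabloid_specht: "t \<in> tableaux \<mu> \<Longrightarrow> polytabloid \<mu> t \<in> specht \<mu>"
  unfolding specht_def by (intro tabloid_module.span_base imageI)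

lemma polytabloid_perm_module: "t \<in> tableaux \<mu> \<Longrightarrow> polytabloid \<mu> t \<in> perm_module \<mu>"
  by (rule subsetD[OF specht_subset_perm_module polytabloid_specht])

lemma perm_action_polytabloid:
  assumes P: "is_partition n \<mu>" and t: "t \<in> tableaux \<mu>" and \<sigma>: "\<sigma> permutes {1..n}"
  shows "perm_action \<sigma> (polytabloid \<mu> t :: tabloid \<Rightarrow> 'r::comm_ring_1) = polytabloid \<mu> (\<sigma> \<circ> t)"
proof (rule perm_module_eqI[OF P])
  have st: "\<sigma> \<circ> t \<in> tableaux \<mu>" by (rule comp_tableaux[OF P \<sigma> t])
  show "polytabloid \<mu> (\<sigma> \<circ> t) \<in> (perm_module \<mu> :: (tabloid \<Rightarrow> 'r) set)"
    by (rule polytabloid_perm_module[OF st])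
  show "perm_action \<sigma> (polytabloid \<mu> t) \<in> (perm_module \<mu> :: (tabloid \<Rightarrow> 'r) set)"
    by (rule perm_action_perm_module[OF P \<sigma> polytabloid_perm_module[OF t]])
  fix g
  have inv: "inv \<sigma> (\<sigma> z) = z" "\<sigma> (inv \<sigma> z) = z" for z using permutes_inverses[OF \<sigma>] by auto
  have conj: "\<sigma> \<circ> \<pi> \<circ> inv \<sigma> \<in> column_stabilizer \<mu> (\<sigma> \<circ> t)" if "\<pi> \<in> column_stabilizer \<mu> t" for \<pi>
  proof -
    have im: "\<pi> ` t ` diagram_col \<mu> j = t ` diagram_col \<mu> j" for j
      using that by (auto simp: column_stabilizer_iff[OF P])
    have "(\<sigma> \<circ> \<pi> \<circ> inv \<sigma>) ` (\<sigma> \<circ> t) ` diagram_col \<mu> j = \<sigma> ` \<pi> ` t ` diagram_col \<mu> j" for j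
      by (simp add: image_image inv)
    then have "(\<sigma> \<circ> \<pi> \<circ> inv \<sigma>) ` (\<sigma> \<circ> t) ` diagram_col \<mu> j = (\<sigma> \<circ> t) ` diagram_col \<mu> j" for j
      by (metis im image_comp)
    moreover have "\<sigma> \<circ> \<pi> \<circ> inv \<sigma> permutes {1..n}"
      using that \<sigma> by (intro permutes_compose permutes_inv) (simp_all only: column_stabilizer_iff[OF P])
    ultimately show ?thesis by (simp only: column_stabilizer_iff[OF P]) blast
  qed
  have conj': "inv \<sigma> \<circ> \<pi> \<circ> \<sigma> \<in> column_stabilizer \<mu> t" if "\<pi> \<in> column_stabilizer \<mu> (\<sigma> \<circ> t)" for \<pi>
  proof -
    have im: "\<pi> ` \<sigma> ` t ` diagram_col \<mu> j = \<sigma> ` t ` diagram_col \<mu> j" for j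
      using that by (auto simp: column_stabilizer_iff[OF P] image_comp)
    have "(inv \<sigma> \<circ> \<pi> \<circ> \<sigma>) ` t ` diagram_col \<mu> j = inv \<sigma> ` \<pi> ` \<sigma> ` t ` diagram_col \<mu> j" for j
      by (simp add: image_image)
    then have "(inv \<sigma> \<circ> \<pi> \<circ> \<sigma>) ` t ` diagram_col \<mu> j = inv \<sigma> ` \<sigma> ` t ` diagram_col \<mu> j" for j
      by (simp only: im)
    then have "(inv \<sigma> \<circ> \<pi> \<circ> \<sigma>) ` t ` diagram_col \<mu> j = t ` diagram_col \<mu> j" for j
      by (simp add: image_image inv)
    moreover have "inv \<sigma> \<circ> \<pi> \<circ> \<sigma> permutes {1..n}"
      using that \<sigma> by (intro permutes_compose permutes_inv) (simp_all only: column_stabilizer_iff[OF P])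
    ultimately show ?thesis by (simp only: column_stabilizer_iff[OF P]) blast
  qed
  have perm: "permutation \<pi>" if "\<pi> permutes {1..n}" for \<pi> using that permutation_permutes by blast
  have sgn: "sign (\<sigma> \<circ> \<pi> \<circ> inv \<sigma>) = sign \<pi>" if "\<pi> \<in> column_stabilizer \<mu> t" for \<pi>
  proof -
    have "\<pi> permutes {1..n}" using that by (simp only: column_stabilizer_iff[OF P])
    then have "sign (\<sigma> \<circ> \<pi> \<circ> inv \<sigma>) = sign \<sigma> * sign \<pi> * sign \<sigma>"
      using \<sigma> perm by (simp add: sign_compose permutation_compose permutation_inverse sign_inverse)
    then show ?thesis by (simp add: sign_idempotent mult.commute mult.left_commute)
  qed
  show "(perm_action \<sigma> (polytabloid \<mu> t) (gtab \<mu> g) :: 'r) = polytabloid \<mu> (\<sigma> \<circ> t) (gtab \<mu> g)"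
    unfolding perm_action_gtab[OF P \<sigma>] polytabloid_gtab[OF P t] polytabloid_gtab[OF P st]
  proof (rule sum.reindex_bij_witness[where i = "\<lambda>\<pi>. inv \<sigma> \<circ> \<pi> \<circ> \<sigma>" and j = "\<lambda>\<pi>. \<sigma> \<circ> \<pi> \<circ> inv \<sigma>"])
    fix \<pi> assume \<pi>: "\<pi> \<in> column_stabilizer \<mu> t"
    show "inv \<sigma> \<circ> (\<sigma> \<circ> \<pi> \<circ> inv \<sigma>) \<circ> \<sigma> = \<pi>" by (simp add: fun_eq_iff inv)
    show "\<sigma> \<circ> \<pi> \<circ> inv \<sigma> \<in> column_stabilizer \<mu> (\<sigma> \<circ> t)" by (rule conj[OF \<pi>])
    show "(if \<forall>v\<in>diagram \<mu>. g ((\<sigma> \<circ> \<pi> \<circ> inv \<sigma>) ((\<sigma> \<circ> t) v)) = fst v then of_int (sign (\<sigma> \<circ> \<pi> \<circ> inv \<sigma>)) else (0::'r)) =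
          (if \<forall>v\<in>diagram \<mu>. (g \<circ> \<sigma>) (\<pi> (t v)) = fst v then of_int (sign \<pi>) else 0)"
      unfolding sgn[OF \<pi>] by (simp add: inv)
  next
    fix \<pi> assume \<pi>: "\<pi> \<in> column_stabilizer \<mu> (\<sigma> \<circ> t)"
    show "\<sigma> \<circ> (inv \<sigma> \<circ> \<pi> \<circ> \<sigma>) \<circ> inv \<sigma> = \<pi>" by (simp add: fun_eq_iff inv)
    show "inv \<sigma> \<circ> \<pi> \<circ> \<sigma> \<in> column_stabilizer \<mu> t" by (rule conj'[OF \<pi>])
  qed
qed

text \<open>Left multiplication by \<open>\<sigma>\<close> permutes the column stabilizer and
  multiplies every sign by that of \<open>\<sigma>\<close>.\<close>

lemma polytabloid_column_perm:
  assumes P: "is_partition n \<mu>" and t: "t \<in> tableaux \<mu>" and \<sigma>: "\<sigma> \<in> column_stabilizer \<mu> t"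
  shows "polytabloid \<mu> t (gtab \<mu> (g \<circ> \<sigma>)) = (of_int (sign \<sigma>) * polytabloid \<mu> t (gtab \<mu> g) :: 'r::comm_ring_1)"
proof -
  have p: "\<sigma> permutes {1..n}" using \<sigma> by (simp only: column_stabilizer_iff[OF P])
  have inv: "inv \<sigma> (\<sigma> z) = z" "\<sigma> (inv \<sigma> z) = z" for z using permutes_inverses[OF p] by auto
  have perm: "permutation \<pi>" if "\<pi> \<in> column_stabilizer \<mu> t" for \<pi>
    using that permutation_permutes unfolding column_stabilizer_iff[OF P] by blast
  show ?thesis
    unfolding polytabloid_gtab[OF P t] sum_distrib_left
  proof (rule sum.reindex_bij_witness[where i = "\<lambda>\<pi>. inv \<sigma> \<circ> \<pi>" and j = "\<lambda>\<pi>. \<sigma> \<circ> \<pi>"])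
    fix \<pi> assume \<pi>: "\<pi> \<in> column_stabilizer \<mu> t"
    show "inv \<sigma> \<circ> (\<sigma> \<circ> \<pi>) = \<pi>" "\<sigma> \<circ> (inv \<sigma> \<circ> \<pi>) = \<pi>" by (simp_all add: fun_eq_iff inv)
    show "\<sigma> \<circ> \<pi> \<in> column_stabilizer \<mu> t" by (rule column_stabilizer_comp[OF P \<sigma> \<pi>])
    show "inv \<sigma> \<circ> \<pi> \<in> column_stabilizer \<mu> t"
      by (rule column_stabilizer_comp[OF P column_stabilizer_inv[OF P \<sigma>] \<pi>])
    have "sign (\<sigma> \<circ> \<pi>) = sign \<sigma> * sign \<pi>" by (intro sign_compose perm \<pi> \<sigma>)
    then have "of_int (sign \<sigma>) * of_int (sign (\<sigma> \<circ> \<pi>)) = (of_int (sign \<pi>) :: 'r)"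
      by (simp add: sign_idempotent mult.assoc[symmetric] flip: of_int_mult)
    then show "of_int (sign \<sigma>) * (if \<forall>v\<in>diagram \<mu>. g ((\<sigma> \<circ> \<pi>) (t v)) = fst v then of_int (sign (\<sigma> \<circ> \<pi>)) else (0::'r)) =
          (if \<forall>v\<in>diagram \<mu>. (g \<circ> \<sigma>) (\<pi> (t v)) = fst v then of_int (sign \<pi>) else 0)"
      by simp
  qed
qed

lemma polytabloid_nonzeroE:
  assumes P: "is_partition n \<mu>" and t: "t \<in> tableaux \<mu>" and nz: "polytabloid \<mu> t (gtab \<mu> g) \<noteq> (0 :: 'r::comm_ring_1)"
  obtains \<pi> where "\<pi> \<in> column_stabilizer \<mu> t" "\<And>v. v \<in> diagram \<mu> \<Longrightarrow> g (\<pi> (t v)) = fst v"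
proof -
  have "\<exists>\<pi>\<in>column_stabilizer \<mu> t. \<forall>v\<in>diagram \<mu>. g (\<pi> (t v)) = fst v"
  proof (rule ccontr)
    assume *: "\<not> ?thesis"
    have "polytabloid \<mu> t (gtab \<mu> g) = (0 :: 'r)"
      unfolding polytabloid_gtab[OF P t] by (rule sum.neutral) (use * in auto)
    then show False using nz by simp
  qed
  then show ?thesis using that by blast
qed

text \<open>A nonzero coefficient comes from a column permutation that puts every entry into its
  row, so the entries of each column occupy all rows of that column, each once. This is the source
  of the later vanishing arguments.\<close>

lemma polytabloid_image:
  assumes P: "is_partition n \<mu>" and t: "t \<in> tableaux \<mu>" and nz: "polytabloid \<mu> t (gtab \<mu> g) \<noteq> 0"
  shows "g ` t ` diagram_col \<mu> j = {..<ht \<mu> j}"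
proof -
  obtain \<pi> where \<pi>: "\<pi> \<in> column_stabilizer \<mu> t" "\<And>v. v \<in> diagram \<mu> \<Longrightarrow> g (\<pi> (t v)) = fst v"
    using polytabloid_nonzeroE[OF P t nz] by blast
  have "\<pi> ` t ` diagram_col \<mu> j = t ` diagram_col \<mu> j"
    using \<pi>(1) by (simp only: column_stabilizer_iff[OF P])
  then have "g ` t ` diagram_col \<mu> j = (\<lambda>v. g (\<pi> (t v))) ` diagram_col \<mu> j" by (metis image_image)
  also have "\<dots> = fst ` diagram_col \<mu> j"
    by (intro image_cong refl \<pi>(2)) (simp add: diagram_col_def)
  finally show ?thesis by (simp add: diagram_col_eq[OF P] image_image)
qed

lemma polytabloid_inj_col:
  assumes P: "is_partition n \<mu>" and t: "t \<in> tableaux \<mu>" and nz: "polytabloid \<mu> t (gtab \<mu> g) \<noteq> 0"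
    and "i < ht \<mu> j" "i' < ht \<mu> j" "g (t (i, j)) = g (t (i', j))"
  shows "i = i'"
proof -
  have "(\<lambda>i. g (t (i, j))) ` {..<ht \<mu> j} = {..<ht \<mu> j}"
    using polytabloid_image[OF P t nz, of j] by (simp add: diagram_col_eq[OF P] image_image)
  then have "inj_on (\<lambda>i. g (t (i, j))) {..<ht \<mu> j}" by (intro eq_card_imp_inj_on) simp_all
  then show ?thesis using assms(4-6) by (auto simp: inj_on_def)
qed

lemma polytabloid_less_ht:
  assumes P: "is_partition n \<mu>" and t: "t \<in> tableaux \<mu>" and nz: "polytabloid \<mu> t (gtab \<mu> g) \<noteq> 0"
    and "i < ht \<mu> j"
  shows "g (t (i, j)) < ht \<mu> j"
proof -
  have "g (t (i, j)) \<in> g ` t ` diagram_col \<mu> j"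
    using assms(4) by (intro imageI) (simp add: diagram_col_eq[OF P])
  then show ?thesis unfolding polytabloid_image[OF P t nz] by simp
qed

lemma polytabloid_hits_row:
  assumes P: "is_partition n \<mu>" and t: "t \<in> tableaux \<mu>" and nz: "polytabloid \<mu> t (gtab \<mu> g) \<noteq> 0"
    and "r < ht \<mu> j"
  obtains i where "i < ht \<mu> j" "g (t (i, j)) = r"
proof -
  have "r \<in> g ` t ` diagram_col \<mu> j" using polytabloid_image[OF P t nz, of j] assms(4) by simp
  then show ?thesis using that unfolding diagram_col_eq[OF P] by auto
qed

text \<open>Within a column the row of an entry determines its node, so the condition on
  \<open>g\<close> leaves just one column permutation in the defining sum.\<close>

lemma polytabloid_value:
  assumes P: "is_partition n \<mu>" and t: "t \<in> tableaux \<mu>"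
    and \<pi>: "\<pi> \<in> column_stabilizer \<mu> t" and g: "\<And>v. v \<in> diagram \<mu> \<Longrightarrow> g (\<pi> (t v)) = fst v"
  shows "polytabloid \<mu> t (gtab \<mu> g) = (of_int (sign \<pi>) :: 'a::comm_ring_1)"
proof -
  have uniq: "\<sigma> = \<pi>" if \<sigma>: "\<sigma> \<in> column_stabilizer \<mu> t" and h: "\<forall>v\<in>diagram \<mu>. g (\<sigma> (t v)) = fst v" for \<sigma>
  proof
    fix z
    have per: "\<pi> permutes {1..n}" "\<sigma> permutes {1..n}"
      using \<pi> \<sigma> by (simp_all only: column_stabilizer_iff[OF P])
    show "\<sigma> z = \<pi> z"
    proof (cases "z \<in> {1..n}")
      case False
      then show ?thesis using per by (metis permutes_not_in)
    next
      case True
      then obtain v where v: "v \<in> diagram \<mu>" "z = t v" using tableaux_surj[OF P t] by blast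
      then have vc: "v \<in> diagram_col \<mu> (snd v)" by (simp add: diagram_col_def)
      have "\<pi> ` t ` diagram_col \<mu> (snd v) = t ` diagram_col \<mu> (snd v)"
        using \<pi> by (simp only: column_stabilizer_iff[OF P])
      moreover have "\<sigma> ` t ` diagram_col \<mu> (snd v) = t ` diagram_col \<mu> (snd v)"
        using \<sigma> by (simp only: column_stabilizer_iff[OF P])
      ultimately have "\<sigma> (t v) \<in> \<pi> ` t ` diagram_col \<mu> (snd v)" using vc by blast
      then obtain w where w: "w \<in> diagram_col \<mu> (snd v)" "\<sigma> (t v) = \<pi> (t w)" by blast
      then have "fst w = fst v" using g[of w] h v by (auto simp: diagram_col_def)
      then have "w = v" using w(1) by (simp add: diagram_col_def prod_eq_iff)
      then show ?thesis using w v by simp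
    qed
  qed
  have fin: "finite (column_stabilizer \<mu> t)"
    by (rule finite_subset[OF _ finite_permutations[of "{1..n}"]]) (auto simp: column_stabilizer_iff[OF P] )
  have "polytabloid \<mu> t (gtab \<mu> g) = (\<Sum>\<sigma>\<in>column_stabilizer \<mu> t. if \<sigma> = \<pi> then of_int (sign \<pi>) else (0::'a))"
    unfolding polytabloid_gtab[OF P t]
  proof (intro sum.cong refl)
    fix \<sigma> assume \<sigma>: "\<sigma> \<in> column_stabilizer \<mu> t"
    have "(\<forall>v\<in>diagram \<mu>. g (\<sigma> (t v)) = fst v) \<longleftrightarrow> \<sigma> = \<pi>" using uniq[OF \<sigma>] g by blast
    then show "(if \<forall>v\<in>diagram \<mu>. g (\<sigma> (t v)) = fst v then of_int (sign \<sigma>) else (0::'a)) =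
      (if \<sigma> = \<pi> then of_int (sign \<pi>) else 0)" by presburger
  qed
  also have "\<dots> = of_int (sign \<pi>)" by (subst sum.delta[OF fin]) (simp only: \<pi> if_True)
  finally show ?thesis .
qed

lemma transpose_image:
  assumes "x \<in> A \<longleftrightarrow> y \<in> A"
  shows "transpose x y ` A = A"
proof (cases "x \<in> A")
  case True
  then show ?thesis using assms swap_image_eq[of x A y id] by simp
next
  case False
  then have "transpose x y z = z" if "z \<in> A" for z
    using that assms by (intro transpose_apply_other) auto
  then show ?thesis by simp
qed

lemma transpose_column_stabilizer:
  assumes P: "is_partition n \<mu>" and t: "t \<in> tableaux \<mu>" and "i < ht \<mu> j" "i' < ht \<mu> j"
  shows "transpose (t (i, j)) (t (i', j)) \<in> column_stabilizer \<mu> t"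
proof -
  have d: "(i, j) \<in> diagram \<mu>" "(i', j) \<in> diagram \<mu>" using assms by (simp_all add: diagram_iff_ht[OF P])
  have "t (i, j) \<in> t ` diagram_col \<mu> k \<longleftrightarrow> t (i', j) \<in> t ` diagram_col \<mu> k" for k
    using d tableaux_eq_iff[OF P t] unfolding diagram_col_def by auto
  then have "transpose (t (i, j)) (t (i', j)) ` t ` diagram_col \<mu> k = t ` diagram_col \<mu> k" for k
    by (rule transpose_image)
  then show ?thesis using transpose_permutes[OF P t d] by (simp only: column_stabilizer_iff[OF P]) blast
qed

lemma polytabloid_column_swap:
  assumes P: "is_partition n \<mu>" and t: "t \<in> tableaux \<mu>" and "i < ht \<mu> j" "i' < ht \<mu> j" "i \<noteq> i'"
  shows "polytabloid \<mu> t (gtab \<mu> (g \<circ> transpose (t (i, j)) (t (i', j)))) = - polytabloid \<mu> t (gtab \<mu> g)"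
proof -
  have "t (i, j) \<noteq> t (i', j)"
    using tableaux_eq_iff[OF P t, of "(i, j)" "(i', j)"] assms(3-) by (simp add: diagram_iff_ht[OF P])
  then show ?thesis
    by (simp add: polytabloid_column_perm[OF P t transpose_column_stabilizer[OF P t assms(3,4)]] sign_swap_id)
qed

section \<open>Garnir relations and kernel relations for a single entry\<close>

lemma comp_transpose_eq: "g x = g y \<Longrightarrow> g \<circ> transpose x y = g"
  by (auto simp: fun_eq_iff transpose_def)

lemma sum_single_nonzero:
  assumes "finite A" "a \<in> A" "\<And>i. i \<in> A \<Longrightarrow> i \<noteq> a \<Longrightarrow> f i = 0"
  shows "sum f A = f a"
proof -
  have "sum f A = sum f {a}" using assms by (intro sum.mono_neutral_right) auto
  then show ?thesis by simp
qed

lemma sum_two_cancel: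
  assumes "finite A" "a \<in> A" "b \<in> A" "a \<noteq> b" "f a = - f b"
    and "\<And>i. i \<in> A \<Longrightarrow> i \<noteq> a \<Longrightarrow> i \<noteq> b \<Longrightarrow> f i = (0::'r::ab_group_add)"
  shows "sum f A = 0"
proof -
  have "sum f A = sum f {a, b}" using assms by (intro sum.mono_neutral_right) auto
  then show ?thesis using assms by simp
qed

text \<open>Checked coefficient by coefficient. If the left side is nonzero, exactly one entry of
  column \<open>k\<close> shares the row of the moved entry; exchanging these two changes nothing,
  and every other exchange repeats a row in column \<open>k\<close>. If it is zero, either all terms
  vanish or two of them cancel and the rest vanish. Columns of equal length may be exchanged in both
  directions, which \<open>col_span_collapse\<close> uses.\<close>

lemma garnir:
  fixes g :: "nat \<Rightarrow> nat"
  assumes P: "is_partition n \<mu>" and t: "t \<in> tableaux \<mu>" and r: "r < ht \<mu> j" and kj: "k \<noteq> j"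
    and le: "ht \<mu> j \<le> ht \<mu> k"
  shows "polytabloid \<mu> t (gtab \<mu> g) =
    (\<Sum>i<ht \<mu> k. polytabloid \<mu> t (gtab \<mu> (g \<circ> transpose (t (r, j)) (t (i, k)))) :: 'r::comm_ring_1)"
proof -
  define e :: "(nat \<Rightarrow> nat) \<Rightarrow> 'r" where "e g = polytabloid \<mu> t (gtab \<mu> g)" for g
  define x where "x = t (r, j)"
  define y where "y i = t (i, k)" for i
  have xy: "x \<noteq> y i" if "i < ht \<mu> k" for i
    using tableaux_eq_iff[OF P t, of "(r, j)" "(i, k)"] r kj that
        by (simp add: diagram_iff_ht[OF P] x_def y_def)
  have yy: "y i = y i' \<longleftrightarrow> i = i'" if "i < ht \<mu> k" "i' < ht \<mu> k" for i i'
    using tableaux_eq_iff[OF P t, of "(i, k)" "(i', k)"] that by (simp add: diagram_iff_ht[OF P] y_def)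
  have inj: "i = i'" if "e h \<noteq> 0" "i < ht \<mu> k" "i' < ht \<mu> k" "h (y i) = h (y i')" for h i i'
    using polytabloid_inj_col[OF P t, of h i k i'] that by (simp add: e_def y_def)
  have hit: "\<exists>i<ht \<mu> k. h (y i) = s" if "e h \<noteq> 0" "s < ht \<mu> k" for h s
    using polytabloid_hits_row[OF P t, of h s k] that by (auto simp: e_def y_def)
  have small: "h x < ht \<mu> k" if "e h \<noteq> 0" for h
  proof -
    have "h (t (r, j)) < ht \<mu> j"
      using polytabloid_less_ht[OF P t _ r, of h] that unfolding e_def by blast
    then show ?thesis using le by (simp add: x_def)
  qed
  have swap: "e (h \<circ> transpose (y i) (y i')) = - e h" if "i < ht \<mu> k" "i' < ht \<mu> k" "i \<noteq> i'" for h i i'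
    using polytabloid_column_swap[OF P t that, of h] by (simp add: e_def y_def)
  have "e g = (\<Sum>i<ht \<mu> k. e (g \<circ> transpose x (y i)))"
  proof (cases "e g = 0")
    case False
    obtain i where i: "i < ht \<mu> k" "g (y i) = g x" using hit[OF False small[OF False]] by blast
    have "e (g \<circ> transpose x (y i')) = 0" if i': "i' < ht \<mu> k" "i' \<noteq> i" for i'
    proof (rule ccontr)
      assume nz: "e (g \<circ> transpose x (y i')) \<noteq> 0"
      have "(g \<circ> transpose x (y i')) (y i) = (g \<circ> transpose x (y i')) (y i')"
        using i i' xy[of i] yy[of i i'] by (simp add: transpose_def)
      from inj[OF nz i(1) i'(1) this] show False using i' by simp
    qed
    then have "(\<Sum>i<ht \<mu> k. e (g \<circ> transpose x (y i))) = e (g \<circ> transpose x (y i))"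
      using i by (intro sum_single_nonzero) auto
    also have "\<dots> = e g" using comp_transpose_eq[of g x "y i"] i by simp
    finally show ?thesis by simp
  next
    case True
    show ?thesis
    proof (cases "\<forall>i<ht \<mu> k. e (g \<circ> transpose x (y i)) = 0")
      case all: True
      then show ?thesis using True by (simp add: sum.neutral)
    next
      case False
      then obtain i1 where i1: "i1 < ht \<mu> k" "e (g \<circ> transpose x (y i1)) \<noteq> 0" by blast
      \<comment> \<open>After the nonzero exchange, \<open>x\<close> sits in the row
        \<open>g (y i1)\<close>, so column \<open>k\<close> has an entry \<open>y i0\<close> in that
        row too. Exchanging \<open>x\<close> with \<open>y i0\<close> instead differs by a swap
        inside column \<open>k\<close>, hence by a sign.\<close>
      obtain i0 where i0: "i0 < ht \<mu> k" "(g \<circ> transpose x (y i1)) (y i0) = g (y i1)"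
        using hit[OF i1(2), of "g (y i1)"] small[OF i1(2)] by auto
      have ne: "i0 \<noteq> i1"
      proof
        assume "i0 = i1"
        then have "g \<circ> transpose x (y i1) = g" using i0 by (intro comp_transpose_eq) simp
        then show False using i1 True by simp
      qed
      then have g01: "g (y i0) = g (y i1)"
        using i0 xy[of i0] i1 yy[of i0 i1] by (simp add: transpose_def)
      have "g \<circ> transpose x (y i0) = g \<circ> transpose x (y i1) \<circ> transpose (y i0) (y i1)"
        using g01 xy[of i0] xy[of i1] yy[of i0 i1] i0 i1 ne by (auto simp: fun_eq_iff transpose_def)
      then have canc: "e (g \<circ> transpose x (y i0)) = - e (g \<circ> transpose x (y i1))"
        using swap[OF i0(1) i1(1) ne] by simp
      have "e (g \<circ> transpose x (y i)) = 0" if i: "i < ht \<mu> k" "i \<noteq> i0" "i \<noteq> i1" for i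
      proof (rule ccontr)
        assume nz: "e (g \<circ> transpose x (y i)) \<noteq> 0"
        have "(g \<circ> transpose x (y i)) (y i0) = (g \<circ> transpose x (y i)) (y i1)"
          using i i0 i1 g01 xy[of i0] xy[of i1] yy[of i i0] yy[of i i1] by (simp add: transpose_def)
        from inj[OF nz i0(1) i1(1) this] show False using ne by simp
      qed
      then have "(\<Sum>i<ht \<mu> k. e (g \<circ> transpose x (y i))) = 0"
        using i0 i1 ne canc by (intro sum_two_cancel[of _ i0 i1]) auto
      then show ?thesis using True by simp
    qed
  qed
  then show ?thesis by (simp add: e_def x_def y_def)
qed

lemma perm_action_add: "perm_action \<sigma> (x + y) = perm_action \<sigma> x + perm_action \<sigma> y"
  by (simp add: perm_action_def fun_eq_iff)

lemma perm_action_scale: "perm_action \<sigma> (scale c x) = scale c (perm_action \<sigma> x)"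
  by (simp add: perm_action_def scale_def)

lemma perm_action_zero: "perm_action \<sigma> 0 = 0"
  by (simp add: perm_action_def fun_eq_iff)

lemma perm_module_sum: "(\<And>i. i \<in> A \<Longrightarrow> f i \<in> perm_module \<mu>) \<Longrightarrow> sum f A \<in> perm_module \<mu>"
  by (auto simp: perm_module_def sum_fun_apply)

lemma garnir_perm_action:
  assumes P: "is_partition n \<mu>" and t: "t \<in> tableaux \<mu>" and r: "r < ht \<mu> j" and kj: "k \<noteq> j"
    and le: "ht \<mu> j \<le> ht \<mu> k"
  shows "polytabloid \<mu> t =
    (\<Sum>i<ht \<mu> k. perm_action (transpose (t (r, j)) (t (i, k))) (polytabloid \<mu> t) :: tabloid \<Rightarrow> 'r::comm_ring_1)"
proof (rule perm_module_eqI[OF P polytabloid_perm_module[OF t]])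
  have tr: "transpose (t (r, j)) (t (i, k)) permutes {1..n}" if "i < ht \<mu> k" for i
    using that r by (intro transpose_permutes[OF P t]) (simp_all add: diagram_iff_ht[OF P])
  then show "(\<Sum>i<ht \<mu> k. perm_action (transpose (t (r, j)) (t (i, k))) (polytabloid \<mu> t)) \<in> perm_module \<mu>"
    by (intro perm_module_sum perm_action_perm_module[OF P] polytabloid_perm_module t) simp
  fix g
  show "polytabloid \<mu> t (gtab \<mu> g) =
    (\<Sum>i<ht \<mu> k. perm_action (transpose (t (r, j)) (t (i, k))) (polytabloid \<mu> t) :: tabloid \<Rightarrow> 'r) (gtab \<mu> g)"
    unfolding garnir[OF P t r kj le, of g] sum_fun_apply
    by (intro sum.cong refl perm_action_gtab[OF P tr, symmetric]) simp
qed

lemma column_swap_perm_action: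
  assumes P: "is_partition n \<mu>" and t: "t \<in> tableaux \<mu>" and "i < ht \<mu> j" "i' < ht \<mu> j" "i \<noteq> i'"
  shows "perm_action (transpose (t (i, j)) (t (i', j))) (polytabloid \<mu> t) =
    scale (- 1) (polytabloid \<mu> t :: tabloid \<Rightarrow> 'r::comm_ring_1)"
proof (rule perm_module_eqI[OF P])
  have tr: "transpose (t (i, j)) (t (i', j)) permutes {1..n}"
    using assms by (intro transpose_permutes[OF P t]) (simp_all add: diagram_iff_ht[OF P])
  then show "perm_action (transpose (t (i, j)) (t (i', j))) (polytabloid \<mu> t) \<in> (perm_module \<mu> :: (tabloid \<Rightarrow> 'r) set)"
    by (intro perm_action_perm_module[OF P] polytabloid_perm_module t)
  show "scale (- 1) (polytabloid \<mu> t) \<in> (perm_module \<mu> :: (tabloid \<Rightarrow> 'r) set)"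
    using polytabloid_perm_module[OF t, where 'a = 'r] by (simp add: perm_module_def scale_def)
  show "perm_action (transpose (t (i, j)) (t (i', j))) (polytabloid \<mu> t) (gtab \<mu> g) =
    scale (- 1) (polytabloid \<mu> t :: tabloid \<Rightarrow> 'r) (gtab \<mu> g)" for g
    by (simp add: perm_action_gtab[OF P tr] polytabloid_column_swap[OF P t assms(3-)] scale_def)
qed

lemma gtab_content:
  assumes P: "is_partition n \<mu>" and x: "x \<in> perm_module \<mu>" and nz: "x (gtab \<mu> g) \<noteq> 0"
  shows "card {z \<in> {1..n}. g z = d} = \<mu> d"
proof -
  have "gtab \<mu> g \<in> tabloids \<mu>" using x nz by (auto simp: perm_module_def)
  then obtain t where t: "t \<in> tableaux \<mu>" "gtab \<mu> g = tabloid_of \<mu> t" by (auto simp: tabloids_def)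
  then have g: "\<forall>v\<in>diagram \<mu>. g (t v) = fst v" using gtab_eq_tabloid_of_iff[OF P t(1)] by blast
  have "{z \<in> {1..n}. g z = d} = t ` (\<lambda>j. (d, j)) ` {..<\<mu> d}"
  proof (intro equalityI subsetI)
    fix z assume z: "z \<in> {z \<in> {1..n}. g z = d}"
    then obtain v where "v \<in> diagram \<mu>" "z = t v" using tableaux_surj[OF P t(1)] by blast
    then show "z \<in> t ` (\<lambda>j. (d, j)) ` {..<\<mu> d}"
      using g z by (cases v) (auto simp: diagram_def)
  next
    fix z assume "z \<in> t ` (\<lambda>j. (d, j)) ` {..<\<mu> d}"
    then obtain v where "v \<in> diagram \<mu>" "fst v = d" "z = t v" by (auto simp: diagram_def)
    then show "z \<in> {z \<in> {1..n}. g z = d}" using g tableaux_range[OF P t(1), of v] by auto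
  qed
  moreover have "inj_on t ((\<lambda>j. (d, j)) ` {..<\<mu> d})"
    using tableaux_bij[OF P t(1)] by (auto simp: bij_betw_def diagram_def elim!: inj_on_subset)
  ultimately show ?thesis by (simp add: card_image inj_on_def)
qed

text \<open>The easy half of James's kernel intersection theorem, for homomorphisms moving one entry.\<close>

lemma specht_raise:
  assumes P: "is_partition n \<mu>" and x: "x \<in> specht \<mu>" and d: "d < d'"
  shows "(\<Sum>z | z \<in> {1..n} \<and> U z = d. x (gtab \<mu> (U(z := d')))) = (0 :: 'r::comm_ring_1)"
  using x unfolding specht_def
proof (induction x rule: tabloid_module.span_induct_alt)
  case base
  then show ?case by simp
next
  case (step c x y)
  then obtain t where t: "t \<in> tableaux \<mu>" and x: "x = polytabloid \<mu> t" by blast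
  define e :: "(nat \<Rightarrow> nat) \<Rightarrow> 'r" where "e g = polytabloid \<mu> t (gtab \<mu> g)" for g
  define A where "A = {z \<in> {1..n}. U z = d}"
  have "(\<Sum>z\<in>A. e (U(z := d'))) = 0"
  proof (cases "\<forall>z\<in>A. e (U(z := d')) = 0")
    case False
    then obtain z1 where z1: "z1 \<in> A" "e (U(z1 := d')) \<noteq> 0" by blast
    obtain i1 j where v: "(i1, j) \<in> diagram \<mu>" "z1 = t (i1, j)"
      using tableaux_surj[OF P t, of z1] z1 unfolding A_def by auto
    then have i1: "i1 < ht \<mu> j" by (simp add: diagram_iff_ht[OF P])
    have "d' < ht \<mu> j"
      using polytabloid_less_ht[OF P t _ i1, of "U(z1 := d')"] z1 v by (simp add: e_def)
    \<comment> \<open>With \<open>z1\<close> moved to row \<open>d'\<close>, its column must still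
      have an entry in row \<open>d\<close>; moving that entry instead of \<open>z1\<close> differs
      by a swap inside the column.\<close>
    then obtain i0 where i0: "i0 < ht \<mu> j" "(U(z1 := d')) (t (i0, j)) = d"
      using polytabloid_hits_row[OF P t, of "U(z1 := d')" d j] z1 d by (auto simp: e_def)
    define z0 where "z0 = t (i0, j)"
    have ne: "z0 \<noteq> z1" using i0 d by (auto simp: z0_def)
    have z0: "z0 \<in> A"
      using i0 ne tableaux_range[OF P t, of "(i0, j)"] by (simp add: A_def z0_def diagram_iff_ht[OF P])
    have i01: "i0 \<noteq> i1" using ne v by (auto simp: z0_def)
    have "U(z0 := d') = U(z1 := d') \<circ> transpose (t (i0, j)) (t (i1, j))"
      using ne z0 z1 v(2) by (auto simp: fun_eq_iff transpose_def z0_def A_def)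
    then have canc: "e (U(z0 := d')) = - e (U(z1 := d'))"
      using polytabloid_column_swap[OF P t i0(1) i1 i01] by (simp add: e_def)
    have "e (U(z := d')) = 0" if z: "z \<in> A" "z \<noteq> z0" "z \<noteq> z1" for z
    proof (rule ccontr)
      assume nz: "e (U(z := d')) \<noteq> 0"
      have "(U(z := d')) (t (i0, j)) = (U(z := d')) (t (i1, j))"
        using z z0 z1 v by (auto simp: z0_def A_def)
      with nz show False
        using polytabloid_inj_col[OF P t _ i0(1) i1, of "U(z := d')"] i01 by (simp add: e_def)
    qed
    then show ?thesis using z0 z1 ne canc by (intro sum_two_cancel[of _ z0 z1]) (auto simp: A_def)
  qed (simp add: sum.neutral)
  then have "(\<Sum>z\<in>A. x (gtab \<mu> (U(z := d')))) = 0" by (simp add: e_def x)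
  moreover have "(\<Sum>z\<in>A. y (gtab \<mu> (U(z := d')))) = 0" using step.IH by (simp only: A_def)
  moreover have "(\<Sum>z\<in>A. (scale c x + y) (gtab \<mu> (U(z := d')))) =
      c * (\<Sum>z\<in>A. x (gtab \<mu> (U(z := d')))) + (\<Sum>z\<in>A. y (gtab \<mu> (U(z := d'))))"
    unfolding scale_def plus_fun_def sum.distrib sum_distrib_left ..
  ultimately show ?case unfolding A_def[symmetric] by (simp only: mult_zero_right add_0_left)
qed

section \<open>Singular fillings\<close>

lemma eq_of_less:
  assumes "\<And>i::nat. i < x \<longleftrightarrow> i < y"
  shows "x = y"
proof -
  have "{..<x} = {..<y}" by (simp only: lessThan_def assms)
  then show ?thesis by simp
qed

text \<open>Dominance is used in the form \<open>rb < ra\<close>, supplied by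
  \<open>row_less_of_dominates\<close>.\<close>

locale box_move =
  fixes lam \<alpha> \<beta> :: "nat \<Rightarrow> nat" and n ra ca rb cb :: nat
  assumes lam: "is_partition (Suc n) lam" and \<alpha>: "is_partition n \<alpha>" and \<beta>: "is_partition n \<beta>"
    and a_in: "(ra, ca) \<in> diagram lam" and diag_\<alpha>: "diagram \<alpha> = diagram lam - {(ra, ca)}"
    and b_in: "(rb, cb) \<in> diagram lam" and diag_\<beta>: "diagram \<beta> = diagram lam - {(rb, cb)}"
    and rows: "rb < ra"
begin

abbreviation "h \<equiv> ht \<alpha>"
abbreviation "D \<equiv> diagram \<alpha>"

lemma less_ht_\<alpha>: "i < h j \<longleftrightarrow> i < ht lam j \<and> (i, j) \<noteq> (ra, ca)"
  using diag_\<alpha> diagram_iff_ht[OF \<alpha>, of i j] diagram_iff_ht[OF lam, of i j] by auto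

lemma less_ht_\<beta>: "i < ht \<beta> j \<longleftrightarrow> i < ht lam j \<and> (i, j) \<noteq> (rb, cb)"
  using diag_\<beta> diagram_iff_ht[OF \<beta>, of i j] diagram_iff_ht[OF lam, of i j] by auto

lemma ht_lam_ca: "ht lam ca = Suc ra"
proof -
  have "ra < ht lam ca" using a_in diagram_iff_ht[OF lam] by blast
  moreover have "\<not> Suc ra < ht lam ca" using less_ht_\<alpha>[of "Suc ra" ca] less_ht_\<alpha>[of ra ca] by auto
  ultimately show ?thesis by simp
qed

lemma ht_lam_cb: "ht lam cb = Suc rb"
proof -
  have "rb < ht lam cb" using b_in diagram_iff_ht[OF lam] by blast
  moreover have "\<not> Suc rb < ht lam cb" using less_ht_\<beta>[of "Suc rb" cb] less_ht_\<beta>[of rb cb] by auto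
  ultimately show ?thesis by simp
qed

lemma cols: "ca < cb"
  using ht_antimono[OF lam, of cb ca] ht_lam_ca ht_lam_cb rows by force

lemma ht_\<alpha>: "h j = (if j = ca then ra else ht lam j)"
proof (rule eq_of_less)
  fix i
  show "i < ht \<alpha> j \<longleftrightarrow> i < (if j = ca then ra else ht lam j)"
    unfolding less_ht_\<alpha>[of i j] using ht_lam_ca by (cases "j = ca") auto
qed

lemma ht_\<beta>: "ht \<beta> j = (if j = cb then rb else ht lam j)"
proof (rule eq_of_less)
  fix i
  show "i < ht \<beta> j \<longleftrightarrow> i < (if j = cb then rb else ht lam j)"
    unfolding less_ht_\<beta>[of i j] using ht_lam_cb by (cases "j = cb") auto
qed

lemma h_cb: "h cb = Suc rb" and h_ca: "h ca = ra"
  using cols ht_lam_cb by (simp_all add: ht_\<alpha>)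

lemma h_antimono: "j \<le> k \<Longrightarrow> h k \<le> h j"
  by (rule ht_antimono[OF \<alpha>])

lemma h_before: "j < ca \<Longrightarrow> ra < h j"
  using ht_antimono[OF lam, of j ca] ht_lam_ca by (simp add: ht_\<alpha>)

lemma h_after: "ca < j \<Longrightarrow> h j \<le> ra"
  using h_antimono[of ca j] h_ca by simp

lemma h_pos: "j \<le> cb \<Longrightarrow> 0 < h j"
  using h_antimono[of j cb] h_cb by simp

lemma D_iff: "(i, j) \<in> D \<longleftrightarrow> i < h j"
  by (rule diagram_iff_ht[OF \<alpha>])

text \<open>\<open>gap E k\<close> is the row in which the bottom entry of the last column of \<open>E\<close> before \<open>k\<close>
  leaves a hole; the filling \<open>chain E\<close> lets the bottom entry of every column in \<open>E\<close>, and of the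
  column of \<open>b\<close>, drop into the current hole.\<close>

primrec gap :: "nat set \<Rightarrow> nat \<Rightarrow> nat" where
  "gap E 0 = ra"
| "gap E (Suc k) = (if ca < k \<and> k \<in> E then h k - 1 else gap E k)"

definition chain :: "nat set \<Rightarrow> node \<Rightarrow> nat" where
  "chain E v = (if ca < snd v \<and> snd v \<le> cb \<and> (snd v \<in> E \<or> snd v = cb) \<and> Suc (fst v) = h (snd v)
     then gap E (snd v) else fst v)"

lemma gap_ca: "k \<le> Suc ca \<Longrightarrow> gap E k = ra"
  by (induction k) auto

text \<open>A hole is the bottom row of an earlier column, or \<open>ra\<close> at the start, and
  columns do not get longer to the right. So a bottom entry that drops moves down or stays, and
  chains increase down each column.\<close>

lemma gap_ge: "ca < k \<Longrightarrow> h k - 1 \<le> gap E k"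
proof (induction k)
  case (Suc k)
  show ?case
  proof (cases "ca < k")
    case True
    then show ?thesis using Suc h_antimono[of k "Suc k"] by auto
  next
    case False
    then have "gap E (Suc k) = ra" by (intro gap_ca) simp
    then show ?thesis using h_after[of "Suc k"] Suc.prems by simp
  qed
qed simp

lemma gap_le: "j \<le> k \<Longrightarrow> gap E k \<le> gap E j"
proof (induction rule: dec_induct)
  case (step k)
  then show ?case using gap_ge[of k E] by auto
qed simp

lemma gap_cong:
  assumes "q \<le> k" "gap E q = gap E' q" "\<And>j. q \<le> j \<Longrightarrow> j < k \<Longrightarrow> ca < j \<Longrightarrow> j \<in> E \<longleftrightarrow> j \<in> E'"
  shows "gap E k = gap E' k"
  using assms by (induction rule: dec_induct) auto

lemma gap_const:
  assumes "q \<le> k" "\<And>j. q \<le> j \<Longrightarrow> j < k \<Longrightarrow> ca < j \<Longrightarrow> j \<notin> E"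
  shows "gap E k = gap E q"
  using assms by (induction rule: dec_induct) auto

lemma chain_cong: "(\<And>j. ca < j \<Longrightarrow> j < cb \<Longrightarrow> j \<in> E \<longleftrightarrow> j \<in> E') \<Longrightarrow> chain E = chain E'"
proof
  fix v :: node assume E: "\<And>j. ca < j \<Longrightarrow> j < cb \<Longrightarrow> j \<in> E \<longleftrightarrow> j \<in> E'"
  have "gap E (snd v) = gap E' (snd v)" if "snd v \<le> cb"
    by (rule gap_cong[of 0]) (use E that in auto)
  then show "chain E v = chain E' v" using E[of "snd v"] by (auto simp: chain_def)
qed

end

text \<open>\<open>c T\<close> stands for the coefficient at the tabloid in which the entry at node
  \<open>v\<close> lies in row \<open>T v\<close>. \<open>column_swap\<close> and
  \<open>garnir_swap\<close> are relations of \<alpha>; \<open>content\<close> and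
  \<open>raise\<close> express membership in the Specht module of \<beta>. The Garnir relations are
  demanded for columns right of that of \<open>a\<close>, the range in which
  \<open>image_vector_garnir\<close> provides them.\<close>

locale singular_filling = box_move +
  fixes c :: "(node \<Rightarrow> nat) \<Rightarrow> 'f::field"
  assumes c_cong: "(\<And>v. v \<in> D \<Longrightarrow> T v = T' v) \<Longrightarrow> c T = c T'"
    and content: "c T \<noteq> 0 \<Longrightarrow> card {v \<in> D. T v = d} = \<beta> d"
    and column_swap: "i < h j \<Longrightarrow> i' < h j \<Longrightarrow> i \<noteq> i' \<Longrightarrow> c (T \<circ> transpose (i, j) (i', j)) = - c T"
    and garnir_swap: "ca < j \<Longrightarrow> r < h j \<Longrightarrow> k \<noteq> j \<Longrightarrow> h j \<le> h k \<Longrightarrow>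
       c T = (\<Sum>i<h k. c (T \<circ> transpose (r, j) (i, k)))"
    and raise: "d < d' \<Longrightarrow> (\<Sum>v | v \<in> D \<and> T v = d. c (T(v := d'))) = 0"
    and two: "(2 :: 'f) \<noteq> 0"
begin

text \<open>Swapping the two equal entries fixes the filling but changes the sign, so
  \<open>2 * c T = 0\<close>. This is where characteristic 2 is excluded.\<close>

lemma repeat_zero:
  assumes "i < h j" "i' < h j" "i \<noteq> i'" "T (i, j) = T (i', j)"
  shows "c T = 0"
proof -
  have "T \<circ> transpose (i, j) (i', j) = T" using assms(4) by (rule comp_transpose_eq)
  then have "c T = - c T" using column_swap[OF assms(1-3), of T] by simp
  then have "c T + c T = - c T + c T" by (rule arg_cong[where f = "\<lambda>x. x + c T"])
  then have "2 * c T = 0" by (simp only: mult_2 left_minus)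
  then show ?thesis using two by simp
qed

lemma raise_only:
  assumes "d < d'" "v \<in> D" "U v = d" and "\<And>w. w \<in> D \<Longrightarrow> w \<noteq> v \<Longrightarrow> U w = d \<Longrightarrow> c (U(w := d')) = 0"
  shows "c (U(v := d')) = 0"
proof -
  have "0 = (\<Sum>w | w \<in> D \<and> U w = d. c (U(w := d')))" using raise[OF assms(1), of U] by simp
  also have "\<dots> = c (U(v := d'))"
    by (rule sum_single_nonzero) (use assms finite_diagram[OF \<alpha>] in auto)
  finally show ?thesis by simp
qed

lemma garnir_only:
  assumes "ca < j" "r < h j" "k \<noteq> j" "h j \<le> h k" "s < h k"
    and "\<And>i. i < h k \<Longrightarrow> i \<noteq> s \<Longrightarrow> c (T \<circ> transpose (r, j) (i, k)) = 0"
  shows "c T = c (T \<circ> transpose (r, j) (s, k))"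
  unfolding garnir_swap[OF assms(1-4), of T]
  by (rule sum_single_nonzero) (use assms(5,6) in auto)

lemma garnir_repeat:
  assumes "r < h j" "k \<noteq> j" "i < h k" "i < r" "T (i, k) = i" "T (i, j) = i"
  shows "c (T \<circ> transpose (r, j) (i, k)) = 0"
  by (rule repeat_zero[of r j i]) (use assms in \<open>auto simp: transpose_def\<close>)

text \<open>Switching column \<open>q\<close> off when all columns between that of \<open>a\<close>
  and \<open>q\<close> are on. \<open>rest\<close> covers the chains obtained from
  \<open>insert q E\<close> by switching off columns before \<open>q\<close>; one term in
  \<open>zero_X\<close> is of this kind.\<close>

context
  fixes q :: nat and E :: "nat set"
  assumes q: "ca < q" "q < cb" and E: "{ca<..<q} \<subseteq> E" "q \<notin> E"
    and ins: "c (chain (insert q E)) = 0"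
    and rest: "\<And>E'. E' \<union> {ca<..<q} = insert q E \<Longrightarrow> c (chain E') = 0"
begin

text \<open>The next column whose bottom entry drops; it receives the hole that \<open>q\<close>
  would fill if switched on.\<close>

private definition "z = (LEAST z. q < z \<and> (z \<in> E \<or> z = cb))"

lemma next_col: "q < z" "z \<le> cb" "z \<in> E \<or> z = cb" and between: "q < j \<Longrightarrow> j < z \<Longrightarrow> j \<notin> E"
proof -
  have ex: "q < cb \<and> (cb \<in> E \<or> cb = cb)" using q by simp
  show "q < z" "z \<in> E \<or> z = cb"
    using LeastI[of "\<lambda>z. q < z \<and> (z \<in> E \<or> z = cb)", OF ex] by (auto simp: z_def)
  show "z \<le> cb" unfolding z_def by (rule Least_le) (use ex in simp)
  show "j \<notin> E" if "q < j" "j < z" using not_less_Least[of j "\<lambda>z. q < z \<and> (z \<in> E \<or> z = cb)"] that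
    by (auto simp: z_def)
qed

text \<open>\<open>k\<close> is the hole on arrival at column \<open>q\<close>; \<open>d\<close> and
  \<open>e\<close> are the bottom rows of \<open>q\<close> and \<open>z\<close>. Switching
  \<open>q\<close> on exchanges the values \<open>d\<close> and \<open>k\<close> of the nodes
  \<open>(d, q)\<close> and \<open>(e, z)\<close>.\<close>

private abbreviation "k \<equiv> gap E q"
private definition "d = h q - 1"
private definition "e = h z - 1"

lemma h_q: "h q = Suc d" using h_pos[of q] q by (simp add: d_def)

lemma h_z: "h z = Suc e" "h z \<le> h q" using h_pos[of z] next_col h_antimono[of q z] by (auto simp: e_def)

lemma gap_z: "gap E z = k"
  by (rule gap_const) (use next_col between E in \<open>auto simp: le_less\<close>)

lemma gap_ins_le: "j \<le> q \<Longrightarrow> gap (insert q E) j = gap E j"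
  by (rule gap_cong[of 0]) auto

lemma gap_ins_Suc: "gap (insert q E) (Suc q) = d"
  using q by (simp add: d_def)

lemma gap_ins_z: "gap (insert q E) z = d"
proof -
  have "gap (insert q E) z = gap (insert q E) (Suc q)"
    by (rule gap_const) (use next_col between in auto)
  then show ?thesis using gap_ins_Suc by simp
qed

lemma gap_ins_after:
  assumes "z < j" "j \<le> cb"
  shows "gap (insert q E) j = gap E j"
  by (rule gap_cong[of "Suc z"]) (use assms next_col q in auto)

lemma chain_E_q: "chain E (i, q) = i"
  using E q by (simp add: chain_def)

lemma chain_E_z: "chain E (e, z) = k"
  using next_col q h_z gap_z by (simp add: chain_def)

lemma chain_insert: "chain (insert q E) = (chain E)((e, z) := d, (d, q) := k)"
proof
  fix v :: node
  obtain i j where v: "v = (i, j)" by (cases v)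
  consider "j < q" | "j = q" | "q < j" "j < z" | "j = z" | "z < j" by linarith
  then show "chain (insert q E) v = ((chain E)((e, z) := d, (d, q) := k)) v"
  proof cases
    case 1
    then show ?thesis using next_col q gap_ins_le[of j] by (simp add: v chain_def)
  next
    case 2
    then show ?thesis using next_col q E gap_ins_le[of q] h_q by (auto simp: v chain_def)
  next
    case 3
    then show ?thesis using next_col q between[of j] by (auto simp: v chain_def)
  next
    case 4
    then show ?thesis using next_col q gap_ins_z h_z by (auto simp: v chain_def)
  next
    case 5
    then show ?thesis using next_col q gap_ins_after[of j] by (auto simp: v chain_def)
  qed
qed

lemma chain_low: "i < h j \<Longrightarrow> Suc i < h j \<Longrightarrow> chain E (i, j) = i"
  by (simp add: chain_def)

text \<open>The Garnir relation that moves the bottom entry of \<open>z\<close> into column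
  \<open>q\<close>: above the bottom row both columns carry their own row numbers, so one exchange
  survives, and it turns \<open>chain E\<close> into \<open>chain (insert q E)\<close>.\<close>

lemma zero_same_height:
  assumes "h z = h q"
  shows "c (chain E) = 0"
proof -
  have "c (chain E) = c (chain E \<circ> transpose (d, z) (d, q))"
  proof (rule garnir_only)
    show "c (chain E \<circ> transpose (d, z) (i, q)) = 0" if "i < h q" "i \<noteq> d" for i
      using that h_q assms next_col by (intro garnir_repeat chain_E_q chain_low) auto
  qed (use assms next_col q h_q in auto)
  also have "chain E \<circ> transpose (d, z) (d, q) = chain (insert q E)"
  proof -
    have "e = d" using assms h_q h_z by simp
    then show ?thesis
      using chain_E_z chain_E_q[of d] next_col(1)
          unfolding chain_insert by (auto simp: fun_eq_iff transpose_def)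
  qed
  finally show ?thesis using ins by simp
qed

text \<open>An entry that drops into its own row does not move, so both chains are the same
  filling.\<close>

lemma zero_no_drop:
  assumes "k = d"
  shows "c (chain E) = 0"
proof -
  have "chain (insert q E) = chain E"
    using chain_E_z chain_E_q[of d] assms unfolding chain_insert by (auto simp: fun_eq_iff)
  then show ?thesis using ins by simp
qed

context
  assumes hz: "h z < h q" and kd: "d < k"
begin

text \<open>The column whose entry in row \<open>k\<close> has been displaced.\<close>

private definition "p = (if k = ra then ca else (LEAST j. ca < j \<and> h j = Suc k))"

text \<open>In a block of equally high columns that all take part, the first one loses its bottom
  row and the others drop into their own row. So in the second case row \<open>k\<close> is the
  bottom row of all columns from \<open>p\<close> to \<open>q - 1\<close>, but its entry is
  displaced in column \<open>p\<close> alone.\<close>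

lemma p_cases:
  obtains (base) "p = ca" "h p = k" "k = ra"
  | (col) "ca < p" "p < q" "h p = Suc k" "k < gap E p" "\<And>j. ca < j \<Longrightarrow> j < p \<Longrightarrow> Suc k < h j"
      "\<And>j. p \<le> j \<Longrightarrow> j < q \<Longrightarrow> h j = Suc k"
proof (cases "k = ra")
  case True
  then show ?thesis using base h_ca by (simp add: p_def)
next
  case False
  then have q1: "ca < q - 1" using gap_ca[of q E] q by (cases "q = Suc ca") auto
  have "q - 1 \<in> E" using q1 E(1) by auto
  then have "gap E (Suc (q - 1)) = h (q - 1) - 1" using q1 by (subst gap.simps) simp
  then have hq1: "h (q - 1) = Suc k" using q1 h_pos[of "q - 1"] q by simp
  have p: "p = (LEAST j. ca < j \<and> h j = Suc k)" using False by (simp add: p_def)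
  have p1: "ca < p" "h p = Suc k"
    using LeastI[of "\<lambda>j. ca < j \<and> h j = Suc k" "q - 1"] q1 hq1 by (auto simp: p)
  have p2: "p \<le> q - 1" unfolding p by (rule Least_le) (use q1 hq1 in simp)
  have p3: "Suc k < h j" if "ca < j" "j < p" for j
    using not_less_Least[of j "\<lambda>j. ca < j \<and> h j = Suc k"] that h_antimono[of j p] p1 by (auto simp: p)
  have p4: "h j = Suc k" if "p \<le> j" "j < q" for j
    using h_antimono[of p j] h_antimono[of j "q - 1"] that p1 hq1 by auto
  have p5: "k < gap E p"
  proof (cases "p = Suc ca")
    case True
    then show ?thesis using gap_ca[of p E] h_after[of p] p1 by simp
  next
    case F: False
    then have p': "ca < p - 1" "p - 1 < q" using p1 p2 q1 by linarith+
    then have "p - 1 \<in> E" using E(1) by auto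
    then have "gap E (Suc (p - 1)) = h (p - 1) - 1" using p' by (subst gap.simps) simp
    then show ?thesis using p3[OF p'(1)] p1 by simp
  qed
  show ?thesis using col p1 p2 p3 p4 p5 q1 by auto
qed

lemma p_less: "p < q" by (cases rule: p_cases) (use q in auto)

lemma h_p: "h p = k \<or> h p = Suc k" by (cases rule: p_cases) auto

lemma chain_p: "i < k \<Longrightarrow> chain E (i, p) = i"
  using h_p by (cases rule: p_cases) (auto simp: chain_def)

text \<open>Writing a second \<open>k\<close> into any of these columns kills the coefficient; only
  \<open>p\<close> escapes this argument.\<close>

lemma chain_other:
  assumes "j < q" "j \<noteq> p"
  shows "k < h j" "chain E (k, j) = k"
proof -
  have "k < h j \<and> chain E (k, j) = k"
  proof (cases rule: p_cases)
    case base
    have "\<not> ca < j"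
    proof
      assume "ca < j"
      then have "gap E (Suc j) = h j - 1" using assms E(1) by auto
      moreover have "gap E q \<le> gap E (Suc j)" using assms by (intro gap_le) simp
      ultimately show False using base h_after[of j] \<open>ca < j\<close> assms h_pos[of j] q by auto
    qed
    then show ?thesis using base h_before[of j] assms by (simp add: chain_def)
  next
    case col
    consider "j \<le> ca" | "ca < j" "j < p" | "p < j" using assms by linarith
    then show ?thesis
    proof cases
      case 1
      then show ?thesis using h_antimono[of j p] col by (simp add: chain_def)
    next
      case 2
      then show ?thesis using col(5)[of j] by (simp add: chain_def)
    next
      case 3
      have "gap E j \<le> gap E (Suc p)" using 3 by (intro gap_le) simp
      moreover have "gap E (Suc p) = k" using col E(1) by auto
      moreover have "gap E q \<le> gap E j" using assms by (intro gap_le) simp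
      ultimately have "gap E j = k" by simp
      then show ?thesis using col(6)[of j] 3 assms by (simp add: chain_def)
    qed
  qed
  then show "k < h j" "chain E (k, j) = k" by auto
qed

text \<open>Displaced entries carry the numbers of holes. Up to column \<open>z\<close> the holes
  are at least \<open>k\<close>, and after \<open>z\<close> they are at most \<open>e\<close>, which
  is less than \<open>d\<close>.\<close>

lemma chain_value:
  assumes "(i, j) \<in> D" "chain E (i, j) = s" "d \<le> s" "s < k"
  shows "i = s"
proof (rule ccontr)
  assume ne: "i \<noteq> s"
  then have j: "ca < j" "j \<le> cb" "j \<in> E \<or> j = cb" "gap E j = s"
    using assms(2) by (auto simp: chain_def split: if_splits)
  consider "j \<le> q" | "q < j" "j < z" | "j = z" | "z < j" by linarith
  then show False
  proof cases
    case 1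
    then show ?thesis using gap_le[of j q E] j assms(4) by simp
  next
    case 2
    then show ?thesis using between[of j] j next_col by auto
  next
    case 3
    then show ?thesis using gap_z j assms by simp
  next
    case 4
    then have "gap E j \<le> gap E (Suc z)" by (intro gap_le) simp
    also have "\<dots> = e" using 4 next_col j q by (auto simp: e_def)
    finally show ?thesis using j assms hz h_z h_q by simp
  qed
qed

text \<open>Compared with \<open>chain E\<close> there is one \<open>d\<close> too many and one
  \<open>k\<close> too few. Raising a \<open>d\<close> of \<open>U\<close> to \<open>k\<close>
  restores the content, and doing so at \<open>(e, z)\<close> gives \<open>chain E\<close>
  back.\<close>

private abbreviation "U \<equiv> (chain E)((e, z) := d)"

text \<open>Such a column has the height of \<open>q\<close> and lies before \<open>z\<close>. If it
  is not \<open>q\<close> itself, a Garnir exchange with column \<open>q\<close> carries the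
  \<open>k\<close> over to \<open>(d, q)\<close>, and the result is
  \<open>chain (insert q E)\<close>.\<close>

lemma zero_V:
  assumes "q \<le> j" "d < h j"
  shows "c (U((d, j) := k)) = 0"
proof -
  have hj: "h j = Suc d" using assms h_antimono[of q j] h_q by simp
  have "\<not> z \<le> j" using hz hj h_q h_antimono[of z j] by auto
  then have jz: "j < z" by simp
  show ?thesis
  proof (cases "j = q")
    case True
    then show ?thesis using ins unfolding chain_insert by simp
  next
    case False
    then have jq: "q < j" using assms by simp
    have own: "chain E (i, j) = i" for i
      using jq jz between[of j] next_col by (simp add: chain_def)
    have "c (U((d, j) := k)) = c (U((d, j) := k) \<circ> transpose (d, j) (d, q))"
    proof (rule garnir_only)
      show "c (U((d, j) := k) \<circ> transpose (d, j) (i, q)) = 0" if "i < h q" "i \<noteq> d" for i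
        using that h_q hj jz jq next_col own chain_E_q by (intro garnir_repeat) auto
    qed (use hj h_q jq q in auto)
    also have "U((d, j) := k) \<circ> transpose (d, j) (d, q) = U((d, q) := k)"
      using jq jz next_col own chain_E_q by (auto simp: fun_eq_iff transpose_def)
    finally show ?thesis by (simp only: ins[unfolded chain_insert])
  qed
qed

lemma zero_other:
  assumes "j < q" "j \<noteq> p" "s < k" "W (k, j) = k"
  shows "c (W((s, j) := k)) = 0"
  by (rule repeat_zero[of s j k]) (use assms chain_other[of j] in auto)

text \<open>The kernel relation raising \<open>s\<close> to \<open>k\<close> in
  \<open>U((d, q) := s)\<close>. Raising \<open>(d, q)\<close> gives
  \<open>chain (insert q E)\<close>; every \<open>s\<close> apart from \<open>(d, q)\<close> and
  \<open>(s, p)\<close> lies in a column that already contains \<open>k\<close>.\<close>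

lemma zero_Y:
  assumes "d < s" "s < k"
  shows "c (U((d, q) := s, (s, p) := k)) = 0"
proof (rule raise_only)
  show "s < k" by fact
  have sp: "(s, p) \<noteq> (d, q)" "(s, p) \<noteq> (e, z)" using p_less next_col by auto
  show "(s, p) \<in> D" using assms h_p by (auto simp: D_iff)
  show "(U((d, q) := s)) (s, p) = s" using sp chain_p assms by simp
  fix w assume w: "w \<in> D" "w \<noteq> (s, p)" "(U((d, q) := s)) w = s"
  obtain i j where ij: "w = (i, j)" by (cases w)
  show "c (U((d, q) := s, w := k)) = 0"
  proof (cases "w = (d, q)")
    case True
    then show ?thesis using zero_V[of q] h_q by simp
  next
    case False
    then have "w \<noteq> (e, z)" "chain E (i, j) = s" using w assms ij by (auto split: if_splits)
    then have i: "i = s" using chain_value[of i j s] w assms ij by simp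
    have "j < q"
    proof (rule ccontr)
      assume "\<not> j < q"
      then have "h j \<le> Suc d" using h_antimono[of q j] h_q by simp
      then show False using w ij i assms by (simp add: D_iff)
    qed
    moreover have "j \<noteq> p" using w ij i by auto
    ultimately show ?thesis
      unfolding ij i using chain_other[of j] next_col assms by (intro zero_other) auto
  qed
qed

text \<open>The Garnir relation that moves the \<open>k\<close> at \<open>(d, q)\<close> of
  \<open>chain (insert q E)\<close> into column \<open>p\<close>. The exchange with row
  \<open>d\<close> gives the filling in question; rows above \<open>d\<close> produce a repetition,
  rows between \<open>d\<close> and \<open>k\<close> are settled by \<open>zero_Y\<close>, and row
  \<open>k\<close>, if column \<open>p\<close> has it, leads to another chain covered by
  \<open>rest\<close>.\<close>

lemma zero_X: "c (U((d, p) := k)) = 0"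
proof -
  let ?V = "U((d, q) := k)"
  have own: "?V (i, p) = i" if "i < k" for i using chain_p[OF that] p_less next_col that by auto
  have tr: "?V \<circ> transpose (d, q) (i, p) = U((d, q) := ?V (i, p), (i, p) := k)" for i
    using p_less next_col by (auto simp: fun_eq_iff transpose_def)
  have "c ?V = c (?V \<circ> transpose (d, q) (d, p))"
  proof (rule garnir_only)
    show "ca < q" "d < h q" "d < h p" "h q \<le> h p" "p \<noteq> q"
      using q h_q h_p kd p_less by auto
    fix i assume i: "i < h p" "i \<noteq> d"
    consider "i < d" | "d < i" "i < k" | "i = k" "h p = Suc k" using i h_p by linarith
    then show "c (?V \<circ> transpose (d, q) (i, p)) = 0"
    proof cases
      case 1
      then show ?thesis using i h_q p_less own[of i] kd chain_E_q next_col by (intro garnir_repeat) auto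
    next
      case 2
      then show ?thesis unfolding tr own[OF 2(2)] by (rule zero_Y)
    next
      case 3
      \<comment> \<open>The block of columns of height \<open>Suc k\<close> before \<open>q\<close>.
        The exchange gives \<open>p\<close> its row \<open>k\<close> back and hands its displaced
        value to \<open>q\<close>: none of the block takes part any longer, and \<open>q\<close>
        fills the hole that \<open>p\<close> used to fill.\<close>
      define B where "B = {j. ca < j \<and> j < q \<and> h j = Suc k}"
      define E' where "E' = insert q (E - B)"
      have col: "ca < p" "k < gap E p" "\<And>j. ca < j \<Longrightarrow> j < p \<Longrightarrow> Suc k < h j"
          "\<And>j. p \<le> j \<Longrightarrow> j < q \<Longrightarrow> h j = Suc k"
        using 3 by (cases rule: p_cases; auto)+
      have gap_p: "gap E' j = gap E j" if "j \<le> p" for j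
      proof (rule gap_cong[of 0])
        show "i \<in> E' \<longleftrightarrow> i \<in> E" if "i < j" "ca < i" for i
          using that \<open>j \<le> p\<close> p_less col(3)[of i] by (auto simp: E'_def B_def)
      qed auto
      have E'_mid: "j \<notin> E'" if "p \<le> j" "j < q" for j
        using that col by (auto simp: E'_def B_def)
      have gap_q: "gap E' q = gap E p"
      proof -
        have "gap E' q = gap E' p" by (rule gap_const) (use p_less E'_mid in auto)
        then show ?thesis using gap_p by simp
      qed
      have E'_after: "j \<in> E' \<longleftrightarrow> j \<in> E" if "q < j" for j
        using that by (auto simp: E'_def B_def)
      have gap_z': "gap E' z = d"
      proof -
        have "gap E' z = gap E' (Suc q)" by (rule gap_const) (use next_col between E'_after in auto)
        then show ?thesis using q by (simp add: E'_def d_def)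
      qed
      have gap_after: "gap E' j = gap E j" if "z < j" "j \<le> cb" for j
        by (rule gap_cong[of "Suc z"]) (use that next_col q E'_after in auto)
      have gap_block: "gap E j = k" if "p < j" "j < q" for j
      proof -
        have "gap E j \<le> gap E (Suc p)" using that by (intro gap_le) simp
        moreover have "gap E (Suc p) = k" using col 3 E(1) p_less by auto
        moreover have "gap E q \<le> gap E j" using that by (intro gap_le) simp
        ultimately show ?thesis by simp
      qed
      have p_E: "p \<in> E" using col p_less E(1) by auto
      have Vp: "?V (k, p) = gap E p"
        using p_less next_col col p_E 3 q by (simp add: chain_def)
      have "chain E' = U((d, q) := gap E p, (k, p) := k)"
      proof
        fix v :: node
        obtain i j where v: "v = (i, j)" by (cases v)
        consider "j < p" | "j = p" | "p < j" "j < q" | "j = q" | "q < j" "j < z" | "j = z" | "z < j"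
          by linarith
        then show "chain E' v = (U((d, q) := gap E p, (k, p) := k)) v"
        proof cases
          case 1
          then have "ca < j \<Longrightarrow> j \<in> E' \<longleftrightarrow> j \<in> E" using p_less col(3)[of j] by (auto simp: E'_def B_def)
          then show ?thesis using 1 next_col p_less gap_p[of j] by (auto simp: v chain_def)
        next
          case 2
          then show ?thesis
            using E'_mid[of p] p_less next_col \<open>h p = Suc k\<close> q by (auto simp: v chain_def)
        next
          case 3
          then show ?thesis
            using E'_mid[of j] col(4)[of j] gap_block[of j] q next_col by (auto simp: v chain_def)
        next
          case 4
          then show ?thesis using gap_q h_q q next_col p_less E by (auto simp: v chain_def E'_def)
        next
          case 5
          then show ?thesis
            using E'_after[of j] between[of j] next_col q p_less by (auto simp: v chain_def)
        next
          case 6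
          then show ?thesis using E'_after[of z] gap_z' next_col q p_less h_z by (auto simp: v chain_def)
        next
          case 7
          then show ?thesis
            using E'_after[of j] gap_after[of j] next_col q p_less by (auto simp: v chain_def)
        qed
      qed
      then have "?V \<circ> transpose (d, q) (i, p) = chain E'"
        unfolding tr 3(1) Vp by simp
      moreover have "E' \<union> {ca<..<q} = insert q E" using E by (auto simp: E'_def B_def)
      ultimately show ?thesis using rest by simp
    qed
  qed
  moreover have "?V \<circ> transpose (d, q) (d, p) = U((d, p) := k)"
    using own[OF kd] unfolding tr using next_col chain_E_q[of d] by (auto simp: fun_eq_iff)
  ultimately show ?thesis using zero_V[of q] h_q by simp
qed

text \<open>The kernel relation raising \<open>d\<close> to \<open>k\<close> in \<open>U\<close>.
  The other terms vanish by \<open>zero_V\<close> from column \<open>q\<close> on, by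
  \<open>zero_X\<close> in column \<open>p\<close>, and by a repeated \<open>k\<close> in the
  remaining columns.\<close>

lemma zero_drop: "c (chain E) = 0"
proof -
  have eq: "U((e, z) := k) = chain E" using chain_E_z by (simp add: fun_upd_idem)
  have "c (U((e, z) := k)) = 0"
  proof (rule raise_only)
    show "d < k" by (rule kd)
    show "(e, z) \<in> D" using h_z by (simp add: D_iff)
    show "U (e, z) = d" by simp
    fix w assume w: "w \<in> D" "w \<noteq> (e, z)" "U w = d"
    obtain i j where ij: "w = (i, j)" by (cases w)
    have "chain E (i, j) = d" using w ij by (auto split: if_splits)
    then have "i = d" using chain_value[of i j d] w ij kd by simp
    then have w': "w = (d, j)" "d < h j" using w ij by (auto simp: D_iff)
    show "c (U(w := k)) = 0"
    proof (cases "q \<le> j")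
      case True
      then show ?thesis using zero_V w' by simp
    next
      case False
      then show ?thesis
        using zero_X zero_other[of j d U] chain_other[of j] kd w' next_col by (cases "j = p") auto
    qed
  qed
  then show ?thesis unfolding eq .
qed

end

lemma chain_step: "c (chain E) = 0"
proof -
  have "d \<le> k" using gap_ge[of q E] q by (simp add: d_def)
  then consider "h z = h q" | "k = d" | "h z < h q" "d < k" using h_z(2) by linarith
  then show ?thesis by cases (simp_all add: zero_same_height zero_no_drop zero_drop)
qed

end

text \<open>Columns are switched off one at a time. The induction hypothesis is kept for all
  \<open>E\<close>: it leads from the intermediate chain to \<open>E\<close>, and it also supplies
  the assumption \<open>rest\<close> of \<open>chain_step\<close>.\<close>

lemma chain_zero:
  assumes top: "c (chain UNIV) = 0"
  shows "c (chain E) = 0"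
proof -
  have "\<forall>E. c (chain (E \<union> {ca<..<q})) = 0 \<longrightarrow> c (chain E) = 0" if "q \<le> cb" for q
    using that
  proof (induction q)
    case (Suc q)
    show ?case
    proof (intro allI impI)
      fix E assume *: "c (chain (E \<union> {ca<..<Suc q})) = 0"
      have IH: "c (chain E) = 0" if "c (chain (E \<union> {ca<..<q})) = 0" for E using Suc that by simp
      show "c (chain E) = 0"
      proof (cases "ca < q \<and> q \<notin> E")
        case True
        let ?E = "E \<union> {ca<..<q}"
        have ins: "E \<union> {ca<..<Suc q} = insert q ?E" using True by auto
        have "c (chain ?E) = 0"
        proof (rule chain_step[of q])
          show "c (chain (insert q ?E)) = 0" using * unfolding ins .
          show "c (chain E') = 0" if "E' \<union> {ca<..<q} = insert q ?E" for E'
            using IH[of E'] * unfolding ins that .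
        qed (use True Suc in auto)
        then show ?thesis by (rule IH)
      next
        case False
        then have "E \<union> {ca<..<Suc q} = E \<union> {ca<..<q}" by (auto simp: less_Suc_eq)
        then show ?thesis using IH * by simp
      qed
    qed
  qed simp
  moreover have "chain (E \<union> {ca<..<cb}) = chain UNIV" by (rule chain_cong) auto
  ultimately show ?thesis using top by (metis order_refl)
qed

end

section \<open>Nonzero fillings of maximal weight are chains\<close>

lemma strict_mono_image_unique:
  fixes f g :: "nat \<Rightarrow> nat"
  assumes "\<And>i j. i < j \<Longrightarrow> j < m \<Longrightarrow> f i < f j" "\<And>i j. i < j \<Longrightarrow> j < m \<Longrightarrow> g i < g j"
    and im: "f ` {..<m} = g ` {..<m}" and "i < m"
  shows "f i = g i"
  using \<open>i < m\<close>
proof (induction i rule: less_induct)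
  case (less i)
  have "g i \<in> f ` {..<m}" "f i \<in> g ` {..<m}" using less.prems im by blast+
  then obtain j k where jk: "j < m" "g i = f j" "k < m" "f i = g k" by auto
  have "i \<le> j"
  proof (rule ccontr)
    assume "\<not> i \<le> j"
    then show False using less.IH[of j] assms(2)[of j i] jk less.prems by auto
  qed
  then have "f i \<le> g i" using assms(1)[of i j] jk by (cases "i = j") auto
  have "i \<le> k"
  proof (rule ccontr)
    assume "\<not> i \<le> k"
    then show False using less.IH[of k] assms(1)[of k i] jk less.prems by auto
  qed
  then have "g i \<le> f i" using assms(2)[of i k] jk by (cases "i = k") auto
  with \<open>f i \<le> g i\<close> show ?case by simp
qed

lemma sum_less_two_changes:
  fixes f f' :: "'b \<Rightarrow> nat"
  assumes "finite A" "u \<in> A" "v \<in> A" "u \<noteq> v" "f u + f v < f' u + f' v"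
    and "\<And>w. w \<in> A \<Longrightarrow> w \<noteq> u \<Longrightarrow> w \<noteq> v \<Longrightarrow> f' w = f w"
  shows "sum f A < sum f' A"
proof -
  have A: "A = insert u (insert v (A - {u, v}))" using assms by auto
  have split: "sum g A = g u + g v + sum g (A - {u, v})" for g :: "'b \<Rightarrow> nat"
    by (subst A) (use assms(1,4) in simp)
  have "sum f' (A - {u, v}) = sum f (A - {u, v})" by (rule sum.cong) (use assms(6) in auto)
  then show ?thesis using assms(5) by (simp add: split)
qed

context box_move
begin

lemma beta_iff: "k < \<beta> d \<longleftrightarrow> d < ht \<beta> k"
  using less_ht_iff[OF \<beta>] by simp

lemma card_cols_\<alpha>: "card {v \<in> diagram \<alpha>. snd v < k} + (if ca < k then 1 else 0) = card {v \<in> diagram lam. snd v < k}"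
proof (cases "ca < k")
  case True
  then have eq: "{v \<in> diagram lam. snd v < k} = insert (ra, ca) {v \<in> diagram \<alpha>. snd v < k}"
    unfolding diag_\<alpha> using a_in by auto
  have notin: "(ra, ca) \<notin> {v \<in> diagram \<alpha>. snd v < k}" by (simp add: diag_\<alpha>)
  have fin: "finite {v \<in> diagram \<alpha>. snd v < k}" using finite_diagram[OF \<alpha>] by simp
  show ?thesis unfolding eq card_insert_disjoint[OF fin notin] using True by simp
next
  case False
  then have "{v \<in> diagram \<alpha>. snd v < k} = {v \<in> diagram lam. snd v < k}"
    unfolding diag_\<alpha> by auto
  then show ?thesis using False by simp
qed

lemma card_cols_\<beta>: "card {v \<in> diagram \<beta>. snd v < k} + (if cb < k then 1 else 0) = card {v \<in> diagram lam. snd v < k}"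
proof (cases "cb < k")
  case True
  then have eq: "{v \<in> diagram lam. snd v < k} = insert (rb, cb) {v \<in> diagram \<beta>. snd v < k}"
    unfolding diag_\<beta> using b_in by auto
  have notin: "(rb, cb) \<notin> {v \<in> diagram \<beta>. snd v < k}" by (simp add: diag_\<beta>)
  have fin: "finite {v \<in> diagram \<beta>. snd v < k}" using finite_diagram[OF \<beta>] by simp
  show ?thesis unfolding eq card_insert_disjoint[OF fin notin] using True by simp
next
  case False
  then have "{v \<in> diagram \<beta>. snd v < k} = {v \<in> diagram lam. snd v < k}"
    unfolding diag_\<beta> by auto
  then show ?thesis using False by simp
qed

end

context singular_filling
begin

lemma filling_less:
  assumes "c T \<noteq> 0" "v \<in> D"
  shows "T v < ht lam 0"
proof -
  have fin: "finite {w \<in> D. T w = T v}" using finite_diagram[OF \<alpha>] by simp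
  have "card {w \<in> D. T w = T v} \<noteq> 0" unfolding card_0_eq[OF fin] using assms(2) by blast
  then have "0 < \<beta> (T v)" using content[OF assms(1), of "T v"] by simp
  then show ?thesis using beta_iff[of 0] less_ht_\<beta>[of "T v" 0] by simp
qed

context
  fixes T :: "node \<Rightarrow> nat" and M :: nat \<comment> \<open>\<open>M\<close> makes the column dominate the row in the weight of a node\<close>
  assumes nz: "c T \<noteq> 0" and M: "\<And>j. h j < M"
    and maximal: "\<And>T'. c T' \<noteq> 0 \<Longrightarrow> (\<Sum>v\<in>D. (M * snd v + fst v) * T' v) \<le> (\<Sum>v\<in>D. (M * snd v + fst v) * T v)"
begin

lemma not_better:
  assumes "u \<in> D" "v \<in> D" "u \<noteq> v" "\<And>w. w \<in> D \<Longrightarrow> w \<noteq> u \<Longrightarrow> w \<noteq> v \<Longrightarrow> T' w = T w"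
    and "(M * snd u + fst u) * T u + (M * snd v + fst v) * T v < (M * snd u + fst u) * T' u + (M * snd v + fst v) * T' v"
  shows "c T' = 0"
proof (rule ccontr)
  assume "c T' \<noteq> 0"
  from maximal[OF this] sum_less_two_changes[OF finite_diagram[OF \<alpha>] assms(1-3,5)] assms(4)
  show False by fastforce
qed

text \<open>Swapping an inversion changes only the sign of \<open>c\<close> and puts the larger
  value on the lower, heavier node.\<close>

lemma T_increasing:
  assumes "i < i'" "i' < h k"
  shows "T (i, k) < T (i', k)"
proof (rule ccontr)
  assume "\<not> ?thesis"
  moreover have "T (i, k) \<noteq> T (i', k)" using repeat_zero[of i k i' T] nz assms by auto
  ultimately have gt: "T (i', k) < T (i, k)" by simp
  define x where "x = T (i, k) - T (i', k)"
  have x: "T (i, k) = T (i', k) + x" "0 < x" using gt by (simp_all add: x_def)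
  define y where "y = i' - i"
  have y: "i' = i + y" "0 < y" using assms(1) by (simp_all add: y_def)
  let ?T = "T \<circ> transpose (i, k) (i', k)"
  have "c ?T = 0"
  proof (rule not_better[of "(i, k)" "(i', k)"])
    show "(M * snd (i, k) + fst (i, k)) * T (i, k) + (M * snd (i', k) + fst (i', k)) * T (i', k)
        < (M * snd (i, k) + fst (i, k)) * ?T (i, k) + (M * snd (i', k) + fst (i', k)) * ?T (i', k)"
      using x(2) y(2) unfolding x(1) y(1)
          by (simp add: transpose_def x(1) y(1)[symmetric]) (simp add: y(1) algebra_simps)
  qed (use assms in \<open>auto simp: D_iff\<close>)
  moreover have "c ?T = - c T" by (rule column_swap) (use assms in auto)
  ultimately show False using nz by simp
qed

private definition "S k = (\<lambda>i. T (i, k)) ` {..<h k}"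

text \<open>The kernel relation raising \<open>e\<close> to \<open>Suc e\<close>, for
  \<open>T\<close> with the \<open>Suc e\<close> of column \<open>k\<close> lowered to
  \<open>e\<close>. As \<open>c T\<close> is nonzero, another term survives, and it arises from
  \<open>T\<close> by exchanging that \<open>Suc e\<close> with an \<open>e\<close> of another
  column. Maximality excludes columns to the right, and a column already containing
  \<open>Suc e\<close> would have a repetition.\<close>

lemma lattice_word:
  assumes "e \<notin> S k" "Suc e \<in> S k"
  obtains j where "j < k" "e \<in> S j" "Suc e \<notin> S j"
proof -
  obtain i where i: "i < h k" "T (i, k) = Suc e" using assms(2) by (auto simp: S_def)
  let ?u = "(i, k)" and ?U = "T((i, k) := e)"
  have "\<exists>v. v \<in> D \<and> v \<noteq> ?u \<and> ?U v = e \<and> c (?U(v := Suc e)) \<noteq> 0"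
  proof (rule ccontr)
    assume none: "\<not> ?thesis"
    have "c (?U(?u := Suc e)) = 0"
    proof (rule raise_only)
      show "c (?U(w := Suc e)) = 0" if "w \<in> D" "w \<noteq> ?u" "?U w = e" for w using none that by blast
    qed (use i in \<open>simp_all add: D_iff\<close>)
    moreover have "?U(?u := Suc e) = T" using i by auto
    ultimately show False using nz by simp
  qed
  then obtain i2 k2 where v: "(i2, k2) \<in> D" "(i2, k2) \<noteq> ?u" "?U (i2, k2) = e" "c (?U((i2, k2) := Suc e)) \<noteq> 0"
    by auto
  then have Tv: "T (i2, k2) = e" "i2 < h k2" by (auto simp: D_iff)
  have "k2 \<noteq> k" using assms(1) Tv by (auto simp: S_def)
  moreover have "\<not> k < k2"
  proof
    assume "k < k2"
    then have "M * k + M \<le> M * k2" by (metis Suc_leI mult_Suc_right mult_le_mono2 add.commute)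
    then have "M * k + i < M * k2 + i2" using M[of k] i(1) by linarith
    then have "c (?U((i2, k2) := Suc e)) = 0"
      by (intro not_better[of ?u "(i2, k2)"]) (use v Tv i in \<open>auto simp: D_iff\<close>)
    then show False using v by simp
  qed
  ultimately have "k2 < k" by simp
  moreover have "e \<in> S k2" using Tv by (auto simp: S_def)
  moreover have "Suc e \<notin> S k2"
  proof
    assume "Suc e \<in> S k2"
    then obtain i3 where i3: "i3 < h k2" "T (i3, k2) = Suc e" by (auto simp: S_def)
    have "c (?U((i2, k2) := Suc e)) = 0"
      by (rule repeat_zero[of i2 k2 i3]) (use i3 Tv \<open>k2 < k\<close> in auto)
    then show False using v by simp
  qed
  ultimately show ?thesis by (rule that)
qed

text \<open>Counting entries in the first \<open>k\<close> columns shows that they fill the first \<open>k\<close> columns of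
  \<open>\<beta>\<close> up to at most one missing node, in the row called \<open>g k\<close> below.\<close>

private definition "cnt k d = card {v \<in> D. snd v < k \<and> T v = d}"

lemma T_inj: "i < h k \<Longrightarrow> i' < h k \<Longrightarrow> T (i, k) = T (i', k) \<Longrightarrow> i = i'"
  using repeat_zero[of i k i' T] nz by auto

lemma cnt_Suc: "cnt (Suc k) d = cnt k d + of_bool (d \<in> S k)"
proof -
  have eq: "{v \<in> D. snd v < Suc k \<and> T v = d} = {v \<in> D. snd v < k \<and> T v = d} \<union> {v \<in> D. snd v = k \<and> T v = d}"
    by auto
  have "card {v \<in> D. snd v = k \<and> T v = d} = of_bool (d \<in> S k)"
  proof (cases "d \<in> S k")
    case True
    then obtain i where i: "i < h k" "T (i, k) = d" by (auto simp: S_def)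
    then have "{v \<in> D. snd v = k \<and> T v = d} = {(i, k)}" using T_inj by (auto simp: D_iff)
    then show ?thesis using True by simp
  next
    case False
    then have "{v \<in> D. snd v = k \<and> T v = d} = {}" by (auto simp: D_iff S_def)
    then have "card {v \<in> D. snd v = k \<and> T v = d} = 0" by (simp only: card.empty)
    then show ?thesis using False by simp
  qed
  then show ?thesis unfolding cnt_def eq
    by (subst card_Un_disjoint) (use finite_diagram[OF \<alpha>] in auto)
qed

lemma cnt_le: "cnt k d \<le> min k (\<beta> d)"
proof -
  have "cnt k d \<le> k" by (induction k) (auto simp: cnt_Suc, simp add: cnt_def)
  moreover have "cnt k d \<le> card {v \<in> D. T v = d}"
    unfolding cnt_def by (rule card_mono) (use finite_diagram[OF \<alpha>] in auto)
  ultimately show ?thesis using content[OF nz, of d] by simp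
qed

private definition "deficit k d \<longleftrightarrow> cnt k d < min k (\<beta> d)"

text \<open>The two sums count the nodes in the first \<open>k\<close> columns of \<alpha> and of
  \<beta>. Both diagrams lack one node of \<open>lam\<close>, and the count notices this once
  \<open>k\<close> passes the column of that node. By \<open>cnt_le\<close> the subtraction is never
  truncated.\<close>

lemma sum_deficit: "(\<Sum>d<ht lam 0. min k (\<beta> d) - cnt k d) = of_bool (ca < k \<and> k \<le> cb)"
proof -
  have 1: "(\<Sum>d<ht lam 0. cnt k d) = card {v \<in> D. snd v < k}"
  proof -
    have "{v \<in> D. snd v < k} = (\<Union>d<ht lam 0. {v \<in> D. snd v < k \<and> T v = d})"
      using filling_less[OF nz] by auto
    then show ?thesis unfolding cnt_def
      by (simp only:) (subst card_UN_disjoint, use finite_diagram[OF \<alpha>] in auto)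
  qed
  have 2: "(\<Sum>d<ht lam 0. min k (\<beta> d)) = card {v \<in> diagram \<beta>. snd v < k}"
  proof -
    have "{v \<in> diagram \<beta>. snd v < k} = (SIGMA d:{..<ht lam 0}. {..<min k (\<beta> d)})"
      using beta_iff less_ht_\<beta>[of _ 0] by (fastforce simp: diagram_def)
    then show ?thesis by simp
  qed
  have "(\<Sum>d<ht lam 0. min k (\<beta> d) - cnt k d) + (\<Sum>d<ht lam 0. cnt k d) = (\<Sum>d<ht lam 0. min k (\<beta> d))"
    unfolding sum.distrib[symmetric] by (intro sum.cong refl) (use cnt_le in simp)
  then have "(\<Sum>d<ht lam 0. min k (\<beta> d) - cnt k d) + card {v \<in> D. snd v < k} = card {v \<in> diagram \<beta>. snd v < k}"
    by (simp only: 1 2)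
  then show ?thesis using card_cols_\<alpha>[of k] card_cols_\<beta>[of k] cols
    by (cases "ca < k"; cases "cb < k") (simp_all del: sum_eq_0_iff)
qed

lemma deficit_less: "deficit k d \<Longrightarrow> d < ht lam 0"
  using beta_iff[of 0 d] less_ht_\<beta>[of d 0] by (auto simp: deficit_def)

lemma deficit_le: "min k (\<beta> d) - cnt k d \<le> of_bool (ca < k \<and> k \<le> cb)"
proof (cases "d < ht lam 0")
  case True
  then show ?thesis unfolding sum_deficit[symmetric] by (intro member_le_sum) auto
next
  case False
  then have "\<not> deficit k d" using deficit_less by blast
  then have "min k (\<beta> d) - cnt k d = 0" unfolding deficit_def by linarith
  then show ?thesis by (simp only: le0)
qed

lemma no_deficit:
  assumes "\<not> (ca < k \<and> k \<le> cb)"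
  shows "\<not> deficit k d"
proof -
  have "min k (\<beta> d) - cnt k d \<le> 0" using deficit_le[of k d] by (simp only: assms of_bool_eq)
  then show ?thesis unfolding deficit_def by linarith
qed

lemma cnt_deficit: "min k (\<beta> d) = cnt k d + of_bool (deficit k d)"
proof -
  have "min k (\<beta> d) - cnt k d \<le> 1" using deficit_le[of k d] by (simp add: of_bool_def split: if_splits)
  then show ?thesis using cnt_le[of k d]
    unfolding deficit_def of_bool_def by (simp only: split: if_split) linarith
qed

lemma deficit_unique: "ca < k \<Longrightarrow> k \<le> cb \<Longrightarrow> \<exists>!d. deficit k d"
proof -
  assume k: "ca < k" "k \<le> cb"
  have "(\<Sum>d<ht lam 0. min k (\<beta> d) - cnt k d) = 1" using sum_deficit[of k] k by simp
  then obtain d where d: "d < ht lam 0" "min k (\<beta> d) - cnt k d = 1"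
      "\<And>d'. d' < ht lam 0 \<Longrightarrow> d' \<noteq> d \<Longrightarrow> min k (\<beta> d') - cnt k d' = 0"
    using sum_eq_1_iff[of "{..<ht lam 0}" "\<lambda>d. min k (\<beta> d) - cnt k d"] by auto
  show ?thesis
  proof (rule ex1I)
    show "deficit k d" using d(2) unfolding deficit_def by linarith
    show "d' = d" if "deficit k d'" for d'
      using that d(3)[OF deficit_less[OF that]] unfolding deficit_def by linarith
  qed
qed

text \<open>Conservation of the missing node: column \<open>k\<close> of \<open>T\<close> consists
  of the rows of column \<open>k\<close> of \<beta>, together with the row missing before it and
  without the row missing after it.\<close>

lemma step_eq: "of_bool (d \<in> S k) + of_bool (deficit (Suc k) d) = (of_bool (d < ht \<beta> k) + of_bool (deficit k d) :: nat)"
proof -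
  have "min (Suc k) (\<beta> d) = min k (\<beta> d) + of_bool (d < ht \<beta> k)"
    unfolding beta_iff[symmetric] by (simp add: min_def)
  then show ?thesis using cnt_deficit[of k d] cnt_deficit[of "Suc k" d] cnt_Suc[of k d] by linarith
qed

private definition "g k = (THE d. deficit k d)"

lemma deficit_iff: "ca < k \<Longrightarrow> k \<le> cb \<Longrightarrow> deficit k d \<longleftrightarrow> d = g k"
  using deficit_unique[of k] unfolding g_def by (metis theI')

lemma S_before:
  assumes "k < ca"
  shows "S k = {..<h k}"
proof -
  have "d \<in> S k \<longleftrightarrow> d < h k" for d
    using step_eq[of d k] no_deficit[of k d] no_deficit[of "Suc k" d] assms cols
        by (auto simp: ht_\<beta> ht_\<alpha> of_bool_def split: if_splits)
  then show ?thesis by blast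
qed

lemma S_after:
  assumes "cb < k"
  shows "S k = {..<h k}"
proof -
  have "d \<in> S k \<longleftrightarrow> d < h k" for d
    using step_eq[of d k] no_deficit[of k d] no_deficit[of "Suc k" d] assms cols
        by (auto simp: ht_\<beta> ht_\<alpha> of_bool_def split: if_splits)
  then show ?thesis by blast
qed

lemma S_ca: "d \<in> S ca \<longleftrightarrow> d \<le> ra \<and> d \<noteq> g (Suc ca)" and g_first_le: "g (Suc ca) \<le> ra"
proof -
  have *: "of_bool (d \<in> S ca) + of_bool (d = g (Suc ca)) = (of_bool (d \<le> ra) :: nat)" for d
    using step_eq[of d ca] no_deficit[of ca d] deficit_iff[of "Suc ca" d] cols ht_lam_ca
        by (auto simp: ht_\<beta> of_bool_def split: if_splits)
  show "d \<in> S ca \<longleftrightarrow> d \<le> ra \<and> d \<noteq> g (Suc ca)" using *[of d] by (auto simp: of_bool_def split: if_splits)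
  show "g (Suc ca) \<le> ra" using *[of "g (Suc ca)"] by (auto simp: of_bool_def split: if_splits)
qed

lemma S_mid:
  assumes "ca < k" "k < cb"
  shows "of_bool (d \<in> S k) + of_bool (d = g (Suc k)) = (of_bool (d < h k) + of_bool (d = g k) :: nat)"
  using step_eq[of d k] deficit_iff[of k d] deficit_iff[of "Suc k" d] assms by (simp add: ht_\<beta> ht_\<alpha>)

lemma S_cb: "of_bool (d \<in> S cb) = (of_bool (d < rb) + of_bool (d = g cb) :: nat)"
  using step_eq[of d cb] deficit_iff[of cb d] no_deficit[of "Suc cb" d] cols by (simp add: ht_\<beta>)

text \<open>If a row above \<open>ra\<close> were missing, the row below it would occur in column
  \<open>ca\<close>, and the lattice condition would demand an earlier column without that row; but
  earlier columns contain all rows down to \<open>ra\<close>.\<close>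

lemma g_first: "g (Suc ca) = ra"
proof (rule ccontr)
  assume "g (Suc ca) \<noteq> ra"
  then have "g (Suc ca) \<notin> S ca" "Suc (g (Suc ca)) \<in> S ca" using S_ca g_first_le by auto
  then obtain j where j: "j < ca" "g (Suc ca) \<in> S j" "Suc (g (Suc ca)) \<notin> S j" by (rule lattice_word)
  have "g (Suc ca) \<noteq> ra" by fact
  then have "Suc (g (Suc ca)) < h j" using h_before[OF j(1)] g_first_le by linarith
  then show False using S_before[OF j(1)] j(3) by simp
qed

text \<open>When the missing row changes, column \<open>k\<close> absorbs the old hole and lacks a
  row \<open>?e\<close> of its own. Were this not its bottom row, the lattice condition would give
  an earlier column without \<open>Suc ?e\<close>, making \<open>Suc ?e\<close> the missing row
  after that column, which is too small for the monotonicity of \<open>g\<close>.\<close>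

lemma g_step:
  assumes "ca < k" "k < cb" "h k - 1 \<le> g k" and mono: "\<And>j. ca < j \<Longrightarrow> j \<le> k \<Longrightarrow> g k \<le> g j"
    and ne: "g (Suc k) \<noteq> g k"
  shows "g (Suc k) = h k - 1" "h k \<le> g k"
proof -
  let ?e = "g (Suc k)"
  have e: "?e < h k" "?e \<notin> S k"
    using S_mid[OF assms(1,2), of ?e] ne by (auto simp: of_bool_def split: if_splits)
  show gk: "h k \<le> g k"
    using S_mid[OF assms(1,2), of "g k"] ne by (auto simp: of_bool_def split: if_splits)
  show "?e = h k - 1"
  proof (rule ccontr)
    assume "?e \<noteq> h k - 1"
    then have e1: "Suc ?e < h k" using e by simp
    then have "Suc ?e \<in> S k"
      using S_mid[OF assms(1,2), of "Suc ?e"] gk by (auto simp: of_bool_def split: if_splits)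
    then obtain j where j: "j < k" "?e \<in> S j" "Suc ?e \<notin> S j" using lattice_word[OF e(2)] by blast
    have "h k \<le> h j" using j by (intro h_antimono) simp
    moreover have "h j \<le> ht \<beta> j" using j assms by (simp add: ht_\<alpha> ht_\<beta> ht_lam_ca)
    ultimately have "Suc ?e < ht \<beta> j" using e1 by simp
    then have def: "deficit (Suc j) (Suc ?e)"
      using step_eq[of "Suc ?e" j] j(3) by (auto simp: of_bool_def split: if_splits)
    then have r: "ca < Suc j" "Suc j \<le> cb" using no_deficit by blast+
    then have "Suc ?e = g (Suc j)" using def deficit_iff by blast
    then show False using mono[of "Suc j"] r j gk e1 by auto
  qed
qed

lemma g_props:
  assumes "ca < k" "k \<le> cb"
  shows "h k - 1 \<le> g k \<and> (\<forall>j. ca < j \<and> j \<le> k \<longrightarrow> g k \<le> g j)"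
  using assms
proof (induction k)
  case (Suc k)
  show ?case
  proof (cases "ca = k")
    case True
    then show ?thesis using g_first h_after[of "Suc k"] by (auto simp: le_Suc_eq)
  next
    case False
    then have IH: "h k - 1 \<le> g k" "\<And>j. ca < j \<Longrightarrow> j \<le> k \<Longrightarrow> g k \<le> g j" using Suc by auto
    have "g (Suc k) = g k \<or> g (Suc k) = h k - 1" "g (Suc k) \<le> g k"
      using g_step[OF _ _ IH] IH(1) False Suc.prems by (auto intro: ccontr)
    then show ?thesis using IH h_antimono[of k "Suc k"] by (auto simp: le_Suc_eq intro: order_trans)
  qed
qed simp

text \<open>The columns that take part are those at which the missing row changes. In each column
  both fillings then have the same set of values, and both increase downwards.\<close>

lemma T_eq_chain: "c (chain {k. g (Suc k) \<noteq> g k}) = c T"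
proof (rule c_cong)
  define E where "E = {k. g (Suc k) \<noteq> g k}"
  have step: "g (Suc k) = h k - 1" "h k \<le> g k" if "ca < k" "k < cb" "k \<in> E" for k
    using g_step[of k] g_props[of k] that by (auto simp: E_def)
  have gap: "gap E k = g k" if "ca < k" "k \<le> cb" for k
    using that
  proof (induction k)
    case (Suc k)
    show ?case
    proof (cases "ca = k")
      case True
      then show ?thesis using gap_ca[of "Suc k" E] g_first by simp
    next
      case False
      then show ?thesis using Suc step[of k] by (cases "k \<in> E") (auto simp: E_def)
    qed
  qed simp
  fix v assume "v \<in> D"
  then obtain i k where v: "v = (i, k)" "i < h k" by (cases v) (auto simp: D_iff)
  let ?f = "\<lambda>i. chain E (i, k)"
  have "T (i, k) = ?f i"
  proof (rule strict_mono_image_unique[of "h k" "\<lambda>i. T (i, k)" ?f])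
    show "T (i, k) < T (j, k)" if "i < j" "j < h k" for i j using T_increasing that .
    have ch: "ca < k \<and> k \<le> cb \<and> (k \<in> E \<or> k = cb) \<Longrightarrow> h k - 1 \<le> g k" using g_props[of k] by blast
    show "?f i < ?f j" if "i < j" "j < h k" for i j
      using that ch gap[of k] by (auto simp: chain_def)
    have "S k = ?f ` {..<h k}"
    proof (cases "ca < k \<and> k \<le> cb \<and> (k \<in> E \<or> k = cb)")
      case True
      then obtain m where m: "h k = Suc m" using h_pos[of k] by (cases "h k") auto
      have f: "?f i = (if i = m then g k else i)" if "i < h k" for i
        using that True gap[of k] m by (auto simp: chain_def)
      have "?f ` {..<h k} = (\<lambda>i. if i = m then g k else i) ` {..<Suc m}"
        unfolding m[symmetric] by (rule image_cong[OF refl]) (use f in simp)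
      also have "\<dots> = insert (g k) {..<m}" unfolding lessThan_Suc by auto
      also have "\<dots> = S k"
      proof (cases "k = cb")
        case k: True
        have "d \<in> S cb \<longleftrightarrow> d \<in> insert (g cb) {..<m}" for d
          using S_cb[of d] m h_cb k by (auto simp: of_bool_def split: if_splits)
        then show ?thesis using k by blast
      next
        case False
        have "d \<in> S k \<longleftrightarrow> d \<in> insert (g k) {..<m}" for d
          using S_mid[of k d] step[of k] True False m by (auto simp: of_bool_def split: if_splits)
        then show ?thesis by blast
      qed
      finally show ?thesis by simp
    next
      case False
      then have "?f ` {..<h k} = {..<h k}" by (auto simp: chain_def)
      moreover have "S k = {..<h k}"
      proof -
        consider "k < ca" | "cb < k" | "k = ca" | "ca < k" "k < cb" "k \<notin> E" using False by fastforce
        then show ?thesis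
        proof cases
          case 3
          have "d \<in> S ca \<longleftrightarrow> d < h ca" for d using S_ca[of d] g_first h_ca by auto
          then show ?thesis using 3 by blast
        next
          case 4
          have "d \<in> S k \<longleftrightarrow> d < h k" for d
            using S_mid[OF 4(1,2), of d] 4(3) by (auto simp: E_def of_bool_def split: if_splits)
          then show ?thesis by blast
        qed (use S_before S_after in auto)
      qed
      ultimately show ?thesis by simp
    qed
    then show "(\<lambda>i. T (i, k)) ` {..<h k} = ?f ` {..<h k}" by (simp only: S_def)
  qed (use v in auto)
  then show "chain {k. g (Suc k) \<noteq> g k} v = T v" using v by (simp add: E_def)
qed

lemma max_is_chain: "\<exists>E. c (chain E) = c T"
  using T_eq_chain by (rule exI)

end

lemma singular_zero:
  assumes top: "c (chain UNIV) = 0"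
  shows "c T = 0"
proof (rule ccontr)
  assume nz: "c T \<noteq> 0"
  define M where "M = Suc (h 0)"
  have M: "h j < M" for j using h_antimono[of 0 j] by (simp add: M_def)
  define P where "P T = (\<Sum>v\<in>D. (M * snd v + fst v) * T v)" for T :: "node \<Rightarrow> nat"
  have bound: "P T' \<le> (\<Sum>v\<in>D. (M * snd v + fst v) * ht lam 0)" if "c T' \<noteq> 0" for T'
    unfolding P_def
  proof (intro sum_mono mult_left_mono)
    fix v assume "v \<in> D"
    then show "T' v \<le> ht lam 0" using filling_less[OF that] by (simp add: less_imp_le)
  qed simp
  \<comment> \<open>There are infinitely many fillings, as their values off the diagram are
    arbitrary. The weight is bounded because the entries of a nonzero filling are rows of
    \<beta>.\<close>
  have "\<exists>T0. c T0 \<noteq> 0 \<and> (\<forall>T'. c T' \<noteq> 0 \<longrightarrow> P T' \<le> P T0)"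
    by (rule Lattices_Big.ex_has_greatest_nat[where P = "\<lambda>T. c T \<noteq> 0" and k = T
          and b = "Suc (\<Sum>v\<in>D. (M * snd v + fst v) * ht lam 0)"])
       (use bound nz in \<open>blast intro: le_imp_less_Suc\<close>)+
  then obtain T0 where T0: "c T0 \<noteq> 0" "\<And>T'. c T' \<noteq> 0 \<Longrightarrow> P T' \<le> P T0" by blast
  have "\<exists>E. c (chain E) = c T0"
    by (rule max_is_chain[OF T0(1) M]) (use T0(2) in \<open>simp only: P_def\<close>)
  then show False using T0(1) chain_zero[OF top] by auto
qed

end

section \<open>Transpositions acting on Specht modules\<close>

lemma perm_action_compose:
  assumes "bij \<sigma>" "bij \<tau>"
  shows "perm_action \<sigma> (perm_action \<tau> x) = perm_action (\<sigma> \<circ> \<tau>) x"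
  unfolding perm_action_def o_inv_distrib[OF assms] by (simp add: image_image o_assoc)

lemma perm_action_id: "perm_action id x = x"
  by (simp add: perm_action_def)

lemma perm_action_sum: "perm_action \<sigma> (sum f A) = (\<Sum>i\<in>A. perm_action \<sigma> (f i))"
  by (induction A rule: infinite_finite_induct) (simp_all only: sum.infinite sum.empty sum.insert perm_action_zero perm_action_add not_False_eq_True)

lemma perm_action_specht:
  assumes P: "is_partition n \<mu>" and \<sigma>: "\<sigma> permutes {1..n}" and x: "x \<in> specht \<mu>"
  shows "perm_action \<sigma> x \<in> (specht \<mu> :: (tabloid \<Rightarrow> 'r::comm_ring_1) set)"
  using x unfolding specht_def
proof (induction x rule: tabloid_module.span_induct_alt)
  case base
  then show ?case by (simp only: perm_action_zero tabloid_module.span_zero)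
next
  case (step c x y)
  then obtain t where t: "t \<in> tableaux \<mu>" "x = polytabloid \<mu> t" by blast
  have "perm_action \<sigma> x \<in> tabloid_module.span (polytabloid \<mu> ` tableaux \<mu>)"
    unfolding t(2) perm_action_polytabloid[OF P t(1) \<sigma>]
    by (intro tabloid_module.span_base imageI comp_tableaux[OF P \<sigma> t(1)])
  then show ?case using step.IH unfolding perm_action_add perm_action_scale
    by (intro tabloid_module.span_add tabloid_module.span_scale)
qed

text \<open>Every column left of \<open>j\<close> is at least as long, so by the Garnir relation it
  contributes the polytabloid once. With the signs from \<open>column_above_sum\<close> this is how
  residues arise.\<close>

lemma columns_before_sum:
  assumes P: "is_partition n \<mu>" and t: "t \<in> tableaux \<mu>" and u: "(i, j) \<in> diagram \<mu>"
  shows "(\<Sum>v | v \<in> diagram \<mu> \<and> snd v < j. perm_action (transpose (t (i, j)) (t v)) (polytabloid \<mu> t)) =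
    scale (of_nat j) (polytabloid \<mu> t :: tabloid \<Rightarrow> 'r::comm_ring_1)"
proof -
  let ?f = "\<lambda>v. perm_action (transpose (t (i, j)) (t v)) (polytabloid \<mu> t) :: tabloid \<Rightarrow> 'r"
  have "(\<Sum>v | v \<in> diagram \<mu> \<and> snd v < j. ?f v) = (\<Sum>(k, i')\<in>(SIGMA k:{..<j}. {..<ht \<mu> k}). ?f (i', k))"
    by (rule sum.reindex_bij_witness[where i = "\<lambda>(k, i'). (i', k)" and j = "\<lambda>(i', k). (k, i')"])
       (auto simp: diagram_iff_ht[OF P])
  also have "\<dots> = (\<Sum>k<j. \<Sum>i'<ht \<mu> k. ?f (i', k))"
    by (subst sum.Sigma) auto
  also have "\<dots> = (\<Sum>k<j. polytabloid \<mu> t)"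
  proof (intro sum.cong refl)
    fix k assume "k \<in> {..<j}"
    then show "(\<Sum>i'<ht \<mu> k. ?f (i', k)) = polytabloid \<mu> t"
      using u ht_antimono[OF P, of k j]
      by (intro garnir_perm_action[OF P t, symmetric]) (auto simp: diagram_iff_ht[OF P])
  qed
  also have "\<dots> = scale (of_nat j) (polytabloid \<mu> t)" by (simp add: scale_def fun_eq_iff sum_fun_apply)
  finally show ?thesis .
qed

lemma column_above_sum:
  assumes P: "is_partition n \<mu>" and t: "t \<in> tableaux \<mu>" and u: "(i, j) \<in> diagram \<mu>"
    and A: "A \<subseteq> {..<ht \<mu> j} - {i}"
  shows "(\<Sum>i'\<in>A. perm_action (transpose (t (i, j)) (t (i', j))) (polytabloid \<mu> t)) =
    scale (- of_nat (card A)) (polytabloid \<mu> t :: tabloid \<Rightarrow> 'r::comm_ring_1)"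
proof -
  have "(\<Sum>i'\<in>A. perm_action (transpose (t (i, j)) (t (i', j))) (polytabloid \<mu> t)) =
      (\<Sum>i'\<in>A. scale (- 1) (polytabloid \<mu> t :: tabloid \<Rightarrow> 'r))"
    using u A by (intro sum.cong refl column_swap_perm_action[OF P t]) (auto simp: diagram_iff_ht[OF P])
  also have "\<dots> = scale (- of_nat (card A)) (polytabloid \<mu> t)"
    by (simp add: scale_def fun_eq_iff sum_fun_apply)
  finally show ?thesis .
qed

text \<open>A central element of the group ring: twice the sum of all transpositions plus
  \<open>m\<close> times the identity.\<close>

definition pair_sum :: "nat \<Rightarrow> (tabloid \<Rightarrow> 'r::comm_ring_1) \<Rightarrow> tabloid \<Rightarrow> 'r" where
  "pair_sum m x = (\<Sum>z\<in>{1..m}. \<Sum>z'\<in>{1..m}. perm_action (transpose z z') x)"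

lemma pair_sum_add: "pair_sum m (x + y) = pair_sum m x + pair_sum m y"
  by (simp add: pair_sum_def perm_action_add sum.distrib)

lemma scale_sum: "scale c (sum f A) = (\<Sum>i\<in>A. scale c (f i))"
  by (simp add: scale_def fun_eq_iff sum_fun_apply sum_distrib_left)

lemma pair_sum_scale: "pair_sum m (scale c x) = scale c (pair_sum m x)"
  by (simp add: pair_sum_def perm_action_scale scale_sum)

lemma symmetric_sum:
  fixes f :: "'a \<Rightarrow> 'a \<Rightarrow> 'b::comm_monoid_add"
  assumes "finite A" and sym: "\<And>u v. f u v = f v u"
    and R: "\<And>u v. u \<in> A \<Longrightarrow> v \<in> A \<Longrightarrow> u \<noteq> v \<Longrightarrow> R u v \<longleftrightarrow> \<not> R v u" "\<And>u. \<not> R u u"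
  shows "(\<Sum>u\<in>A. \<Sum>v\<in>A. f u v) = (\<Sum>u\<in>A. f u u) + ((\<Sum>u\<in>A. \<Sum>v | v \<in> A \<and> R v u. f u v) + (\<Sum>u\<in>A. \<Sum>v | v \<in> A \<and> R v u. f u v))"
proof -
  have "(\<Sum>v\<in>A. f u v) = f u u + ((\<Sum>v | v \<in> A \<and> R v u. f u v) + (\<Sum>v | v \<in> A \<and> R u v. f u v))" if u: "u \<in> A" for u
  proof -
    have "A = {u} \<union> ({v. v \<in> A \<and> R v u} \<union> {v. v \<in> A \<and> R u v})" using R u by blast
    then have "(\<Sum>v\<in>A. f u v) = (\<Sum>v\<in>{u} \<union> ({v. v \<in> A \<and> R v u} \<union> {v. v \<in> A \<and> R u v}). f u v)"
      by (rule arg_cong)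
    also have "\<dots> = (\<Sum>v\<in>{u}. f u v) + (\<Sum>v\<in>{v. v \<in> A \<and> R v u} \<union> {v. v \<in> A \<and> R u v}. f u v)"
      by (rule sum.union_disjoint) (use assms(1) R(2) in auto)
    also have "(\<Sum>v\<in>{v. v \<in> A \<and> R v u} \<union> {v. v \<in> A \<and> R u v}. f u v) =
        (\<Sum>v | v \<in> A \<and> R v u. f u v) + (\<Sum>v | v \<in> A \<and> R u v. f u v)"
    proof (rule sum.union_disjoint)
      show "{v. v \<in> A \<and> R v u} \<inter> {v. v \<in> A \<and> R u v} = {}" using R u by blast
    qed (use assms(1) in auto)
    finally show ?thesis by simp
  qed
  then have "(\<Sum>u\<in>A. \<Sum>v\<in>A. f u v) = (\<Sum>u\<in>A. f u u) +
      ((\<Sum>u\<in>A. \<Sum>v | v \<in> A \<and> R v u. f u v) + (\<Sum>u\<in>A. \<Sum>v | v \<in> A \<and> R u v. f u v))"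
    by (simp add: sum.distrib)
  also have "(\<Sum>u\<in>A. \<Sum>v | v \<in> A \<and> R u v. f u v) = (\<Sum>v\<in>A. \<Sum>u | u \<in> A \<and> R u v. f u v)"
    by (rule sum.swap_restrict[OF assms(1) assms(1)])
  finally show ?thesis by (simp add: sym)
qed

text \<open>The scalar is not just the sum of the residues because \<open>pair_sum\<close> runs over ordered pairs,
  including the diagonal.\<close>

lemma pair_sum_specht:
  fixes x :: "tabloid \<Rightarrow> int"
  assumes P: "is_partition n \<mu>" and x: "x \<in> specht \<mu>"
  shows "pair_sum n x = scale (\<Sum>v\<in>diagram \<mu>. 2 * residue v + 1) x"
  using x unfolding specht_def
proof (induction x rule: tabloid_module.span_induct_alt)
  case base
  then show ?case by (simp only: pair_sum_def perm_action_zero sum.neutral_const tabloid_module.scale_zero_right)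
next
  case (step c x y)
  then obtain t where t: "t \<in> tableaux \<mu>" "x = polytabloid \<mu> t" by blast
  let ?f = "\<lambda>u v. perm_action (transpose (t u) (t v)) x"
  \<comment> \<open>Column reading order. The nodes before \<open>u\<close> are those in columns to
    the left and those above it in its own column, exactly the ones whose transpositions with
    \<open>u\<close> sum to the residue of \<open>u\<close>.\<close>
  let ?R = "\<lambda>v u. snd v < snd u \<or> snd v = snd u \<and> fst v < (fst u :: nat)"
  note bij = tableaux_bij[OF P t(1)]
  have fin: "finite (diagram \<mu>)" by (rule finite_diagram[OF P])
  have before: "(\<Sum>v | v \<in> diagram \<mu> \<and> ?R v u. ?f u v) = scale (residue u) x" if u: "u \<in> diagram \<mu>" for u
  proof -
    obtain i j where ij: "u = (i, j)" by (cases u)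
    have i: "i < ht \<mu> j" using u ij by (simp add: diagram_iff_ht[OF P])
    have "{v. v \<in> diagram \<mu> \<and> ?R v u} = {v. v \<in> diagram \<mu> \<and> snd v < j} \<union> (\<lambda>i'. (i', j)) ` {..<i}"
      using i by (auto simp: ij diagram_iff_ht[OF P])
    then have "(\<Sum>v | v \<in> diagram \<mu> \<and> ?R v u. ?f u v) =
        (\<Sum>v\<in>{v. v \<in> diagram \<mu> \<and> snd v < j} \<union> (\<lambda>i'. (i', j)) ` {..<i}. ?f u v)" by (rule arg_cong)
    also have "\<dots> = (\<Sum>v | v \<in> diagram \<mu> \<and> snd v < j. ?f u v) + (\<Sum>v\<in>(\<lambda>i'. (i', j)) ` {..<i}. ?f u v)"
      by (rule sum.union_disjoint) (use fin in auto)
    also have "(\<Sum>v\<in>(\<lambda>i'. (i', j)) ` {..<i}. ?f u v) = (\<Sum>i'<i. ?f u (i', j))"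
      by (subst sum.reindex) (auto simp: inj_on_def)
    also have "\<dots> = scale (- of_nat (card {..<i})) x"
      unfolding ij t(2) by (rule column_above_sum[OF P t(1)]) (use i u ij in auto)
    also have "(\<Sum>v | v \<in> diagram \<mu> \<and> snd v < j. ?f u v) = scale (of_nat j) x"
      unfolding ij t(2) using columns_before_sum[OF P t(1)] u ij by blast
    finally show ?thesis by (simp add: ij residue_def scale_def fun_eq_iff algebra_simps)
  qed
  have "pair_sum n x = (\<Sum>u\<in>diagram \<mu>. \<Sum>v\<in>diagram \<mu>. ?f u v)"
    unfolding pair_sum_def sum.reindex_bij_betw[OF bij, symmetric] ..
  also have "\<dots> = (\<Sum>u\<in>diagram \<mu>. ?f u u) +
      ((\<Sum>u\<in>diagram \<mu>. \<Sum>v | v \<in> diagram \<mu> \<and> ?R v u. ?f u v) + (\<Sum>u\<in>diagram \<mu>. \<Sum>v | v \<in> diagram \<mu> \<and> ?R v u. ?f u v))"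
    by (rule symmetric_sum) (use fin in \<open>auto simp: transpose_commute prod_eq_iff\<close>)
  also have "\<dots> = (\<Sum>u\<in>diagram \<mu>. x) + ((\<Sum>u\<in>diagram \<mu>. scale (residue u) x) + (\<Sum>u\<in>diagram \<mu>. scale (residue u) x))"
    using before by (simp add: perm_action_id[unfolded id_def] transpose_eq_id_iff[THEN iffD2] perm_action_id)
  also have "\<dots> = scale (\<Sum>v\<in>diagram \<mu>. 2 * residue v + 1) x"
    by (simp add: scale_def fun_eq_iff sum_fun_apply sum.distrib sum_distrib_right[symmetric] sum_distrib_left[symmetric] algebra_simps)
  finally have "pair_sum n x = scale (\<Sum>v\<in>diagram \<mu>. 2 * residue v + 1) x" .
  then show ?case
    unfolding pair_sum_add pair_sum_scale step.IH by (simp add: scale_def fun_eq_iff algebra_simps)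
qed

section \<open>Self-adjointness for the form; adding and removing the largest entry\<close>

lemma tabloids_image:
  assumes P: "is_partition n \<mu>" and \<sigma>: "\<sigma> permutes {1..n}"
  shows "bij_betw ((`) ((\<circ>) (inv \<sigma>))) (tabloids \<mu>) (tabloids \<mu>)"
proof (rule bij_betwI[where g = "(`) ((\<circ>) \<sigma>)"])
  have img: "(\<circ>) \<tau> ` T \<in> tabloids \<mu>" if "T \<in> tabloids \<mu>" "\<tau> permutes {1..n}" for \<tau> T
  proof -
    obtain t where t: "t \<in> tableaux \<mu>" "T = tabloid_of \<mu> t"
      using \<open>T \<in> tabloids \<mu>\<close> by (auto simp: tabloids_def)
    have "(\<circ>) \<tau> ` T = tabloid_of \<mu> (\<tau> \<circ> t)"
      unfolding t(2) by (rule comp_image_tabloid) (use that in \<open>simp only: card_diagram[OF P]\<close>)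
    then show ?thesis using comp_tableaux[OF P that(2) t(1)] by (simp add: tabloids_def)
  qed
  show "(`) ((\<circ>) (inv \<sigma>)) \<in> tabloids \<mu> \<rightarrow> tabloids \<mu>" using img permutes_inv[OF \<sigma>] by blast
  show "(`) ((\<circ>) \<sigma>) \<in> tabloids \<mu> \<rightarrow> tabloids \<mu>" using img \<sigma> by blast
  show "(\<circ>) \<sigma> ` (\<circ>) (inv \<sigma>) ` T = T" for T
    using permutes_inverses(1)[OF \<sigma>] by (auto simp: image_image o_def)
  show "(\<circ>) (inv \<sigma>) ` (\<circ>) \<sigma> ` T = T" for T
    using permutes_inverses(2)[OF \<sigma>] by (auto simp: image_image o_def)
qed

text \<open>A transposition permutes the orthonormal basis and is its own inverse.\<close>

lemma tabloid_form_transpose: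
  assumes P: "is_partition n \<mu>" and "z \<in> {1..n}" "z' \<in> {1..n}"
  shows "tabloid_form \<mu> (perm_action (transpose z z') x) y = tabloid_form \<mu> x (perm_action (transpose z z') y)"
proof -
  let ?\<tau> = "transpose z z'"
  have \<tau>: "?\<tau> permutes {1..n}" using assms by (intro permutes_swap_id)
  have inv: "(\<circ>) (inv ?\<tau>) ` (\<circ>) (inv ?\<tau>) ` T = T" for T :: "tableau set"
    by (auto simp: image_image o_def)
  have "tabloid_form \<mu> x (perm_action ?\<tau> y) =
      (\<Sum>T\<in>tabloids \<mu>. x ((\<circ>) (inv ?\<tau>) ` T) * y ((\<circ>) (inv ?\<tau>) ` (\<circ>) (inv ?\<tau>) ` T))"
    unfolding tabloid_form_def perm_action_def
    by (rule sum.reindex_bij_betw[OF tabloids_image[OF P \<tau>], symmetric])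
  then show ?thesis unfolding tabloid_form_def perm_action_def inv by simp
qed

lemma tabloid_form_add_left: "tabloid_form \<mu> (x + y) w = tabloid_form \<mu> x w + tabloid_form \<mu> y w"
  by (simp add: tabloid_form_def algebra_simps sum.distrib)

lemma tabloid_form_scale_left: "tabloid_form \<mu> (scale c x) w = c * tabloid_form \<mu> x w"
  by (simp add: tabloid_form_def scale_def algebra_simps sum_distrib_left)

lemma tabloid_form_scale_right: "tabloid_form \<mu> x (scale c w) = c * tabloid_form \<mu> x w"
  by (simp add: tabloid_form_def scale_def algebra_simps sum_distrib_left)

lemma tabloid_form_sum_left: "tabloid_form \<mu> (sum f A) w = (\<Sum>i\<in>A. tabloid_form \<mu> (f i) w)"
  unfolding tabloid_form_def sum_fun_apply sum_distrib_right by (rule sum.swap)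

lemma tabloid_form_sum_right: "tabloid_form \<mu> w (sum f A) = (\<Sum>i\<in>A. tabloid_form \<mu> w (f i))"
  unfolding tabloid_form_def sum_fun_apply sum_distrib_left by (rule sum.swap)

lemma tabloid_form_pair_sum:
  assumes P: "is_partition n \<mu>"
  shows "tabloid_form \<mu> (pair_sum n x) w = tabloid_form \<mu> x (pair_sum n w)"
  unfolding pair_sum_def tabloid_form_sum_left tabloid_form_sum_right
  by (intro sum.cong refl tabloid_form_transpose[OF P])

lemma tableaux_off: "t \<in> tableaux \<mu> \<Longrightarrow> v \<notin> diagram \<mu> \<Longrightarrow> t v = 0"
  unfolding tableaux_def by blast

lemma extend_tableau:
  assumes L: "is_partition (Suc n) lam" and P: "is_partition n \<mu>"
    and u: "u \<in> diagram lam" and d: "diagram \<mu> = diagram lam - {u}" and s: "s \<in> tableaux \<mu>"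
  shows "s(u := Suc n) \<in> tableaux lam"
proof -
  have lam: "diagram lam = insert u (diagram \<mu>)" "u \<notin> diagram \<mu>" using u d by auto
  have "bij_betw (s(u := Suc n)) (diagram \<mu>) {1..n}"
    using tableaux_bij[OF P s] lam(2) by (subst bij_betw_cong[of _ _ s]) auto
  then have "bij_betw (s(u := Suc n)) (diagram \<mu> \<union> {u}) ({1..n} \<union> {Suc n})"
    by (rule bij_betw_combine) (auto simp: bij_betw_def)
  moreover have "{1..n} \<union> {Suc n} = {1..Suc n}" "diagram \<mu> \<union> {u} = diagram lam" using lam by auto
  ultimately have "bij_betw (s(u := Suc n)) (diagram lam) {1..card (diagram lam)}"
    by (simp only: card_diagram[OF L])
  moreover have "(s(u := Suc n)) v = 0" if "v \<notin> diagram lam" for v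
    using that tableaux_off[OF s, of v] lam by auto
  ultimately show ?thesis by (simp add: tableaux_def)
qed

lemma restrict_tableau:
  assumes L: "is_partition (Suc n) lam" and P: "is_partition n \<mu>"
    and u: "u \<in> diagram lam" and d: "diagram \<mu> = diagram lam - {u}"
    and t: "t \<in> tableaux lam" "t u = Suc n"
  shows "t(u := 0) \<in> tableaux \<mu>"
proof -
  have "bij_betw t (diagram lam - {u}) ({1..Suc n} - {t u})"
    by (rule bij_betw_DiffI[OF tableaux_bij[OF L t(1)]]) (use u t(2) in auto)
  moreover have "{1..Suc n} - {t u} = {1..n}" using t(2) by auto
  ultimately have "bij_betw t (diagram \<mu>) {1..n}" by (simp only: d)
  then have "bij_betw (t(u := 0)) (diagram \<mu>) {1..n}"
    using d by (subst bij_betw_cong[of _ _ t]) auto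
  then have "bij_betw (t(u := 0)) (diagram \<mu>) {1..card (diagram \<mu>)}" by (simp only: card_diagram[OF P])
  moreover have "(t(u := 0)) v = 0" if "v \<notin> diagram \<mu>" for v
    using that tableaux_off[OF t(1), of v] d by auto
  ultimately show ?thesis by (simp add: tableaux_def)
qed

section \<open>The Jucys--Murphy element\<close>

context box_move
begin

definition jm :: "(tabloid \<Rightarrow> int) \<Rightarrow> tabloid \<Rightarrow> int" where
  "jm x = (\<Sum>z\<in>{1..n}. perm_action (transpose z (Suc n)) x)"

definition col_span :: "nat \<Rightarrow> (tabloid \<Rightarrow> int) set" where
  "col_span k = tabloid_module.span
     (polytabloid lam ` {t \<in> tableaux lam. \<exists>i j. k \<le> j \<and> i < ht lam j \<and> t (i, j) = Suc n})"

text \<open>The residue of the bottom node of column \<open>k\<close>, removable or not.\<close>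

definition col_res :: "nat \<Rightarrow> int" where
  "col_res k = int k - int (ht lam k) + 1"

lemma jm_add: "jm (x + y) = jm x + jm y"
  by (simp add: jm_def perm_action_add sum.distrib)

lemma jm_scale: "jm (scale c x) = scale c (jm x)"
  by (simp add: jm_def perm_action_scale scale_sum)

lemma jm_zero: "jm 0 = 0"
  by (simp only: jm_def perm_action_zero sum.neutral_const)

lemma scale_add: "scale c (x + y) = scale c x + scale c y"
  by (rule tabloid_module.scale_right_distrib)

lemma col_span_mono: "k \<le> k' \<Longrightarrow> col_span k' \<subseteq> col_span k"
  unfolding col_span_def by (intro tabloid_module.span_mono image_mono) (auto intro: order_trans)

lemma col_span_base: "t \<in> tableaux lam \<Longrightarrow> k \<le> j \<Longrightarrow> i < ht lam j \<Longrightarrow> t (i, j) = Suc n \<Longrightarrow> polytabloid lam t \<in> col_span k"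
  unfolding col_span_def by (intro tabloid_module.span_base imageI) auto

lemma col_span_add: "x \<in> col_span k \<Longrightarrow> y \<in> col_span k \<Longrightarrow> x + y \<in> col_span k"
  unfolding col_span_def by (rule tabloid_module.span_add)

lemma col_span_scale: "x \<in> col_span k \<Longrightarrow> scale c x \<in> col_span k"
  unfolding col_span_def by (rule tabloid_module.span_scale)

lemma col_span_sum: "(\<And>i. i \<in> A \<Longrightarrow> f i \<in> col_span k) \<Longrightarrow> sum f A \<in> col_span k"
  unfolding col_span_def by (rule tabloid_module.span_sum)

lemma col_span_zero: "0 \<in> col_span k"
  unfolding col_span_def by (rule tabloid_module.span_zero)

lemma move_last_col_span:
  assumes t: "t \<in> tableaux lam" and u: "u \<in> diagram lam" "t u = Suc n" and v: "v \<in> diagram lam" "k \<le> snd v"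
  shows "perm_action (transpose (t u) (t v)) (polytabloid lam t) \<in> col_span k"
proof -
  have tr: "transpose (t u) (t v) permutes {1..Suc n}" by (rule transpose_permutes[OF lam t u(1) v(1)])
  have "(transpose (t u) (t v) \<circ> t) (fst v, snd v) = Suc n" using u by simp
  moreover have "fst v < ht lam (snd v)" using v diagram_iff_ht[OF lam, of "fst v" "snd v"] by simp
  ultimately show ?thesis
    unfolding perm_action_polytabloid[OF lam t tr]
    using v(2) comp_tableaux[OF lam tr t] by (intro col_span_base)
qed

text \<open>Exchanging \<open>n + 1\<close> with the columns to its left contributes
  \<open>j\<close> by the Garnir relations, each of the \<open>ht lam j - 1\<close> other entries of
  its column contributes a sign, and the entries further right carry \<open>n + 1\<close> into later
  columns. So the scalar is the residue of the bottom node, whatever the row of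
  \<open>n + 1\<close>.\<close>

lemma jm_polytabloid:
  assumes t: "t \<in> tableaux lam" and i: "i < ht lam j" "t (i, j) = Suc n"
  obtains w where "w \<in> col_span (Suc j)" "jm (polytabloid lam t) = scale (col_res j) (polytabloid lam t) + w"
proof -
  let ?u = "(i, j)" and ?e = "polytabloid lam t :: tabloid \<Rightarrow> int"
  let ?f = "\<lambda>v. perm_action (transpose (t ?u) (t v)) ?e"
  have u: "?u \<in> diagram lam" using i by (simp add: diagram_iff_ht[OF lam])
  have fin: "finite (diagram lam)" by (rule finite_diagram[OF lam])
  have "bij_betw t (diagram lam - {?u}) ({1..Suc n} - {t ?u})"
    by (rule bij_betw_DiffI[OF tableaux_bij[OF lam t]]) (use u i in auto)
  moreover have "{1..Suc n} - {t ?u} = {1..n}" using i by auto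
  ultimately have bij: "bij_betw t (diagram lam - {?u}) {1..n}" by simp
  let ?A = "{v. v \<in> diagram lam \<and> snd v < j}" and ?B = "(\<lambda>i'. (i', j)) ` ({..<ht lam j} - {i})"
    and ?C = "{v. v \<in> diagram lam \<and> j < snd v}"
  have "jm ?e = (\<Sum>v\<in>diagram lam - {?u}. perm_action (transpose (t v) (Suc n)) ?e)"
    unfolding jm_def by (rule sum.reindex_bij_betw[OF bij, symmetric])
  also have "\<dots> = (\<Sum>v\<in>diagram lam - {?u}. ?f v)" by (simp only: i transpose_commute)
  also have "diagram lam - {?u} = ?A \<union> (?B \<union> ?C)" by (auto simp: diagram_iff_ht[OF lam])
  also have "(\<Sum>v\<in>?A \<union> (?B \<union> ?C). ?f v) = (\<Sum>v\<in>?A. ?f v) + (\<Sum>v\<in>?B \<union> ?C. ?f v)"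
    by (rule sum.union_disjoint) (use fin in auto)
  also have "(\<Sum>v\<in>?B \<union> ?C. ?f v) = (\<Sum>v\<in>?B. ?f v) + (\<Sum>v\<in>?C. ?f v)"
    by (rule sum.union_disjoint) (use fin in auto)
  also have "(\<Sum>v\<in>?B. ?f v) = (\<Sum>i'\<in>{..<ht lam j} - {i}. ?f (i', j))"
    by (subst sum.reindex) (auto simp: inj_on_def)
  also have "\<dots> = scale (- of_nat (card ({..<ht lam j} - {i}))) ?e"
    by (rule column_above_sum[OF lam t u]) simp
  also have "(\<Sum>v\<in>?A. ?f v) = scale (of_nat j) ?e"
    by (rule columns_before_sum[OF lam t u])
  finally have eq: "jm ?e = scale (of_nat j) ?e + (scale (- of_nat (card ({..<ht lam j} - {i}))) ?e + (\<Sum>v\<in>?C. ?f v))" .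
  have "card ({..<ht lam j} - {i}) = ht lam j - 1" using i by simp
  then have "col_res j = of_nat j + - of_nat (card ({..<ht lam j} - {i}))"
    using i by (simp add: col_res_def)
  then have "jm ?e = scale (col_res j) ?e + (\<Sum>v\<in>?C. ?f v)"
    unfolding eq by (simp only: tabloid_module.scale_left_distrib add.assoc)
  moreover have "(\<Sum>v\<in>?C. ?f v) \<in> col_span (Suc j)"
    by (rule col_span_sum) (use move_last_col_span[OF t u i(2)] in auto)
  ultimately show ?thesis using that by blast
qed

lemma jm_col_span:
  assumes "x \<in> col_span k"
  shows "\<exists>w\<in>col_span (Suc k). jm x = scale (col_res k) x + w"
  using assms unfolding col_span_def[of k]
proof (induction x rule: tabloid_module.span_induct_alt)
  case base
  show ?case by (rule bexI[OF _ col_span_zero]) (simp only: jm_zero tabloid_module.scale_zero_right add_0)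
next
  case (step c x y)
  then obtain t i j where t: "t \<in> tableaux lam" "x = polytabloid lam t" and ij: "k \<le> j" "i < ht lam j" "t (i, j) = Suc n"
    by blast
  obtain w where w: "w \<in> col_span (Suc j)" "jm x = scale (col_res j) x + w"
    using jm_polytabloid[OF t(1) ij(2,3)] t(2) by blast
  have "\<exists>w'\<in>col_span (Suc k). jm x = scale (col_res k) x + w'"
  proof (cases "j = k")
    case False
    then have "x \<in> col_span (Suc k)"
      unfolding t(2) using ij t(1) by (intro col_span_base[of t _ j i]) auto
    moreover have "w \<in> col_span (Suc k)" using w(1) col_span_mono[of "Suc k" "Suc j"] ij by auto
    ultimately have "scale (col_res j - col_res k) x + w \<in> col_span (Suc k)"
      by (intro col_span_add col_span_scale)
    moreover have "jm x = scale (col_res k) x + (scale (col_res j - col_res k) x + w)"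
      unfolding w(2) by (simp add: scale_def fun_eq_iff algebra_simps)
    ultimately show ?thesis by blast
  qed (use w in blast)
  then obtain w1 where w1: "w1 \<in> col_span (Suc k)" "jm x = scale (col_res k) x + w1" by blast
  obtain w2 where w2: "w2 \<in> col_span (Suc k)" "jm y = scale (col_res k) y + w2" using step.IH by blast
  have "jm (scale c x + y) = scale (col_res k) (scale c x + y) + (scale c w1 + w2)"
    unfolding jm_add jm_scale w1(2) w2(2) by (simp add: scale_def fun_eq_iff algebra_simps)
  then show ?case using w1(1) w2(1) by (blast intro: col_span_add col_span_scale)
qed

text \<open>Between columns of equal height the Garnir relation also works towards the right and
  pushes \<open>n + 1\<close> on. The filtration can only jump at columns that end in a removable
  node.\<close>

lemma col_span_collapse:
  assumes eq: "ht lam (Suc k) = ht lam k"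
  shows "col_span k \<subseteq> col_span (Suc k)"
  unfolding col_span_def[of k]
proof (rule tabloid_module.span_minimal)
  show "tabloid_module.subspace (col_span (Suc k))"
    unfolding col_span_def by (rule tabloid_module.subspace_span)
  show "polytabloid lam ` {t \<in> tableaux lam. \<exists>i j. k \<le> j \<and> i < ht lam j \<and> t (i, j) = Suc n} \<subseteq> col_span (Suc k)"
  proof clarify
    fix t i j assume t: "t \<in> tableaux lam" and ij: "k \<le> j" "i < ht lam j" "t (i, j) = Suc n"
    show "polytabloid lam t \<in> col_span (Suc k)"
    proof (cases "j = k")
      case False
      then show ?thesis using t ij by (intro col_span_base[of t _ j i]) auto
    next
      case True
      have "polytabloid lam t = (\<Sum>i'<ht lam (Suc k). perm_action (transpose (t (i, j)) (t (i', Suc k))) (polytabloid lam t) :: tabloid \<Rightarrow> int)"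
        by (rule garnir_perm_action[OF lam t ij(2)]) (use True eq in auto)
      also have "\<dots> \<in> col_span (Suc k)"
        by (intro col_span_sum move_last_col_span t ij) (use ij in \<open>auto simp: diagram_iff_ht[OF lam]\<close>)
      finally show ?thesis .
    qed
  qed
qed

text \<open>Only columns ending in a removable node contribute a factor: with a factor for every column
  the image vector could vanish modulo \<open>p\<close>.\<close>

definition jm_step :: "nat \<Rightarrow> (tabloid \<Rightarrow> int) \<Rightarrow> tabloid \<Rightarrow> int" where
  "jm_step k x = (if ht lam (Suc k) < ht lam k then jm x + scale (- col_res k) x else x)"

primrec jm_prod :: "nat \<Rightarrow> nat \<Rightarrow> (tabloid \<Rightarrow> int) \<Rightarrow> tabloid \<Rightarrow> int" where
  "jm_prod s 0 x = x"
| "jm_prod s (Suc m) x = jm_step (s + m) (jm_prod s m x)"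

lemma jm_step_add: "jm_step k (x + y) = jm_step k x + jm_step k y"
  by (cases "ht lam (Suc k) < ht lam k")
    (simp_all only: jm_step_def if_True if_False jm_add scale_add ac_simps)

lemma jm_step_scale: "jm_step k (scale c x) = scale c (jm_step k x)"
  by (cases "ht lam (Suc k) < ht lam k")
    (simp_all only: jm_step_def if_True if_False jm_scale scale_add tabloid_module.scale_left_commute)

lemma jm_step_commute: "jm_step k (jm_step l x) = jm_step l (jm_step k x)"
  by (cases "ht lam (Suc k) < ht lam k"; cases "ht lam (Suc l) < ht lam l")
    (simp_all only: jm_step_def if_True if_False jm_add jm_scale scale_add tabloid_module.scale_left_commute ac_simps)

lemma jm_prod_add: "jm_prod s m (x + y) = jm_prod s m x + jm_prod s m y"
  by (induction m) (simp_all only: jm_prod.simps jm_step_add)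

lemma jm_prod_scale: "jm_prod s m (scale c x) = scale c (jm_prod s m x)"
  by (induction m) (simp_all only: jm_prod.simps jm_step_scale)

text \<open>The factors commute, being polynomials in one operator, so the factor of column
  \<open>s\<close> may come last.\<close>

lemma jm_prod_first: "jm_prod s (Suc m) x = jm_step s (jm_prod (Suc s) m x)"
proof (induction m)
  case (Suc m)
  have "jm_prod s (Suc (Suc m)) x = jm_step (s + Suc m) (jm_step s (jm_prod (Suc s) m x))"
    using Suc by simp
  then show ?case by (subst (asm) jm_step_commute) simp
qed simp

lemma jm_step_col_span:
  assumes "x \<in> col_span k"
  shows "jm_step k x \<in> col_span (Suc k)"
proof (cases "ht lam (Suc k) < ht lam k")
  case True
  obtain w where w: "w \<in> col_span (Suc k)" "jm x = scale (col_res k) x + w"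
    using jm_col_span[OF assms] by blast
  have "jm_step k x = w" using True by (simp add: jm_step_def w(2) scale_def fun_eq_iff)
  then show ?thesis using w(1) by simp
next
  case False
  then have "ht lam (Suc k) = ht lam k" using ht_antimono[OF lam, of k "Suc k"] by simp
  then show ?thesis using col_span_collapse[of k] assms False by (auto simp: jm_step_def)
qed

lemma jm_prod_col_span: "x \<in> col_span s \<Longrightarrow> jm_prod s m x \<in> col_span (s + m)"
  by (induction m) (simp_all add: jm_step_col_span)

lemma perm_action_jm:
  assumes \<sigma>: "\<sigma> permutes {1..n}"
  shows "perm_action \<sigma> (jm x) = jm (perm_action \<sigma> x)"
proof -
  have fixN: "\<sigma> (Suc n) = Suc n" by (rule permutes_not_in[OF \<sigma>]) simp
  have bij: "bij \<sigma>" by (rule permutes_bij[OF \<sigma>])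
  have fix_iff: "\<sigma> w = Suc n \<longleftrightarrow> w = Suc n" for w
    using injD[OF bij_is_inj[OF bij], of w "Suc n"] fixN by auto
  have comm: "perm_action \<sigma> (perm_action (transpose z (Suc n)) x) = perm_action (transpose (\<sigma> z) (Suc n)) (perm_action \<sigma> x)" for z
  proof -
    have "\<sigma> \<circ> transpose z (Suc n) = transpose (\<sigma> z) (Suc n) \<circ> \<sigma>"
      using bij_is_inj[OF bij] fix_iff fixN by (auto simp: fun_eq_iff transpose_def inj_eq)
    then show ?thesis by (simp add: perm_action_compose bij)
  qed
  have "perm_action \<sigma> (jm x) = (\<Sum>z\<in>{1..n}. perm_action (transpose (\<sigma> z) (Suc n)) (perm_action \<sigma> x))"
    unfolding jm_def perm_action_sum comm ..
  also have "\<dots> = jm (perm_action \<sigma> x)"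
    unfolding jm_def by (rule sum.reindex_bij_betw[OF permutes_imp_bij[OF \<sigma>]])
  finally show ?thesis .
qed

lemma perm_action_jm_prod:
  assumes "\<sigma> permutes {1..n}"
  shows "perm_action \<sigma> (jm_prod s m x) = jm_prod s m (perm_action \<sigma> x)"
proof (induction m)
  case (Suc m)
  have "perm_action \<sigma> (jm_step k y) = jm_step k (perm_action \<sigma> y)" for k y
    by (cases "ht lam (Suc k) < ht lam k")
      (simp_all only: jm_step_def if_True if_False perm_action_add perm_action_scale perm_action_jm[OF assms])
  then show ?case by (simp only: jm_prod.simps Suc)
qed (simp only: jm_prod.simps)

text \<open>All the tabloids in the union coincide; it adds the entry \<open>n + 1\<close> to the row of \<open>b\<close>.\<close>

definition rho :: "(tabloid \<Rightarrow> int) \<Rightarrow> tabloid \<Rightarrow> int" where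
  "rho x T = (if T \<in> tabloids \<beta> then x (\<Union>s\<in>T. tabloid_of lam (s((rb, cb) := Suc n))) else 0)"

lemma rho_add: "rho (x + y) = rho x + rho y" by (simp add: rho_def fun_eq_iff)
lemma rho_scale: "rho (scale c x) = scale c (rho x)" by (simp add: rho_def scale_def fun_eq_iff)
lemma rho_zero: "rho 0 = 0" by (simp add: rho_def fun_eq_iff)

lemma rho_perm_module: "rho x \<in> perm_module \<beta>" by (simp add: rho_def perm_module_def)

lemma rho_tabloid:
  assumes "gtab \<beta> g \<in> tabloids \<beta>"
  shows "rho x (gtab \<beta> g) = x (gtab lam (g(Suc n := rb)))"
proof -
  obtain t where t: "t \<in> tableaux \<beta>" "gtab \<beta> g = tabloid_of \<beta> t" using assms by (auto simp: tabloids_def)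
  have "tabloid_of lam (s((rb, cb) := Suc n)) = gtab lam (g(Suc n := rb))" if s: "s \<in> gtab \<beta> g" for s
  proof (rule tabloid_of_eq_gtab[OF lam])
    have sT: "s \<in> tableaux \<beta>" using s by (simp add: gtab_def)
    then show "s((rb, cb) := Suc n) \<in> tableaux lam" by (rule extend_tableau[OF lam \<beta> b_in diag_\<beta>])
    show "\<forall>v\<in>diagram lam. (g(Suc n := rb)) ((s((rb, cb) := Suc n)) v) = fst v"
    proof
      fix v assume v: "v \<in> diagram lam"
      show "(g(Suc n := rb)) ((s((rb, cb) := Suc n)) v) = fst v"
      proof (cases "v = (rb, cb)")
        case False
        then have "v \<in> diagram \<beta>" using v diag_\<beta> by auto
        then show ?thesis using False s tableaux_range[OF \<beta> sT, of v] by (auto simp: gtab_def)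
      qed simp
    qed
  qed
  moreover have "t \<in> gtab \<beta> g" unfolding t(2) using t(1) by (simp add: tabloid_of_def)
  ultimately have "(\<Union>s\<in>gtab \<beta> g. tabloid_of lam (s((rb, cb) := Suc n))) = gtab lam (g(Suc n := rb))"
    by blast
  then show ?thesis using assms by (simp add: rho_def)
qed

text \<open>A tableau with these rows has \<open>n + 1\<close> in row \<open>rb\<close>. Exchanging
  it with the last entry of that row does not affect the rows, and then the node
  \<open>(rb, cb)\<close> can be deleted.\<close>

lemma gtab_restrict:
  assumes "gtab lam (g(Suc n := rb)) \<noteq> {}"
  shows "gtab \<beta> g \<in> tabloids \<beta>"
proof -
  obtain s where s: "s \<in> tableaux lam" "\<And>v. v \<in> diagram lam \<Longrightarrow> (g(Suc n := rb)) (s v) = fst v"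
    using assms by (auto simp: gtab_def)
  have "Suc n \<in> {1..Suc n}" by simp
  then obtain v where v: "v \<in> diagram lam" "s v = Suc n" using tableaux_surj[OF lam s(1)] by metis
  have fv: "fst v = rb" using s(2)[OF v(1)] v(2) by simp
  define \<tau> where "\<tau> = transpose (s (rb, cb)) (s v)"
  have \<tau>: "\<tau> permutes {1..Suc n}" unfolding \<tau>_def by (rule transpose_permutes[OF lam s(1) b_in v(1)])
  define t where "t = \<tau> \<circ> s"
  have t: "t \<in> tableaux lam" unfolding t_def by (rule comp_tableaux[OF lam \<tau> s(1)])
  have tb: "t (rb, cb) = Suc n" using v by (simp add: t_def \<tau>_def)
  have row: "(g(Suc n := rb)) (t w) = fst w" if w: "w \<in> diagram lam" for w
  proof -
    have "(g(Suc n := rb)) (s (rb, cb)) = (g(Suc n := rb)) (s v)"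
      using s(2)[OF b_in] s(2)[OF v(1)] fv by simp
    then have "(g(Suc n := rb)) \<circ> \<tau> = g(Suc n := rb)" unfolding \<tau>_def by (rule comp_transpose_eq)
    then show ?thesis using s(2)[OF w] by (simp add: t_def comp_assoc[symmetric] fun_eq_iff)
  qed
  let ?t = "t((rb, cb) := 0)"
  have t': "?t \<in> tableaux \<beta>" by (rule restrict_tableau[OF lam \<beta> b_in diag_\<beta> t tb])
  have "g (?t w) = fst w" if "w \<in> diagram \<beta>" for w
  proof -
    have w: "w \<in> diagram lam" "w \<noteq> (rb, cb)" using that diag_\<beta> by auto
    then have "t w \<noteq> Suc n" using tableaux_eq_iff[OF lam t w(1) b_in] tb by simp
    then show ?thesis using row[OF w(1)] w(2) by simp
  qed
  then have "gtab \<beta> g = tabloid_of \<beta> ?t" by (subst tabloid_of_eq_gtab[OF \<beta> t']) auto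
  then show ?thesis using t' by (simp add: tabloids_def)
qed

lemma rho_gtab:
  assumes "x \<in> perm_module lam"
  shows "rho x (gtab \<beta> g) = x (gtab lam (g(Suc n := rb)))"
proof (cases "gtab \<beta> g \<in> tabloids \<beta>")
  case False
  then have "gtab lam (g(Suc n := rb)) = {}" using gtab_restrict by blast
  moreover have "{} \<notin> tabloids lam" by (auto simp: tabloids_def tabloid_of_def)
  ultimately show ?thesis using False assms by (simp add: rho_def perm_module_def)
qed (rule rho_tabloid)

lemma rho_perm_action:
  assumes \<sigma>: "\<sigma> permutes {1..n}"
  shows "rho (perm_action \<sigma> x) = perm_action \<sigma> (rho x)"
proof
  fix T
  show "rho (perm_action \<sigma> x) T = perm_action \<sigma> (rho x) T"
  proof (cases "T \<in> tabloids \<beta>")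
    case False
    then show ?thesis
      using perm_action_perm_module[OF \<beta> \<sigma> rho_perm_module, of x] by (simp add: rho_def perm_module_def)
  next
    case True
    then obtain g where T: "T = gtab \<beta> g" by (rule tabloids_gtab[OF \<beta>])
    have \<sigma>': "\<sigma> permutes {1..Suc n}" by (rule permutes_subset[OF \<sigma>]) auto
    have "perm_action \<sigma> (rho x) T = rho x (gtab \<beta> (g \<circ> \<sigma>))"
      unfolding T by (rule perm_action_gtab[OF \<beta> \<sigma>])
    moreover have "gtab \<beta> (g \<circ> \<sigma>) \<in> tabloids \<beta>"
    proof -
      have "(\<circ>) (inv \<sigma>) ` T \<in> tabloids \<beta>" using bij_betwE[OF tabloids_image[OF \<beta> \<sigma>]] True by blast
      \<comment> \<open>\<open>perm_action_gtab\<close> speaks of coefficients; applied to the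
        indicator of the set on the right, it yields equality of sets.\<close>
      moreover have "(\<circ>) (inv \<sigma>) ` T = gtab \<beta> (g \<circ> \<sigma>)"
        using perm_action_gtab[OF \<beta> \<sigma>, of "tabloid_basis (gtab \<beta> (g \<circ> \<sigma>))" g]
        by (simp add: T perm_action_def tabloid_basis_def split: if_splits)
      ultimately show ?thesis by simp
    qed
    ultimately have "perm_action \<sigma> (rho x) T = x (gtab lam ((g \<circ> \<sigma>)(Suc n := rb)))"
      by (simp add: rho_tabloid)
    also have "(g \<circ> \<sigma>)(Suc n := rb) = g(Suc n := rb) \<circ> \<sigma>"
    proof
      fix w
      have "\<sigma> (Suc n) = Suc n" by (rule permutes_not_in[OF \<sigma>]) simp
      then have "\<sigma> w = Suc n \<longleftrightarrow> w = Suc n" using injD[OF permutes_inj[OF \<sigma>], of w "Suc n"] by auto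
      then show "((g \<circ> \<sigma>)(Suc n := rb)) w = (g(Suc n := rb) \<circ> \<sigma>) w" by simp
    qed
    finally have "perm_action \<sigma> (rho x) T = x (gtab lam (g(Suc n := rb) \<circ> \<sigma>))" .
    moreover have "rho (perm_action \<sigma> x) T = perm_action \<sigma> x (gtab lam (g(Suc n := rb)))"
      using True unfolding T by (rule rho_tabloid)
    ultimately show ?thesis by (simp add: perm_action_gtab[OF lam \<sigma>'])
  qed
qed

end

section \<open>Passing from the Specht module of \<open>lam\<close> to that of \<beta>\<close>

context box_move
begin

lemma ht_lam_after: "cb < j \<Longrightarrow> ht lam j \<le> rb"
proof (rule ccontr)
  assume j: "cb < j" "\<not> ht lam j \<le> rb"
  then have "rb < ht \<beta> j" by (simp add: ht_\<beta>)
  then have "rb < ht \<beta> cb" using ht_antimono[OF \<beta>, of cb j] j by simp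
  then show False by (simp add: ht_\<beta>)
qed

text \<open>A column permutation contributing at a tabloid with \<open>n + 1\<close> in row
  \<open>rb\<close> must fix \<open>n + 1\<close>, since column \<open>cb\<close> has just one entry
  in that row. It is then a column permutation of the smaller tableau, with the same sign.\<close>

lemma rho_polytabloid:
  assumes t: "t \<in> tableaux lam" and tb: "t (rb, cb) = Suc n"
  shows "rho (polytabloid lam t) = polytabloid \<beta> (t((rb, cb) := 0))"
proof (rule perm_module_eqI[OF \<beta> rho_perm_module])
  let ?t = "t((rb, cb) := 0)"
  have t': "?t \<in> tableaux \<beta>" by (rule restrict_tableau[OF lam \<beta> b_in diag_\<beta> t tb])
  show "polytabloid \<beta> ?t \<in> perm_module \<beta>" by (rule polytabloid_perm_module[OF t'])
  fix g
  let ?g = "g(Suc n := rb)"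
  have col: "?t ` diagram_col \<beta> j = t ` diagram_col lam j - {Suc n}" for j
  proof (intro equalityI subsetI)
    fix z assume "z \<in> ?t ` diagram_col \<beta> j"
    then obtain v where v: "v \<in> diagram \<beta>" "snd v = j" "z = ?t v" unfolding diagram_col_def by blast
    then have v': "v \<in> diagram lam" "v \<noteq> (rb, cb)" using diag_\<beta> by auto
    then have "z = t v" "t v \<noteq> Suc n" using v(3) tableaux_eq_iff[OF lam t v'(1) b_in] tb by auto
    then show "z \<in> t ` diagram_col lam j - {Suc n}" using v v' by (auto simp: diagram_col_def)
  next
    fix z assume "z \<in> t ` diagram_col lam j - {Suc n}"
    then obtain v where v: "v \<in> diagram lam" "snd v = j" "z = t v" "z \<noteq> Suc n"
      by (auto simp: diagram_col_def)
    then have "v \<noteq> (rb, cb)" using tb by auto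
    then have "v \<in> diagram_col \<beta> j" "z = ?t v" using v diag_\<beta> by (auto simp: diagram_col_def)
    then show "z \<in> ?t ` diagram_col \<beta> j" by blast
  qed
  have "polytabloid lam t (gtab lam ?g) = (polytabloid \<beta> ?t (gtab \<beta> g) :: int)"
  proof -
    \<comment> \<open>A column permutation fixing \<open>n + 1\<close> that fits \<open>g\<close>
      makes both coefficients equal to its sign. What remains is that either coefficient being
      nonzero produces such a permutation.\<close>
    have up: "polytabloid lam t (gtab lam ?g) = (of_int (sign \<pi>) :: int)"
      and down: "polytabloid \<beta> ?t (gtab \<beta> g) = (of_int (sign \<pi>) :: int)"
      if \<pi>: "\<pi> permutes {1..n}" "\<And>j. \<pi> ` (t ` diagram_col lam j) = t ` diagram_col lam j"
        "\<And>v. v \<in> diagram \<beta> \<Longrightarrow> g (\<pi> (?t v)) = fst v" for \<pi>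
    proof -
      have fixN: "\<pi> (Suc n) = Suc n" by (rule permutes_not_in[OF \<pi>(1)]) simp
      have fix_iff: "\<pi> w = Suc n \<longleftrightarrow> w = Suc n" for w
        using injD[OF permutes_inj[OF \<pi>(1)], of w "Suc n"] fixN by auto
      show "polytabloid lam t (gtab lam ?g) = (of_int (sign \<pi>) :: int)"
      proof (rule polytabloid_value[OF lam t])
        show "\<pi> \<in> column_stabilizer lam t"
          using \<pi>(2) permutes_subset[OF \<pi>(1), of "{1..Suc n}"]
              by (simp add: column_stabilizer_iff[OF lam])
        fix v assume v: "v \<in> diagram lam"
        show "?g (\<pi> (t v)) = fst v"
        proof (cases "v = (rb, cb)")
          case False
          then have "t v \<noteq> Suc n" using tableaux_eq_iff[OF lam t v b_in] tb by simp
          then show ?thesis using False v \<pi>(3)[of v] diag_\<beta> fix_iff by simp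
        qed (use tb fixN in simp)
      qed
      show "polytabloid \<beta> ?t (gtab \<beta> g) = (of_int (sign \<pi>) :: int)"
      proof (rule polytabloid_value[OF \<beta> t'])
        have "\<pi> ` (t ` diagram_col lam j - {Suc n}) = \<pi> ` t ` diagram_col lam j - \<pi> ` {Suc n}" for j
          by (rule image_set_diff[OF permutes_inj[OF \<pi>(1)]])
        then have "\<pi> ` (t ` diagram_col lam j - {Suc n}) = t ` diagram_col lam j - {Suc n}" for j
          by (simp only: \<pi>(2) image_insert image_empty fixN)
        then show "\<pi> \<in> column_stabilizer \<beta> ?t"
          using \<pi>(1) unfolding column_stabilizer_iff[OF \<beta>] col by blast
      qed (rule \<pi>(3))
    qed
    show ?thesis
    proof (cases "polytabloid lam t (gtab lam ?g) = (0 :: int)")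
      case False
      obtain \<pi> where \<pi>: "\<pi> \<in> column_stabilizer lam t" "\<And>v. v \<in> diagram lam \<Longrightarrow> ?g (\<pi> (t v)) = fst v"
        using polytabloid_nonzeroE[OF lam t False] by blast
      have per: "\<pi> permutes {1..Suc n}" and im: "\<And>j. \<pi> ` (t ` diagram_col lam j) = t ` diagram_col lam j"
        using \<pi>(1) by (simp_all only: column_stabilizer_iff[OF lam])
      have bcol: "(rb, cb) \<in> diagram_col lam cb" using b_in by (simp add: diagram_col_def)
      then have "\<pi> (t (rb, cb)) \<in> t ` diagram_col lam cb" using im[of cb] by blast
      then obtain i where i: "i < ht lam cb" "\<pi> (t (rb, cb)) = t (i, cb)"
        by (auto simp: diagram_col_eq[OF lam])
      have "?g (t (i, cb)) = rb" using \<pi>(2)[OF b_in] by (simp only: i(2) fst_conv)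
      then have "?g (t (i, cb)) = ?g (t (rb, cb))" using tb by simp
      then have "i = rb" using polytabloid_inj_col[OF lam t False i(1), of rb] ht_lam_cb by simp
      then have fixN: "\<pi> (Suc n) = Suc n" using i tb by simp
      have per': "\<pi> permutes {1..n}"
        by (rule permutes_superset[OF per]) (use fixN in \<open>auto simp: le_Suc_eq\<close>)
      have g: "g (\<pi> (?t v)) = fst v" if v: "v \<in> diagram \<beta>" for v
      proof -
        have v': "v \<in> diagram lam" "v \<noteq> (rb, cb)" using v diag_\<beta> by auto
        then have "t v \<noteq> Suc n" using tableaux_eq_iff[OF lam t v'(1) b_in] tb by simp
        then have "\<pi> (t v) \<noteq> Suc n" using fixN injD[OF permutes_inj[OF per], of "t v" "Suc n"] by auto
        then show ?thesis using \<pi>(2)[OF v'(1)] v' by simp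
      qed
      show ?thesis using up[OF per' im g] down[OF per' im g] by simp
    next
      case True
      show ?thesis
      proof (rule ccontr)
        assume "\<not> ?thesis"
        then have nz: "polytabloid \<beta> ?t (gtab \<beta> g) \<noteq> (0 :: int)" using True by simp
        obtain \<pi> where \<pi>: "\<pi> \<in> column_stabilizer \<beta> ?t" "\<And>v. v \<in> diagram \<beta> \<Longrightarrow> g (\<pi> (?t v)) = fst v"
          using polytabloid_nonzeroE[OF \<beta> t' nz] by blast
        have per: "\<pi> permutes {1..n}" and im: "\<And>j. \<pi> ` (t ` diagram_col lam j - {Suc n}) = t ` diagram_col lam j - {Suc n}"
          using \<pi>(1) by (simp_all only: column_stabilizer_iff[OF \<beta>] col)
        have fixN: "\<pi> (Suc n) = Suc n" by (rule permutes_not_in[OF per]) simp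
        have im': "\<pi> ` (t ` diagram_col lam j) = t ` diagram_col lam j" for j
        proof (cases "Suc n \<in> t ` diagram_col lam j")
          case True
          then have "t ` diagram_col lam j = insert (Suc n) (t ` diagram_col lam j - {Suc n})" by blast
          then show ?thesis using im[of j] fixN by (metis image_insert)
        next
          case False
          then have "t ` diagram_col lam j - {Suc n} = t ` diagram_col lam j" by blast
          then show ?thesis using im[of j] by simp
        qed
        show False using up[OF per im' \<pi>(2)] True by (simp add: sign_def split: if_splits)
      qed
    qed
  qed
  then show "rho (polytabloid lam t) (gtab \<beta> g) = polytabloid \<beta> ?t (gtab \<beta> g)"
    by (simp add: rho_gtab[OF polytabloid_perm_module[OF t]])
qed

lemma rho_zero_of_later_column:
  assumes t: "t \<in> tableaux lam" and i: "cb < j" "i < ht lam j" "t (i, j) = Suc n"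
  shows "rho (polytabloid lam t) = 0"
proof (rule perm_module_eqI[OF \<beta> rho_perm_module])
  show "(0 :: tabloid \<Rightarrow> int) \<in> perm_module \<beta>" by (simp add: perm_module_def)
  fix g
  have "polytabloid lam t (gtab lam (g(Suc n := rb))) = (0 :: int)"
  proof (rule ccontr)
    assume "polytabloid lam t (gtab lam (g(Suc n := rb))) \<noteq> (0 :: int)"
    from polytabloid_less_ht[OF lam t this i(2)] have "rb < ht lam j" using i by simp
    then show False using ht_lam_after[OF i(1)] by simp
  qed
  then show "rho (polytabloid lam t) (gtab \<beta> g) = 0 (gtab \<beta> g)"
    by (simp add: rho_gtab[OF polytabloid_perm_module[OF t]])
qed

lemma rho_col_span_zero:
  assumes "x \<in> col_span (Suc cb)"
  shows "rho x = 0"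
  using assms unfolding col_span_def
proof (induction x rule: tabloid_module.span_induct_alt)
  case base
  show ?case by (rule rho_zero)
next
  case (step c x y)
  then obtain t i j where t: "t \<in> tableaux lam" "x = polytabloid lam t" and ij: "Suc cb \<le> j" "i < ht lam j" "t (i, j) = Suc n"
    by blast
  have "rho x = 0" unfolding t(2) by (rule rho_zero_of_later_column[OF t(1) _ ij(2,3)]) (use ij in simp)
  then show ?case unfolding rho_add rho_scale step.IH
    by (simp only: tabloid_module.scale_zero_right add_0)
qed

text \<open>If \<open>n + 1\<close> is in column \<open>cb\<close>, a swap inside the column brings
  it to the bottom at the cost of a sign; columns further right end above row \<open>rb\<close> and
  are killed.\<close>

lemma rho_col_span:
  assumes "x \<in> col_span cb"
  shows "rho x \<in> specht \<beta>"
  using assms unfolding col_span_def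
proof (induction x rule: tabloid_module.span_induct_alt)
  case base
  show ?case unfolding rho_zero specht_def by (rule tabloid_module.span_zero)
next
  case (step c x y)
  then obtain t i j where t: "t \<in> tableaux lam" "x = polytabloid lam t" and ij: "cb \<le> j" "i < ht lam j" "t (i, j) = Suc n"
    by blast
  have "rho x \<in> specht \<beta>"
  proof (cases "j = cb")
    case False
    then have "rho x = 0"
      unfolding t(2) using ij by (intro rho_zero_of_later_column[OF t(1) _ ij(2,3)]) simp
    then show ?thesis unfolding specht_def by (simp only: tabloid_module.span_zero)
  next
    case True
    show ?thesis
    proof (cases "i = rb")
      case i: True
      then have tb: "t (rb, cb) = Suc n" using ij True by simp
      show ?thesis unfolding t(2) rho_polytabloid[OF t(1) tb]
        by (rule polytabloid_specht[OF restrict_tableau[OF lam \<beta> b_in diag_\<beta> t(1) tb]])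
    next
      case False
      let ?\<tau> = "transpose (t (i, cb)) (t (rb, cb))"
      have i': "i < ht lam cb" "rb < ht lam cb" using ij True ht_lam_cb by simp_all
      have \<tau>: "?\<tau> permutes {1..Suc n}"
        by (rule transpose_permutes[OF lam t(1)]) (use i' in \<open>simp_all add: diagram_iff_ht[OF lam]\<close>)
      have t': "?\<tau> \<circ> t \<in> tableaux lam" by (rule comp_tableaux[OF lam \<tau> t(1)])
      have tb: "(?\<tau> \<circ> t) (rb, cb) = Suc n" using ij True by simp
      have "scale (- 1) x = polytabloid lam (?\<tau> \<circ> t)"
        unfolding perm_action_polytabloid[OF lam t(1) \<tau>, symmetric] t(2)
        by (rule column_swap_perm_action[OF lam t(1) i' False, symmetric])
      then have "scale (- 1) (scale (- 1) x) = scale (- 1) (polytabloid lam (?\<tau> \<circ> t))" by (rule arg_cong)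
      then have "x = scale (- 1) (polytabloid lam (?\<tau> \<circ> t))" by (simp add: scale_def)
      then have "rho x = scale (- 1) (polytabloid \<beta> ((?\<tau> \<circ> t)((rb, cb) := 0)))"
        unfolding rho_polytabloid[OF t' tb, symmetric] rho_scale[symmetric] by (rule arg_cong)
      moreover have "polytabloid \<beta> ((?\<tau> \<circ> t)((rb, cb) := 0)) \<in> (specht \<beta> :: (tabloid \<Rightarrow> int) set)"
        by (rule polytabloid_specht[OF restrict_tableau[OF lam \<beta> b_in diag_\<beta> t' tb]])
      ultimately show ?thesis unfolding specht_def by (simp only: tabloid_module.span_scale)
    qed
  qed
  then show ?case using step.IH unfolding rho_add rho_scale specht_def
    by (intro tabloid_module.span_add tabloid_module.span_scale)
qed

lemma jm_specht: "x \<in> specht lam \<Longrightarrow> jm x \<in> specht lam"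
proof -
  assume x: "x \<in> specht lam"
  have "perm_action (transpose z (Suc n)) x \<in> specht lam" if "z \<in> {1..n}" for z
    using that by (intro perm_action_specht[OF lam _ x] permutes_swap_id) auto
  then show ?thesis unfolding jm_def specht_def by (intro tabloid_module.span_sum)
qed

lemma jm_step_specht: "x \<in> specht lam \<Longrightarrow> jm_step k x \<in> specht lam"
  using jm_specht[of x] unfolding jm_step_def specht_def
  by (simp only: tabloid_module.span_add tabloid_module.span_scale split: if_split) blast

lemma jm_prod_specht: "x \<in> specht lam \<Longrightarrow> jm_prod s m x \<in> specht lam"
  by (induction m) (simp_all add: jm_step_specht)

text \<open>In the square of ordered pairs, the last row and the last column each give
  \<open>jm\<close>, and the corner gives the identity.\<close>

lemma pair_sum_Suc: "pair_sum (Suc n) x = pair_sum n x + (jm x + jm x) + x"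
proof -
  have "pair_sum (Suc n) x = (\<Sum>z\<in>{1..n}. (\<Sum>z'\<in>{1..n}. perm_action (transpose z z') x) + perm_action (transpose z (Suc n)) x) +
      ((\<Sum>z'\<in>{1..n}. perm_action (transpose (Suc n) z') x) + perm_action (transpose (Suc n) (Suc n)) x)"
    unfolding pair_sum_def by (simp only: sum.cl_ivl_Suc) simp
  also have "\<dots> = pair_sum n x + jm x + (jm x + x)"
    by (simp add: pair_sum_def jm_def sum.distrib transpose_commute[of "Suc n"] perm_action_id)
  finally show ?thesis by (simp add: add.assoc)
qed

text \<open>The central elements \<open>pair_sum\<close> act by scalars on both Specht modules, so their difference,
  essentially the Jucys--Murphy element, acts by a scalar on one side of the pairing.\<close>

lemma form_jm:
  assumes x: "x \<in> specht lam" and w: "w \<in> specht \<beta>"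
  shows "tabloid_form \<beta> (rho (jm x)) w = residue (rb, cb) * tabloid_form \<beta> (rho x) w"
proof -
  let ?K = "\<lambda>\<mu>. \<Sum>v\<in>diagram \<mu>. 2 * residue v + 1" and ?f = "tabloid_form \<beta> (rho x) w"
  have K: "?K lam = ?K \<beta> + (2 * residue (rb, cb) + 1)"
    using sum.remove[OF finite_diagram[OF lam] b_in, of "\<lambda>v. 2 * residue v + 1"] diag_\<beta> by simp
  have rho_pair: "rho (pair_sum n x) = pair_sum n (rho x)"
  proof -
    have sum: "rho (sum f A) = (\<Sum>i\<in>A. rho (f i))" for f and A :: "nat set"
      by (induction A rule: infinite_finite_induct) (simp_all only: sum.infinite sum.empty sum.insert rho_zero rho_add not_False_eq_True)
    have "rho (perm_action (transpose z z') x) = perm_action (transpose z z') (rho x)"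
      if "z \<in> {1..n}" "z' \<in> {1..n}" for z z'
      using that by (intro rho_perm_action permutes_swap_id)
    then show ?thesis unfolding pair_sum_def sum by (intro sum.cong refl)
  qed
  have "?K lam * ?f = tabloid_form \<beta> (rho (pair_sum (Suc n) x)) w"
    unfolding pair_sum_specht[OF lam x] rho_scale tabloid_form_scale_left ..
  also have "\<dots> = tabloid_form \<beta> (rho x) (pair_sum n w) + 2 * tabloid_form \<beta> (rho (jm x)) w + ?f"
    unfolding pair_sum_Suc rho_add rho_pair tabloid_form_add_left tabloid_form_pair_sum[OF \<beta>] by simp
  also have "tabloid_form \<beta> (rho x) (pair_sum n w) = ?K \<beta> * ?f"
    unfolding pair_sum_specht[OF \<beta> w] tabloid_form_scale_right ..
  finally show ?thesis unfolding K by (simp add: algebra_simps)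
qed

lemma form_jm_prod:
  assumes x: "x \<in> specht lam" and w: "w \<in> specht \<beta>"
  shows "tabloid_form \<beta> (rho (jm_prod s m x)) w =
    (\<Prod>k\<in>{s..<s + m}. if ht lam (Suc k) < ht lam k then residue (rb, cb) - col_res k else 1) *
    tabloid_form \<beta> (rho x) w"
proof (induction m)
  case (Suc m)
  let ?y = "jm_prod s m x"
  have "tabloid_form \<beta> (rho (jm_step k ?y)) w =
      (if ht lam (Suc k) < ht lam k then residue (rb, cb) - col_res k else 1) * tabloid_form \<beta> (rho ?y) w" for k
    using form_jm[OF jm_prod_specht[OF x] w, of s m]
    by (simp only: jm_step_def split: if_split) (simp only: rho_add rho_scale tabloid_form_add_left tabloid_form_scale_left, simp add: algebra_simps)
  then show ?case using Suc.IH by (simp add: mult.assoc)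
qed simp

lemma col_res_ca: "col_res ca = residue (ra, ca)" and col_res_cb: "col_res cb = residue (rb, cb)"
  by (simp_all add: col_res_def residue_def ht_lam_ca ht_lam_cb)

definition image_vector :: "tableau \<Rightarrow> tabloid \<Rightarrow> int" where
  "image_vector t = rho (jm_prod ca (cb - ca) (polytabloid lam t))"

lemma a_removable: "ht lam (Suc ca) < ht lam ca"
  using h_after[of "Suc ca"] ht_lam_ca by (simp add: ht_\<alpha>)

lemma image_vector_jantzen:
  assumes t: "t \<in> tableaux lam" "t (ra, ca) = Suc n"
    and dvd: "int p ^ i dvd residue (ra, ca) - residue (rb, cb)"
  shows "image_vector t \<in> jantzen_lattice p i \<beta>"
proof -
  have "polytabloid lam t \<in> col_span ca" using t ht_lam_ca by (intro col_span_base[of t ca ca ra]) auto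
  then have "jm_prod ca (cb - ca) (polytabloid lam t) \<in> col_span cb"
    using jm_prod_col_span[of _ ca "cb - ca"] cols by simp
  then have "image_vector t \<in> specht \<beta>" unfolding image_vector_def by (rule rho_col_span)
  moreover have "int p ^ i dvd tabloid_form \<beta> (image_vector t) w" if w: "w \<in> specht \<beta>" for w
  proof -
    let ?f = "\<lambda>k. if ht lam (Suc k) < ht lam k then residue (rb, cb) - col_res k else 1"
    \<comment> \<open>The factor of column \<open>ca\<close> is present because \<open>a\<close> is
      removable, and it is the residue difference up to sign.\<close>
    have "int p ^ i dvd ?f ca" using dvd a_removable by (simp add: col_res_ca dvd_diff_commute)
    also have "?f ca dvd (\<Prod>k\<in>{ca..<ca + (cb - ca)}. ?f k)" using cols by (intro dvd_prodI) auto
    finally show ?thesis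
      unfolding image_vector_def form_jm_prod[OF polytabloid_specht[OF t(1)] w] by (rule dvd_mult2)
  qed
  ultimately show ?thesis by (simp add: jantzen_lattice_def)
qed

text \<open>The factors other than that of column \<open>ca\<close> already carry \<open>x\<close>
  into \<open>col_span cb\<close>. There \<open>jm\<close> is the residue of \<open>b\<close> up to
  vectors killed by \<open>rho\<close>, so the factor of \<open>ca\<close>, applied last, becomes
  the residue difference.\<close>

lemma rho_jm_prod_later:
  assumes x: "x \<in> col_span (Suc ca)"
  obtains w where "rho (jm_prod ca (cb - ca) x) = scale (residue (rb, cb) - residue (ra, ca)) w"
proof -
  obtain m where m: "cb - ca = Suc m" using cols by (cases "cb - ca") auto
  define z where "z = jm_prod (Suc ca) m x"
  have "Suc ca + m = cb" using m cols by simp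
  then have z: "z \<in> col_span cb" using jm_prod_col_span[OF x, of m] by (simp only: z_def)
  obtain w where w: "w \<in> col_span (Suc cb)" "jm z = scale (col_res cb) z + w"
    using jm_col_span[OF z] by blast
  have "jm_prod ca (cb - ca) x = jm z + scale (- col_res ca) z"
    unfolding m jm_prod_first jm_step_def z_def[symmetric] using a_removable by (simp only: if_True)
  also have "\<dots> = scale (col_res cb - col_res ca) z + w"
    unfolding w(2) by (simp add: scale_def fun_eq_iff algebra_simps)
  finally have "rho (jm_prod ca (cb - ca) x) = scale (col_res cb - col_res ca) (rho z) + 0"
    by (simp only: rho_add rho_scale rho_col_span_zero[OF w(1)])
  then show ?thesis using that by (simp only: col_res_ca col_res_cb add_0_right)
qed

end

section \<open>The coefficient of the image vector at the full chain\<close>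

context box_move
begin

definition removable :: "nat \<Rightarrow> nat set" where
  "removable m = {k. ca \<le> k \<and> k < ca + m \<and> ht lam (Suc k) < ht lam k}"

text \<open>By \<open>polytabloid_image\<close>, a nonzero coefficient of the polytabloid requires
  this set to be empty; its size measures how far \<open>g\<close> is from the support.\<close>

definition bad_cols :: "tableau \<Rightarrow> (nat \<Rightarrow> nat) \<Rightarrow> nat set" where
  "bad_cols t g = {j. ca < j \<and> j \<le> cb \<and> g ` t ` diagram_col lam j \<noteq> {..<ht lam j}}"

lemma finite_bad_cols: "finite (bad_cols t g)"
  unfolding bad_cols_def by (rule finite_subset[of _ "{..cb}"]) auto

lemma card_removable_Suc:
  "card (removable (Suc m)) = card (removable m) + (if ht lam (Suc (ca + m)) < ht lam (ca + m) then 1 else 0)"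
proof (cases "ht lam (Suc (ca + m)) < ht lam (ca + m)")
  case True
  then have "removable (Suc m) = insert (ca + m) (removable m)" by (auto simp: removable_def less_Suc_eq)
  moreover have "ca + m \<notin> removable m" "finite (removable m)" by (auto simp: removable_def)
  ultimately show ?thesis using True by simp
next
  case False
  then have "removable (Suc m) = removable m" by (auto simp: removable_def less_Suc_eq)
  then show ?thesis using False by simp
qed

lemma jm_gtab: "jm x (gtab lam g) = (\<Sum>z\<in>{1..n}. x (gtab lam (g \<circ> transpose z (Suc n))))"
  unfolding jm_def sum_fun_apply
proof (intro sum.cong refl)
  fix z assume "z \<in> {1..n}"
  then have "transpose z (Suc n) permutes {1..Suc n}" by (intro permutes_swap_id) auto
  then show "perm_action (transpose z (Suc n)) x (gtab lam g) = x (gtab lam (g \<circ> transpose z (Suc n)))"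
    by (rule perm_action_gtab[OF lam])
qed

text \<open>Each factor can repair at most one column.\<close>

lemma jm_prod_support:
  assumes t: "t \<in> tableaux lam" and ta: "t (ra, ca) = Suc n"
    and nz: "jm_prod ca m (polytabloid lam t) (gtab lam g) \<noteq> 0"
  shows "card (bad_cols t g) \<le> card (removable m)"
  using nz
proof (induction m arbitrary: g)
  case 0
  then have "polytabloid lam t (gtab lam g) \<noteq> (0 :: int)" by simp
  from polytabloid_image[OF lam t this] have "bad_cols t g = {}" by (simp add: bad_cols_def)
  then show ?case by simp
next
  case (Suc m)
  let ?y = "jm_prod ca m (polytabloid lam t)"
  show ?case
  proof (cases "ht lam (Suc (ca + m)) < ht lam (ca + m)")
    case False
    then show ?thesis using Suc by (simp add: jm_step_def card_removable_Suc)
  next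
    case True
    have "(\<Sum>z\<in>{1..n}. ?y (gtab lam (g \<circ> transpose z (Suc n)))) + (- col_res (ca + m)) * ?y (gtab lam g) \<noteq> 0"
      using Suc.prems True by (simp add: jm_step_def jm_gtab scale_def del: mult_minus_left)
    then consider "?y (gtab lam g) \<noteq> 0" | z where "z \<in> {1..n}" "?y (gtab lam (g \<circ> transpose z (Suc n))) \<noteq> 0"
      by (metis (no_types, lifting) add_0 mult_zero_right sum.neutral)
    then show ?thesis
    proof cases
      case 1
      then show ?thesis using Suc.IH[of g] True by (simp add: card_removable_Suc)
    next
      case (2 z)
      have "z \<in> {1..Suc n}" using 2 by simp
      then obtain v where v: "v \<in> diagram lam" "z = t v" using tableaux_surj[OF lam t] by metis
      let ?g = "g \<circ> transpose z (Suc n)"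
      have "bad_cols t g \<subseteq> insert (snd v) (bad_cols t ?g)"
      proof
        fix j assume j: "j \<in> bad_cols t g"
        show "j \<in> insert (snd v) (bad_cols t ?g)"
        proof (cases "j = snd v")
          case False
          have "transpose z (Suc n) w = w" if w: "w \<in> t ` diagram_col lam j" for w
          proof -
            obtain u where u: "u \<in> diagram lam" "snd u = j" "w = t u"
              using w by (auto simp: diagram_col_def)
            have "w \<noteq> z" using tableaux_eq_iff[OF lam t u(1) v(1)] u v False by auto
            moreover have "w \<noteq> Suc n"
              using tableaux_eq_iff[OF lam t u(1) a_in] u ta j by (auto simp: bad_cols_def)
            ultimately show ?thesis by (intro transpose_apply_other)
          qed
          then have "?g ` t ` diagram_col lam j = g ` t ` diagram_col lam j"
            by (intro image_cong refl) simp
          then show ?thesis using j unfolding bad_cols_def by simp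
        qed simp
      qed
      then have "card (bad_cols t g) \<le> card (insert (snd v) (bad_cols t ?g))"
        by (rule card_mono[rotated]) (simp add: finite_bad_cols)
      also have "\<dots> \<le> Suc (card (bad_cols t ?g))" by (simp add: card_insert_if finite_bad_cols)
      also have "\<dots> \<le> card (removable (Suc m))"
        unfolding card_removable_Suc using Suc.IH[OF 2(2)] True by (simp only: if_True)
      finally show ?thesis .
    qed
  qed
qed

text \<open>The entry \<open>n + 1\<close> at \<open>a\<close> has reached the bottom row of column
  \<open>ca + m\<close>, and on the way each bottom entry has dropped to the bottom row of the
  preceding column. For \<open>m = cb - ca\<close> this is \<open>chain UNIV\<close> with
  \<open>n + 1\<close> in the row of \<open>b\<close>.\<close>

definition shifted :: "nat \<Rightarrow> node \<Rightarrow> nat" where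
  "shifted m v = (if v = (ra, ca) then ht lam (ca + m) - 1
     else if ca < snd v \<and> snd v \<le> ca + m \<and> Suc (fst v) = ht lam (snd v) then ht lam (snd v - 1) - 1
     else fst v)"

lemma ht_lam_pos: "j \<le> cb \<Longrightarrow> 0 < ht lam j"
  using ht_antimono[OF lam, of j cb] ht_lam_cb by simp

lemma card_removable_shift:
  "card {j. ca < j \<and> j \<le> ca + m \<and> ht lam j < ht lam (j - 1)} = card (removable m)"
proof (rule bij_betw_same_card[of "\<lambda>j. j - 1"])
  show "bij_betw (\<lambda>j. j - 1) {j. ca < j \<and> j \<le> ca + m \<and> ht lam j < ht lam (j - 1)} (removable m)"
    by (rule bij_betwI[where g = Suc]) (auto simp: removable_def)
qed

text \<open>The extreme case of \<open>jm_prod_support\<close>. When a factor is applied, the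
  filling has more bad columns than the previous product tolerates, so the scalar part of the factor
  contributes nothing. Among the exchanges, the one with the bottom entry of the newest column leads
  to \<open>shifted m\<close>; every other one leaves all columns of \<open>B\<close> bad.\<close>

lemma jm_prod_coeff:
  assumes t: "t \<in> tableaux lam" and ta: "t (ra, ca) = Suc n" and m: "ca + m \<le> cb"
    and g: "\<And>v. v \<in> diagram lam \<Longrightarrow> g (t v) = shifted m v"
  shows "jm_prod ca m (polytabloid lam t) (gtab lam g) = 1"
  using m g
proof (induction m arbitrary: g)
  case 0
  have "polytabloid lam t (gtab lam g) = (of_int (sign (id :: nat \<Rightarrow> nat)) :: int)"
  proof (rule polytabloid_value[OF lam t])
    show "id \<in> column_stabilizer lam t" by (simp add: column_stabilizer_iff[OF lam] permutes_id)
    show "g (id (t v)) = fst v" if "v \<in> diagram lam" for v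
      using 0(2)[OF that] ht_lam_ca by (auto simp: shifted_def)
  qed
  then show ?case by simp
next
  case (Suc m)
  let ?y = "jm_prod ca m (polytabloid lam t)" and ?k = "ca + m"
  show ?case
  proof (cases "ht lam (Suc ?k) < ht lam ?k")
    case False
    then have eq: "ht lam (Suc ?k) = ht lam ?k" using ht_antimono[OF lam, of ?k "Suc ?k"] by simp
    have "shifted (Suc m) v = shifted m v" for v
      using eq by (auto simp: shifted_def le_Suc_eq)
    then have "?y (gtab lam g) = 1" using Suc.prems by (intro Suc.IH) auto
    then show ?thesis using eq by (simp add: jm_step_def)
  next
    case True
    define e where "e = ht lam (Suc ?k) - 1"
    have e: "ht lam (Suc ?k) = Suc e" using ht_lam_pos[of "Suc ?k"] Suc.prems(1) by (simp add: e_def)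
    let ?w0 = "(e, Suc ?k)"
    have w0: "?w0 \<in> diagram lam" "?w0 \<noteq> (ra, ca)" using e by (simp_all add: diagram_iff_ht[OF lam])
    define B where "B = {j. ca < j \<and> j \<le> ca + Suc m \<and> ht lam j < ht lam (j - 1)}"
    have cB: "card (removable m) < card B"
      unfolding B_def card_removable_shift card_removable_Suc using True by simp
    have zero: "?y (gtab lam g') = 0" if "B \<subseteq> bad_cols t g'" for g'
    proof (rule ccontr)
      assume "?y (gtab lam g') \<noteq> 0"
      then have "card (bad_cols t g') \<le> card (removable m)" by (rule jm_prod_support[OF t ta])
      moreover have "card B \<le> card (bad_cols t g')" by (rule card_mono[OF finite_bad_cols that])
      ultimately show False using cB by simp
    qed
    have bottom: "(ht lam j - 1, j) \<in> diagram lam" "(ht lam j - 1, j) \<noteq> (ra, ca)"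
      "g (t (ht lam j - 1, j)) = ht lam (j - 1) - 1" "\<not> ht lam (j - 1) - 1 < ht lam j" "j \<le> cb" "ca < j"
      if "j \<in> B" for j
    proof -
      have j: "ca < j" "j \<le> ca + Suc m" "ht lam j < ht lam (j - 1)" using that by (auto simp: B_def)
      have pos: "0 < ht lam j" using ht_lam_pos[of j] j Suc.prems(1) by simp
      show 1: "(ht lam j - 1, j) \<in> diagram lam" using pos by (simp add: diagram_iff_ht[OF lam])
      show "(ht lam j - 1, j) \<noteq> (ra, ca)" "j \<le> cb" "ca < j" using j Suc.prems(1) by auto
      show "g (t (ht lam j - 1, j)) = ht lam (j - 1) - 1"
        using Suc.prems(2)[OF 1] j pos by (auto simp: shifted_def)
      show "\<not> ht lam (j - 1) - 1 < ht lam j" using j by simp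
    qed
    have bad: "j \<in> bad_cols t g'"
      if "ca < j" "j \<le> cb" "v \<in> diagram lam" "snd v = j" "\<not> g' (t v) < ht lam j" for j v g'
      using that unfolding bad_cols_def diagram_col_def by blast
    have Bg: "B \<subseteq> bad_cols t g"
    proof
      fix j assume "j \<in> B"
      note b = bottom[OF this]
      show "j \<in> bad_cols t g" using b by (intro bad[of j "(ht lam j - 1, j)"]) auto
    qed
    have gN: "g (Suc n) = e" using Suc.prems(2)[OF a_in] ta by (simp add: shifted_def e)
    have Bz: "B \<subseteq> bad_cols t (g \<circ> transpose (t w) (Suc n))"
      if w: "w \<in> diagram lam" "w \<noteq> (ra, ca)" "w \<noteq> ?w0" for w
    proof
      fix j assume jB: "j \<in> B"
      note b = bottom[OF jB]
      let ?g = "g \<circ> transpose (t w) (Suc n)" and ?b = "(ht lam j - 1, j)"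
      have unmoved: "?g (t v) = g (t v)" if "v \<in> diagram lam" "v \<noteq> w" "v \<noteq> (ra, ca)" for v
        using tableaux_eq_iff[OF lam t that(1) w(1)] tableaux_eq_iff[OF lam t that(1) a_in] that ta
            by simp
      show "j \<in> bad_cols t ?g"
      proof (cases "w = ?b")
        case False
        then have "?g (t ?b) = g (t ?b)" using b by (intro unmoved) auto
        then show ?thesis using b by (intro bad[of j ?b]) auto
      next
        case True
        \<comment> \<open>Exchanging \<open>n + 1\<close> with the bottom entry of an older bad
          column brings the value \<open>e\<close> there, while the column still lacks its own
          bottom row.\<close>
        have "j \<noteq> Suc ?k" using True w(3) e by auto
        then have jk: "j \<le> ?k" using jB by (auto simp: B_def)
        have "ht lam ?k \<le> ht lam j" by (rule ht_antimono[OF lam jk])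
        then have ej: "e < ht lam j - 1" using \<open>ht lam (Suc ?k) < ht lam ?k\<close> e by simp
        have "ht lam j - 1 \<notin> ?g ` t ` diagram_col lam j"
        proof
          assume "ht lam j - 1 \<in> ?g ` t ` diagram_col lam j"
          then obtain i where i: "i < ht lam j" "?g (t (i, j)) = ht lam j - 1"
            by (auto simp: diagram_col_eq[OF lam])
          show False
          proof (cases "(i, j) = w")
            case True
            then show ?thesis using i gN ej by simp
          next
            case False
            have d: "(i, j) \<in> diagram lam" using i by (simp add: diagram_iff_ht[OF lam])
            have "(i, j) \<noteq> (ra, ca)" using b by auto
            then have "?g (t (i, j)) = shifted (Suc m) (i, j)"
              using unmoved[OF d False] Suc.prems(2)[OF d] by simp
            also have "\<dots> = i" using False True \<open>(i, j) \<noteq> (ra, ca)\<close> i by (auto simp: shifted_def)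
            finally show ?thesis using i False True by simp
          qed
        qed
        moreover have "ht lam j - 1 < ht lam j" using ej by simp
        ultimately show ?thesis using b unfolding bad_cols_def by auto
      qed
    qed
    have one: "?y (gtab lam (g \<circ> transpose (t ?w0) (Suc n))) = 1"
    proof (rule Suc.IH)
      show "ca + m \<le> cb" using Suc.prems(1) by simp
      fix v assume v: "v \<in> diagram lam"
      have gw0: "g (t ?w0) = ht lam ?k - 1"
        using Suc.prems(2)[OF w0(1)] w0(2) e by (simp add: shifted_def)
      consider "v = (ra, ca)" | "v = ?w0" | "v \<noteq> (ra, ca)" "v \<noteq> ?w0" by blast
      then show "(g \<circ> transpose (t ?w0) (Suc n)) (t v) = shifted m v"
      proof cases
        case 1
        then show ?thesis using ta gw0 by (simp add: shifted_def)
      next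
        case 2
        then show ?thesis using gN w0 by (simp add: shifted_def)
      next
        case 3
        then have "t v \<noteq> Suc n" "t v \<noteq> t ?w0"
          using tableaux_eq_iff[OF lam t v a_in] tableaux_eq_iff[OF lam t v w0(1)] ta by auto
        then have "(g \<circ> transpose (t ?w0) (Suc n)) (t v) = shifted (Suc m) v"
          using Suc.prems(2)[OF v] by simp
        also have "\<dots> = shifted m v"
          using 3 e by (cases v) (auto simp: shifted_def le_Suc_eq)
        finally show ?thesis .
      qed
    qed
    have tw0: "t ?w0 \<in> {1..n}"
    proof -
      have "t ?w0 \<noteq> Suc n" using tableaux_eq_iff[OF lam t w0(1) a_in] w0(2) ta by simp
      then show ?thesis using tableaux_range[OF lam t w0(1)] by (auto simp: le_Suc_eq)
    qed
    have "(\<Sum>z\<in>{1..n}. ?y (gtab lam (g \<circ> transpose z (Suc n)))) = ?y (gtab lam (g \<circ> transpose (t ?w0) (Suc n)))"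
    proof (rule sum_single_nonzero[OF _ tw0])
      fix z assume z: "z \<in> {1..n}" "z \<noteq> t ?w0"
      then have "z \<in> {1..Suc n}" by simp
      then obtain w where w: "w \<in> diagram lam" "z = t w" using tableaux_surj[OF lam t] by metis
      have "w \<noteq> (ra, ca)" "w \<noteq> ?w0" using w z ta by auto
      then show "?y (gtab lam (g \<circ> transpose z (Suc n))) = 0"
        unfolding w(2) using w(1) by (intro zero Bz)
    qed simp
    then have "jm ?y (gtab lam g) = 1" unfolding jm_gtab one .
    moreover have "?y (gtab lam g) = 0" by (rule zero[OF Bg])
    ultimately show ?thesis using True by (simp add: jm_step_def scale_def)
  qed
qed

lemma gap_UNIV: "ca < k \<Longrightarrow> gap UNIV k = ht lam (k - 1) - 1"
proof (induction k)
  case (Suc k)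
  then show ?case
    by (cases "k = ca") (auto simp: ht_\<alpha> ht_lam_ca gap_ca)
qed simp

lemma image_vector_chain:
  assumes t: "t \<in> tableaux lam" and ta: "t (ra, ca) = Suc n"
    and g: "\<And>v. v \<in> D \<Longrightarrow> g (t v) = chain UNIV v"
  shows "image_vector t (gtab \<beta> g) = 1"
proof -
  let ?x = "jm_prod ca (cb - ca) (polytabloid lam t)"
  have "?x \<in> specht lam" by (rule jm_prod_specht[OF polytabloid_specht[OF t]])
  then have x: "?x \<in> perm_module lam" using specht_subset_perm_module by blast
  have "?x (gtab lam (g(Suc n := rb))) = 1"
  proof (rule jm_prod_coeff[OF t ta])
    show "ca + (cb - ca) \<le> cb" using cols by simp
    fix v assume v: "v \<in> diagram lam"
    show "(g(Suc n := rb)) (t v) = shifted (cb - ca) v"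
    proof (cases "v = (ra, ca)")
      case True
      then show ?thesis using ta cols by (simp add: shifted_def ht_lam_cb)
    next
      case False
      then have vD: "v \<in> D" using v diag_\<alpha> by auto
      have "t v \<noteq> Suc n" using tableaux_eq_iff[OF lam t v a_in] False ta by simp
      then have "(g(Suc n := rb)) (t v) = chain UNIV v" using g[OF vD] by simp
      also have "\<dots> = shifted (cb - ca) v"
        using False cols gap_UNIV[of "snd v"] by (auto simp: chain_def shifted_def ht_\<alpha>)
      finally show ?thesis .
    qed
  qed
  then show ?thesis unfolding image_vector_def rho_gtab[OF x] .
qed

end

section \<open>Homomorphisms in characteristic p\<close>

lemma reduction_add: "reduction (x + y) = reduction x + reduction y"
  by (simp add: reduction_def fun_eq_iff)

lemma reduction_scale: "reduction (scale c x) = scale (of_int c) (reduction x)"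
  by (simp add: reduction_def scale_def fun_eq_iff)

lemma reduction_sum: "reduction (sum f A) = (\<Sum>i\<in>A. reduction (f i))"
  by (simp add: reduction_def sum_fun_apply fun_eq_iff)

lemma reduction_perm_action: "reduction (perm_action \<sigma> x) = perm_action \<sigma> (reduction x)"
  by (simp add: reduction_def perm_action_def)

lemma reduction_polytabloid: "reduction (polytabloid \<mu> t) = polytabloid \<mu> t"
  by (auto simp: reduction_def polytabloid_def scale_def tabloid_basis_def sum_fun_apply fun_eq_iff intro!: sum.cong)

lemma reduction_specht:
  assumes "x \<in> specht \<mu>"
  shows "reduction x \<in> (specht \<mu> :: (tabloid \<Rightarrow> 'f::field) set)"
  using assms unfolding specht_def
proof (induction x rule: tabloid_module.span_induct_alt)
  case base
  have "reduction 0 = (0 :: tabloid \<Rightarrow> 'f)" by (simp add: reduction_def fun_eq_iff)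
  then show ?case by (simp only: tabloid_module.span_zero)
next
  case (step c x y)
  then obtain t where t: "t \<in> tableaux \<mu>" "x = polytabloid \<mu> t" by blast
  have "reduction x \<in> (tabloid_module.span (polytabloid \<mu> ` tableaux \<mu>) :: (tabloid \<Rightarrow> 'f) set)"
    unfolding t(2) reduction_polytabloid using t(1) by (intro tabloid_module.span_base imageI)
  then show ?case using step.IH unfolding reduction_add reduction_scale
    by (intro tabloid_module.span_add tabloid_module.span_scale)
qed

lemma sym_hom_zero: "\<theta> \<in> sym_hom n (specht \<mu>) V \<Longrightarrow> \<theta> 0 = 0"
proof -
  assume \<theta>: "\<theta> \<in> sym_hom n (specht \<mu>) V"
  have "0 \<in> (specht \<mu> :: (tabloid \<Rightarrow> 'a) set)" unfolding specht_def by (rule tabloid_module.span_zero)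
  then have "\<theta> (scale 0 0) = scale 0 (\<theta> 0)" using \<theta> unfolding sym_hom_def by blast
  then show ?thesis by (simp only: tabloid_module.scale_zero_left)
qed

lemma sym_hom_sum:
  assumes \<theta>: "\<theta> \<in> sym_hom n (specht \<mu>) V" and f: "\<And>i. i \<in> A \<Longrightarrow> f i \<in> specht \<mu>"
  shows "\<theta> (sum f A) = (\<Sum>i\<in>A. \<theta> (f i))"
  using f
proof (induction A rule: infinite_finite_induct)
  case (insert a A)
  have "sum f A \<in> specht \<mu>"
    using insert.prems unfolding specht_def by (intro tabloid_module.span_sum) auto
  then have "\<theta> (f a + sum f A) = \<theta> (f a) + \<theta> (sum f A)"
    using \<theta> insert.prems unfolding sym_hom_def by blast
  moreover have "\<theta> (sum f A) = (\<Sum>i\<in>A. \<theta> (f i))" using insert by blast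
  ultimately show ?case by (simp only: sum.insert[OF insert.hyps])
qed (simp_all only: sum.infinite sum.empty sym_hom_zero[OF \<theta>] not_False_eq_True)

section \<open>Comparing homomorphic images with the image vector\<close>

context box_move
begin

lemma image_vector_specht:
  assumes "t \<in> tableaux lam" "t (ra, ca) = Suc n"
  shows "image_vector t \<in> specht \<beta>"
  using image_vector_jantzen[OF assms, of 1 0] by (simp add: jantzen_lattice_def)

lemma perm_action_image_vector:
  assumes "\<sigma> permutes {1..n}"
  shows "perm_action \<sigma> (image_vector t) = rho (jm_prod ca (cb - ca) (perm_action \<sigma> (polytabloid lam t)))"
  unfolding image_vector_def
  by (simp only: rho_perm_action[OF assms, symmetric] perm_action_jm_prod[OF assms])

context
  fixes s t :: tableau
  assumes s: "s \<in> tableaux \<alpha>" and t: "t \<in> tableaux lam" and ta: "t (ra, ca) = Suc n"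
    and st: "\<And>v. v \<in> D \<Longrightarrow> t v = s v"
begin

lemma image_vector_column_swap:
  assumes i: "i < h j" "i' < h j" "i \<noteq> i'"
  shows "perm_action (transpose (s (i, j)) (s (i', j))) (image_vector t) = scale (- 1) (image_vector t)"
proof -
  have d: "(i, j) \<in> D" "(i', j) \<in> D" using i by (simp_all add: D_iff)
  have tr: "transpose (s (i, j)) (s (i', j)) permutes {1..n}" by (rule transpose_permutes[OF \<alpha> s d])
  have i': "i < ht lam j" "i' < ht lam j" using i by (simp_all add: less_ht_\<alpha>)
  have "perm_action (transpose (s (i, j)) (s (i', j))) (polytabloid lam t) = scale (- 1) (polytabloid lam t :: tabloid \<Rightarrow> int)"
    using column_swap_perm_action[OF lam t i' i(3)] by (simp only: st[OF d(1)] st[OF d(2)])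
  then show ?thesis
    unfolding perm_action_image_vector[OF tr] by (simp only: jm_prod_scale rho_scale image_vector_def)
qed

text \<open>The Garnir relations of \<open>\<alpha>\<close> hold for the image vector up to an error supported on the
  polytabloids with \<open>n + 1\<close> further to the right, which is a multiple of the residue difference.\<close>

lemma image_vector_garnir:
  assumes "ca < j" "r < h j" "k \<noteq> j" "h j \<le> h k"
  obtains w where "image_vector t = (\<Sum>i<h k. perm_action (transpose (s (r, j)) (s (i, k))) (image_vector t)) +
    scale (residue (rb, cb) - residue (ra, ca)) w"
proof -
  let ?e = "polytabloid lam t :: tabloid \<Rightarrow> int"
  let ?\<tau> = "\<lambda>i. transpose (t (r, j)) (t (i, k))"
  have rj: "(r, j) \<in> D" using assms by (simp add: D_iff)
  have ik: "(i, k) \<in> D" if "i < h k" for i using that by (simp add: D_iff)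
  have tr: "transpose (s (r, j)) (s (i, k)) permutes {1..n}" if "i < h k" for i
    by (rule transpose_permutes[OF \<alpha> s rj ik[OF that]])
  have j: "r < ht lam j" "ht lam j \<le> ht lam k"
    using assms ht_lam_ca by (auto simp: ht_\<alpha> split: if_splits)
  have gar: "?e = (\<Sum>i<ht lam k. perm_action (?\<tau> i) ?e)"
    by (rule garnir_perm_action[OF lam t j(1) assms(3) j(2)])
  have "\<exists>z\<in>col_span (Suc ca). ?e = (\<Sum>i<h k. perm_action (?\<tau> i) ?e) + z"
  proof (cases "k = ca")
    case False
    then have "?e = (\<Sum>i<h k. perm_action (?\<tau> i) ?e) + 0" using gar by (simp add: ht_\<alpha>)
    then show ?thesis using col_span_zero by blast
  next
    case True
    have "?e = (\<Sum>i<h k. perm_action (?\<tau> i) ?e) + perm_action (?\<tau> ra) ?e"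
      by (subst gar) (simp only: True ht_lam_ca h_ca sum.lessThan_Suc)
    moreover have "perm_action (?\<tau> ra) ?e \<in> col_span (Suc ca)"
    proof -
      have "perm_action (transpose (t (ra, ca)) (t (r, j))) ?e \<in> col_span (Suc ca)"
        by (rule move_last_col_span[OF t a_in ta]) (use j assms in \<open>simp_all add: diagram_iff_ht[OF lam]\<close>)
      then show ?thesis unfolding True transpose_commute[of "t (r, j)"] .
    qed
    ultimately show ?thesis by blast
  qed
  then obtain z where z: "z \<in> col_span (Suc ca)" "?e = (\<Sum>i<h k. perm_action (?\<tau> i) ?e) + z" by blast
  let ?\<Phi> = "\<lambda>x. rho (jm_prod ca (cb - ca) x)"
  have add: "?\<Phi> (x + y) = ?\<Phi> x + ?\<Phi> y" for x y by (simp only: jm_prod_add rho_add)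
  have zero: "?\<Phi> 0 = 0"
    using add[of 0 0] unfolding add_0_right by (rule add_cancel_right_right[THEN iffD1])
  have sum: "?\<Phi> (sum f A) = (\<Sum>i\<in>A. ?\<Phi> (f i))" for f and A :: "nat set"
    by (induction A rule: infinite_finite_induct) (simp_all only: sum.infinite sum.empty sum.insert zero add not_False_eq_True)
  obtain w where w: "?\<Phi> z = scale (residue (rb, cb) - residue (ra, ca)) w"
    by (rule rho_jm_prod_later[OF z(1)])
  have "image_vector t = ?\<Phi> ((\<Sum>i<h k. perm_action (?\<tau> i) ?e) + z)"
    unfolding image_vector_def z(2)[symmetric] ..
  also have "\<dots> = (\<Sum>i<h k. ?\<Phi> (perm_action (?\<tau> i) ?e)) + scale (residue (rb, cb) - residue (ra, ca)) w"
    unfolding add sum w ..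
  also have "(\<Sum>i<h k. ?\<Phi> (perm_action (?\<tau> i) ?e)) = (\<Sum>i<h k. perm_action (transpose (s (r, j)) (s (i, k))) (image_vector t))"
  proof (intro sum.cong refl)
    fix i assume "i \<in> {..<h k}"
    then have i: "i < h k" by simp
    show "?\<Phi> (perm_action (?\<tau> i) ?e) = perm_action (transpose (s (r, j)) (s (i, k))) (image_vector t)"
      unfolding perm_action_image_vector[OF tr[OF i]] st[OF rj] st[OF ik[OF i]] ..
  qed
  finally show ?thesis by (rule that)
qed

text \<open>Transports a filling of the diagram of \<alpha> along \<open>s\<close> to a row function
  on entries. Outside \<open>{1..n}\<close> the values are arbitrary, and \<open>gtab\<close>
  ignores them.\<close>

definition assignment :: "(node \<Rightarrow> nat) \<Rightarrow> nat \<Rightarrow> nat" where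
  "assignment T z = T (inv_into D s z)"

lemma assignment_entry: "v \<in> D \<Longrightarrow> assignment T (s v) = T v"
  using tableaux_bij[OF \<alpha> s] by (simp add: assignment_def bij_betw_def)

lemma gtab_assignment:
  assumes "\<And>v. v \<in> D \<Longrightarrow> g (s v) = T v"
  shows "gtab \<beta> (assignment T) = gtab \<beta> g"
proof (rule gtab_cong[OF \<beta>])
  fix z assume "z \<in> {1..n}"
  then obtain v where "v \<in> D" "z = s v" using tableaux_surj[OF \<alpha> s] by metis
  then show "assignment T z = g z" using assms assignment_entry by simp
qed

lemma gtab_assignment_swap:
  assumes "u \<in> D" "v \<in> D"
  shows "gtab \<beta> (assignment (T \<circ> transpose u v)) = gtab \<beta> (assignment T \<circ> transpose (s u) (s v))"
proof (rule gtab_assignment)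
  fix w assume w: "w \<in> D"
  have "transpose (s u) (s v) (s w) = s (transpose u v w)"
    using tableaux_eq_iff[OF \<alpha> s] w assms by (auto simp: transpose_def)
  moreover have "transpose u v w \<in> D" using w assms by (auto simp: transpose_def)
  ultimately show "(assignment T \<circ> transpose (s u) (s v)) (s w) = (T \<circ> transpose u v) w"
    by (simp add: assignment_entry)
qed

text \<open>Read along \<open>s\<close>, the coefficients of \<open>X\<close> form a
  \<open>singular_filling\<close>. Every row function \<open>g\<close> comes from the filling
  \<open>g \<circ> s\<close>, so nothing of \<open>X\<close> is lost.\<close>

lemma singular_vector_zero:
  fixes X :: "tabloid \<Rightarrow> 'f::field"
  assumes X: "X \<in> specht \<beta>" and two: "(2 :: 'f) \<noteq> 0"
    and swap: "\<And>i i' j. i < h j \<Longrightarrow> i' < h j \<Longrightarrow> i \<noteq> i' \<Longrightarrow>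
       perm_action (transpose (s (i, j)) (s (i', j))) X = scale (- 1) X"
    and gar: "\<And>r j k. ca < j \<Longrightarrow> r < h j \<Longrightarrow> k \<noteq> j \<Longrightarrow> h j \<le> h k \<Longrightarrow>
       X = (\<Sum>i<h k. perm_action (transpose (s (r, j)) (s (i, k))) X)"
    and top: "X (gtab \<beta> (assignment (chain UNIV))) = 0"
  shows "X = 0"
proof -
  have Xp: "X \<in> perm_module \<beta>" using X specht_subset_perm_module by blast
  have act: "perm_action (transpose (s u) (s v)) X (gtab \<beta> (assignment T)) = X (gtab \<beta> (assignment (T \<circ> transpose u v)))"
    if "u \<in> D" "v \<in> D" for u v T
    unfolding gtab_assignment_swap[OF that]
        by (rule perm_action_gtab[OF \<beta> transpose_permutes[OF \<alpha> s that]])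
  interpret singular_filling lam \<alpha> \<beta> n ra ca rb cb "\<lambda>T. X (gtab \<beta> (assignment T))"
  proof unfold_locales
    fix T T' :: "node \<Rightarrow> nat" assume "\<And>v. v \<in> D \<Longrightarrow> T v = T' v"
    then have "gtab \<beta> (assignment T) = gtab \<beta> (assignment T')"
      by (intro gtab_assignment) (simp add: assignment_entry)
    then show "X (gtab \<beta> (assignment T)) = X (gtab \<beta> (assignment T'))" by simp
  next
    fix T and d :: nat assume nz: "X (gtab \<beta> (assignment T)) \<noteq> 0"
    have "bij_betw s {v \<in> D. T v = d} {z \<in> {1..n}. assignment T z = d}"
    proof (rule bij_betw_imageI)
      show "inj_on s {v \<in> D. T v = d}" using tableaux_eq_iff[OF \<alpha> s] by (auto simp: inj_on_def)
      show "s ` {v \<in> D. T v = d} = {z \<in> {1..n}. assignment T z = d}"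
      proof (intro equalityI subsetI)
        fix z assume "z \<in> s ` {v \<in> D. T v = d}"
        then show "z \<in> {z \<in> {1..n}. assignment T z = d}"
          using tableaux_range[OF \<alpha> s] assignment_entry by force
      next
        fix z assume z: "z \<in> {z \<in> {1..n}. assignment T z = d}"
        then obtain v where "v \<in> D" "z = s v" using tableaux_surj[OF \<alpha> s, of z] by blast
        then show "z \<in> s ` {v \<in> D. T v = d}" using z assignment_entry by auto
      qed
    qed
    then show "card {v \<in> D. T v = d} = \<beta> d"
      using gtab_content[OF \<beta> Xp nz, of d] by (simp add: bij_betw_same_card)
  next
    fix i j i' T assume i: "i < h j" "i' < h j" "i \<noteq> i'"
    then show "X (gtab \<beta> (assignment (T \<circ> transpose (i, j) (i', j)))) = - X (gtab \<beta> (assignment T))"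
      using act[of "(i, j)" "(i', j)" T] swap[OF i] by (simp add: D_iff scale_def)
  next
    fix r j k T assume j: "ca < j" "r < h j" "k \<noteq> j" "h j \<le> h k"
    have "X (gtab \<beta> (assignment T)) = (\<Sum>i<h k. perm_action (transpose (s (r, j)) (s (i, k))) X (gtab \<beta> (assignment T)))"
      by (subst gar[OF j]) (simp only: sum_fun_apply)
    also have "\<dots> = (\<Sum>i<h k. X (gtab \<beta> (assignment (T \<circ> transpose (r, j) (i, k)))))"
      by (intro sum.cong refl act) (use j in \<open>simp_all add: D_iff\<close>)
    finally show "X (gtab \<beta> (assignment T)) = (\<Sum>i<h k. X (gtab \<beta> (assignment (T \<circ> transpose (r, j) (i, k)))))" .
  next
    fix d d' :: nat and T assume d: "d < d'"
    have "(\<Sum>v | v \<in> D \<and> T v = d. X (gtab \<beta> (assignment (T(v := d'))))) =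
        (\<Sum>z | z \<in> {1..n} \<and> assignment T z = d. X (gtab \<beta> ((assignment T)(z := d'))))"
    proof (rule sum.reindex_bij_witness[where i = "inv_into D s" and j = s])
      note b = tableaux_bij[OF \<alpha> s]
      fix v assume v: "v \<in> {v. v \<in> D \<and> T v = d}"
      show "inv_into D s (s v) = v" using v b by (simp add: bij_betw_def)
      show "s v \<in> {z. z \<in> {1..n} \<and> assignment T z = d}"
        using v assignment_entry tableaux_range[OF \<alpha> s, of v] by simp
      have "gtab \<beta> (assignment (T(v := d'))) = gtab \<beta> ((assignment T)(s v := d'))"
        by (rule gtab_assignment) (use v tableaux_eq_iff[OF \<alpha> s] assignment_entry in auto)
      then show "X (gtab \<beta> ((assignment T)(s v := d'))) = X (gtab \<beta> (assignment (T(v := d'))))" by simp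
    next
      note b = tableaux_bij[OF \<alpha> s]
      fix z assume z: "z \<in> {z. z \<in> {1..n} \<and> assignment T z = d}"
      then have zs: "z \<in> s ` D" using b by (simp add: bij_betw_def)
      show "s (inv_into D s z) = z" by (rule f_inv_into_f[OF zs])
      show "inv_into D s z \<in> {v. v \<in> D \<and> T v = d}"
        using inv_into_into[OF zs] z by (simp add: assignment_def)
    qed
    also have "\<dots> = 0" by (rule specht_raise[OF \<beta> X d])
    finally show "(\<Sum>v | v \<in> D \<and> T v = d. X (gtab \<beta> (assignment (T(v := d'))))) = 0" .
  qed (rule two)
  show ?thesis
  proof (rule perm_module_eqI[OF \<beta> Xp])
    show "(0 :: tabloid \<Rightarrow> 'f) \<in> perm_module \<beta>" by (simp add: perm_module_def)
    fix g
    have "X (gtab \<beta> (assignment (g \<circ> s))) = 0" by (rule singular_zero[OF top])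
    moreover have "gtab \<beta> (assignment (g \<circ> s)) = gtab \<beta> g" by (rule gtab_assignment) simp
    ultimately show "X (gtab \<beta> g) = 0 (gtab \<beta> g)" by simp
  qed
qed

lemma hom_image:
  fixes \<theta> :: "(tabloid \<Rightarrow> 'f::field) \<Rightarrow> tabloid \<Rightarrow> 'f"
  assumes \<theta>: "\<theta> \<in> sym_hom n (specht \<alpha>) (specht \<beta>)" and two: "(2 :: 'f) \<noteq> 0"
    and res: "(of_int (residue (rb, cb) - residue (ra, ca)) :: 'f) = 0"
  obtains c where "\<theta> (polytabloid \<alpha> s) = scale c (reduction (image_vector t))"
proof -
  let ?e = "polytabloid \<alpha> s :: tabloid \<Rightarrow> 'f"
  let ?T = "gtab \<beta> (assignment (chain UNIV))"
  \<comment> \<open>The only possible scalar, since the image vector has coefficient 1 at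
    \<open>?T\<close>.\<close>
  define c where "c = \<theta> ?e ?T"
  define X where "X = \<theta> ?e + scale (- c) (reduction (image_vector t))"
  have e: "?e \<in> specht \<alpha>" by (rule polytabloid_specht[OF s])
  have \<theta>e: "\<theta> ?e \<in> specht \<beta>" using \<theta> e unfolding sym_hom_def by blast
  have hom: "\<theta> (perm_action \<pi> ?e) = perm_action \<pi> (\<theta> ?e)" if "\<pi> permutes {1..n}" for \<pi>
    using \<theta> e that unfolding sym_hom_def by blast
  have "X = 0"
  proof (rule singular_vector_zero[OF _ two])
    show "X \<in> specht \<beta>" unfolding X_def
      using \<theta>e reduction_specht[OF image_vector_specht[OF t ta], where 'f = 'f]
      unfolding specht_def by (intro tabloid_module.span_add tabloid_module.span_scale)
    show "perm_action (transpose (s (i, j)) (s (i', j))) X = scale (- 1) X"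
      if i: "i < h j" "i' < h j" "i \<noteq> i'" for i i' j
    proof -
      let ?\<tau> = "transpose (s (i, j)) (s (i', j))"
      have tr: "?\<tau> permutes {1..n}"
        by (rule transpose_permutes[OF \<alpha> s]) (use i in \<open>simp_all add: D_iff\<close>)
      have "perm_action ?\<tau> (\<theta> ?e) = \<theta> (scale (- 1) ?e)"
        unfolding hom[OF tr, symmetric] column_swap_perm_action[OF \<alpha> s i] ..
      also have "\<dots> = scale (- 1) (\<theta> ?e)" using \<theta> e unfolding sym_hom_def by blast
      finally have 1: "perm_action ?\<tau> (\<theta> ?e) = scale (- 1) (\<theta> ?e)" .
      have "perm_action ?\<tau> (reduction (image_vector t)) = (reduction (scale (- 1) (image_vector t)) :: tabloid \<Rightarrow> 'f)"
        unfolding reduction_perm_action[symmetric] image_vector_column_swap[OF i] ..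
      then have 2: "perm_action ?\<tau> (reduction (image_vector t)) = (scale (- 1) (reduction (image_vector t)) :: tabloid \<Rightarrow> 'f)"
        unfolding reduction_scale by simp
      show ?thesis unfolding X_def perm_action_add perm_action_scale 1 2
        by (simp only: tabloid_module.scale_right_distrib tabloid_module.scale_left_commute)
    qed
    show "X = (\<Sum>i<h k. perm_action (transpose (s (r, j)) (s (i, k))) X)"
      if j: "ca < j" "r < h j" "k \<noteq> j" "h j \<le> h k" for r j k
    proof -
      let ?\<tau> = "\<lambda>i. transpose (s (r, j)) (s (i, k))"
      have tr: "?\<tau> i permutes {1..n}" if "i < h k" for i
        by (rule transpose_permutes[OF \<alpha> s]) (use j that in \<open>simp_all add: D_iff\<close>)
      have "\<theta> ?e = \<theta> (\<Sum>i<h k. perm_action (?\<tau> i) ?e)"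
        using garnir_perm_action[OF \<alpha> s j(2-4), where 'r = 'f] by (rule arg_cong)
      also have "\<dots> = (\<Sum>i<h k. \<theta> (perm_action (?\<tau> i) ?e))"
        by (rule sym_hom_sum[OF \<theta>]) (use perm_action_specht[OF \<alpha> tr e] in simp)
      also have "\<dots> = (\<Sum>i<h k. perm_action (?\<tau> i) (\<theta> ?e))"
        by (intro sum.cong refl hom tr) simp
      finally have 1: "\<theta> ?e = (\<Sum>i<h k. perm_action (?\<tau> i) (\<theta> ?e))" .
      obtain w where w: "image_vector t = (\<Sum>i<h k. perm_action (?\<tau> i) (image_vector t)) +
          scale (residue (rb, cb) - residue (ra, ca)) w"
        by (rule image_vector_garnir[OF j])
      have "reduction (image_vector t) = (reduction ((\<Sum>i<h k. perm_action (?\<tau> i) (image_vector t)) +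
          scale (residue (rb, cb) - residue (ra, ca)) w) :: tabloid \<Rightarrow> 'f)"
        by (rule arg_cong[OF w])
      also have "\<dots> = (\<Sum>i<h k. perm_action (?\<tau> i) (reduction (image_vector t)))"
        unfolding reduction_add reduction_sum reduction_scale res reduction_perm_action
        by (simp only: tabloid_module.scale_zero_left add_0_right)
      finally have 2: "reduction (image_vector t) = (\<Sum>i<h k. perm_action (?\<tau> i) (reduction (image_vector t)) :: tabloid \<Rightarrow> 'f)" .
      have "X = (\<Sum>i<h k. perm_action (?\<tau> i) (\<theta> ?e)) + scale (- c) (\<Sum>i<h k. perm_action (?\<tau> i) (reduction (image_vector t)))"
        unfolding X_def using 1 2 by (simp only: )
      then show ?thesis
        unfolding X_def perm_action_add perm_action_scale sum.distrib scale_sum .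
    qed
    have "image_vector t ?T = 1"
      by (rule image_vector_chain[OF t ta]) (simp add: st assignment_entry)
    then show "X ?T = 0" by (simp add: X_def c_def scale_def reduction_def)
  qed
  then have "\<theta> ?e = scale c (reduction (image_vector t))"
    unfolding X_def by (simp add: scale_def fun_eq_iff)
  then show ?thesis by (rule that)
qed

end

end

text \<open>If \<open>a\<close> were above \<open>b\<close>, the partial row sum through row
  \<open>ra\<close> would be smaller for \<alpha>. In a common row both nodes would have to be the
  last one, so they would coincide and the partitions would be equal.\<close>

lemma row_less_of_dominates:
  assumes P: "is_partition n \<alpha>" "is_partition n \<beta>" and ne: "\<alpha> \<noteq> \<beta>"
    and a: "(ra, ca) \<in> diagram lam" "diagram \<alpha> = diagram lam - {(ra, ca)}"
    and b: "(rb, cb) \<in> diagram lam" "diagram \<beta> = diagram lam - {(rb, cb)}"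
    and dom: "\<alpha> \<unrhd> \<beta>"
  shows "rb < ra"
proof (rule ccontr)
  assume "\<not> rb < ra"
  have row\<alpha>: "j < \<alpha> i \<longleftrightarrow> (i, j) \<in> diagram lam \<and> (i, j) \<noteq> (ra, ca)" for i j
    using a(2) by (auto simp: diagram_def)
  have row\<beta>: "j < \<beta> i \<longleftrightarrow> (i, j) \<in> diagram lam \<and> (i, j) \<noteq> (rb, cb)" for i j
    using b(2) by (auto simp: diagram_def)
  have eq: "\<alpha> i = \<beta> i" if "i \<noteq> ra" "i \<noteq> rb" for i
    by (rule eq_of_less) (use that in \<open>simp add: row\<alpha> row\<beta>\<close>)
  consider "ra < rb" | "ra = rb" "ca \<noteq> cb" | "(ra, ca) = (rb, cb)" using \<open>\<not> rb < ra\<close> by force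
  then show False
  proof cases
    case 1
    have "ca < \<beta> ra" "\<not> ca < \<alpha> ra" using 1 a(1) by (simp_all add: row\<alpha> row\<beta>)
    then have "(\<Sum>i<Suc ra. \<alpha> i) < (\<Sum>i<Suc ra. \<beta> i)" using 1 eq by (simp add: sum.lessThan_Suc)
    then show ?thesis
      using dom unfolding dominates_def by (simp add: not_le[symmetric] del: sum.lessThan_Suc)
  next
    case 2
    have "cb < \<alpha> ra" "\<not> ca < \<alpha> ra" "ca < \<beta> ra" "\<not> cb < \<beta> ra" using 2 a(1) b(1) by (auto simp: row\<alpha> row\<beta>)
    then show ?thesis by simp
  next
    case 3
    have "\<alpha> i = \<beta> i" for i
      by (rule eq_of_less) (use 3 in \<open>simp add: row\<alpha> row\<beta>\<close>)
    then show ?thesis using ne by blast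
  qed
qed

theorem theorem1p6:
  fixes lam \<alpha> \<beta> :: "nat \<Rightarrow> nat"
    and a b :: node
    and n p i :: nat
    and \<theta> :: "(tabloid \<Rightarrow> 'f::field) \<Rightarrow> tabloid \<Rightarrow> 'f"
  assumes "CHAR('f) = p" and "p > 2"
    and "is_partition (n + 1) lam" and "is_partition n \<alpha>" and "is_partition n \<beta>"
    and "\<alpha> \<noteq> \<beta>"
    and "a \<in> diagram lam" and "diagram \<alpha> = diagram lam - {a}"
    and "b \<in> diagram lam" and "diagram \<beta> = diagram lam - {b}"
    and "\<alpha> \<unrhd> \<beta>"
    and "\<theta> \<in> sym_hom n (specht \<alpha>) (specht \<beta>)"
    and "int p ^ i dvd residue a - residue b"
  shows "\<theta> ` specht \<alpha> \<subseteq> jantzen_submodule i \<beta>"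
proof -
  obtain ra ca rb cb where ab: "a = (ra, ca)" "b = (rb, cb)" by (cases a, cases b)
  note \<theta> = assms(12)
  interpret box_move lam \<alpha> \<beta> n ra ca rb cb
  proof
    show "rb < ra" by (rule row_less_of_dominates[OF assms(4-6) _ _ _ _ assms(11)]) (use assms(7-10) ab in simp_all)
  qed (use assms(3-5,7-10) ab in simp_all)
  have gen: "\<theta> (polytabloid \<alpha> s) \<in> jantzen_submodule i \<beta>" if s: "s \<in> tableaux \<alpha>" for s
  proof (cases "i = 0")
    \<comment> \<open>For \<open>i = 0\<close> the hypothesis gives no divisibility by
      \<open>p\<close>, but the Jantzen lattice is then the whole integral Specht module.\<close>
    case True
    have "\<theta> (polytabloid \<alpha> s) \<in> specht \<beta>" using \<theta> polytabloid_specht[OF s] unfolding sym_hom_def by blast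
    also have "specht \<beta> \<subseteq> (jantzen_submodule i \<beta> :: (tabloid \<Rightarrow> 'f) set)"
      unfolding specht_def jantzen_submodule_def
    proof (rule tabloid_module.span_mono, clarify)
      fix t assume t: "t \<in> tableaux \<beta>"
      have "(polytabloid \<beta> t :: tabloid \<Rightarrow> int) \<in> jantzen_lattice CHAR('f) i \<beta>"
        using polytabloid_specht[OF t] True by (simp add: jantzen_lattice_def)
      then show "polytabloid \<beta> t \<in> (reduction ` jantzen_lattice CHAR('f) i \<beta> :: (tabloid \<Rightarrow> 'f) set)"
        using reduction_polytabloid[of \<beta> t, where 'a = 'f] by (metis imageI)
    qed
    finally show ?thesis .
  next
    case False
    define t where "t = s((ra, ca) := Suc n)"
    have t: "t \<in> tableaux lam" "t (ra, ca) = Suc n" "\<And>v. v \<in> D \<Longrightarrow> t v = s v"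
      using extend_tableau[OF lam \<alpha> a_in diag_\<alpha> s] diag_\<alpha> by (auto simp: t_def)
    have "int p dvd int p ^ i" using False by simp
    then have "int p dvd residue (rb, cb) - residue (ra, ca)"
      using assms(13) ab by (metis dvd_diff_commute dvd_trans)
    then have res: "(of_int (residue (rb, cb) - residue (ra, ca)) :: 'f) = 0"
      unfolding of_int_eq_0_iff_char_dvd assms(1) .
    have two: "(2 :: 'f) \<noteq> 0"
    proof
      assume "(2 :: 'f) = 0"
      then have "(of_nat 2 :: 'f) = 0" by simp
      then have "p dvd 2" unfolding of_nat_eq_0_iff_char_dvd assms(1) .
      then show False using assms(2) by (auto dest: dvd_imp_le)
    qed
    obtain c where c: "\<theta> (polytabloid \<alpha> s) = scale c (reduction (image_vector t))"
      using hom_image[OF s t \<theta> two res] by blast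
    have "image_vector t \<in> jantzen_lattice CHAR('f) i \<beta>"
      by (rule image_vector_jantzen[OF t(1,2)]) (use assms(1,13) ab in simp)
    then show ?thesis
      unfolding c jantzen_submodule_def
          by (intro tabloid_module.span_scale tabloid_module.span_base imageI)
  qed
  \<comment> \<open>Membership in the Specht module is carried through the induction because
    \<theta> is additive only there.\<close>
  have "\<theta> x \<in> jantzen_submodule i \<beta> \<and> x \<in> specht \<alpha>" if "x \<in> specht \<alpha>" for x
    using that[unfolded specht_def]
  proof (induction x rule: tabloid_module.span_induct_alt)
    case base
    show ?case
      unfolding sym_hom_zero[OF \<theta>] jantzen_submodule_def specht_def
          by (simp only: tabloid_module.span_zero)
  next
    case (step c x y)
    then obtain s where s: "s \<in> tableaux \<alpha>" "x = polytabloid \<alpha> s" by blast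
    have x: "x \<in> specht \<alpha>" unfolding s(2) by (rule polytabloid_specht[OF s(1)])
    have cx: "scale c x \<in> specht \<alpha>" using x unfolding specht_def by (rule tabloid_module.span_scale)
    have "\<theta> (scale c x + y) = scale c (\<theta> x) + \<theta> y"
      using \<theta> x cx step.IH unfolding sym_hom_def by simp
    moreover have "scale c (\<theta> x) + \<theta> y \<in> jantzen_submodule i \<beta>"
      using gen[OF s(1)] step.IH unfolding s(2) jantzen_submodule_def
      by (intro tabloid_module.span_add tabloid_module.span_scale) auto
    moreover have "scale c x + y \<in> specht \<alpha>"
      using cx step.IH unfolding specht_def by (intro tabloid_module.span_add) auto
    ultimately show ?case by (simp only: simp_thms)
  qed
  then show ?thesis by blast
qed

end
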